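(* Let $n\ge 3$, $\alpha<1$, $p\in(1,\infty]$ and let $q\in[1,\infty)$ be its conjugate exponent ($1/p+1/q=1$). Let $\phi\in L^{p}(\mathbb{S}^{n-1},\mathbb{R})$ and $u=P_\alpha[\phi]$ in $\mathbb{B}^n$. Then for every $x\in\mathbb{B}^n$, $$|\nabla u(x)|\le \frac{(n-\alpha)C_{n,\alpha}}{(1-|x|^2)^{\frac{n(q-1)+1}{q}}}\Big(\sup_{l\in\mathbb{S}^{n-1}} I(\alpha,q,x,l)+J(\alpha,q,x)\Big)^{1/q}\|\phi\|_{L^p(\mathbb{S}^{n-1},\mathbb{R})},$$ where $$I(\alpha,q,x,l)=\int_{\mathbb{S}^{n-1}}|\eta-x|^{(n-\alpha)q-2n+2}|\langle \eta,l\rangle|^q\,d\sigma(\eta),$$ $$J(\alpha,q,x)=q|x|\frac{|2-\alpha-n|}{n-\alpha}\Big(1+\frac{|2-\alpha-n|}{n-\alpha}|x|\Big)^{q-1}{}_2F_1\Big(n-1-\tfrac{q(n-\alpha)}{2},\ \tfrac{n-q(n-\alpha)}{2};\ \tfrac n2;\ |x|^2\Big).$$ Moreover, if $x=0$ or $\alpha=2-n$, the coefficient of $\|\phi\|_{L^p}$ on the right-hand side equals the optimal constant $\mathbf{C}_{\alpha,q}(x)$, i.e. the inequality is sharp.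
   Context: Throughout, $n\ge3$, $\mathbb{B}^n$ is the open unit ball of $\mathbb{R}^n$, $\mathbb{S}^{n-1}$ its boundary sphere, and $\sigma$ the normalized surface measure on $\mathbb{S}^{n-1}$ ($\sigma(\mathbb{S}^{n-1})=1$); $L^p$ norms on $\mathbb{S}^{n-1}$ are with respect to $\sigma$. For $\alpha<1$, the Poisson–Szegő kernel is $P_\alpha(x,\zeta)=C_{n,\alpha}\frac{(1-|x|^2)^{1-\alpha}}{|x-\zeta|^{n-\alpha}}$ ($x\in\mathbb{B}^n,\zeta\in\mathbb{S}^{n-1}$) with $C_{n,\alpha}=\frac{\Gamma(\frac{n-\alpha}{2})\Gamma(1-\frac\alpha2)}{\Gamma(\frac n2)\Gamma(1-\alpha)}$, and for $\phi\in L^p(\mathbb{S}^{n-1},\mathbb{R}^m)$, $p\in[1,\infty]$, $P_\alpha[\phi](x)=\int_{\mathbb{S}^{n-1}}P_\alpha(x,\zeta)\phi(\zeta)\,d\sigma(\zeta)$. For $p\in[1,\infty]$ with conjugate exponent $q$, $x\in\mathbb{B}^n$ and $l\in\mathbb{S}^{n-1}$, $\mathbf{C}_{\alpha,q}(x)$ (resp. $\mathbf{C}_{\alpha,q}(x;l)$) denotes the smallest constant such that $|\nabla u(x)|\le \mathbf{C}_{\alpha,q}(x)\|\phi\|_{L^p(\mathbb{S}^{n-1},\mathbb{R})}$ (resp. $|\langle\nabla u(x),l\rangle|\le \mathbf{C}_{\alpha,q}(x;l)\|\phi\|_{L^p(\mathbb{S}^{n-1},\mathbb{R})}$) for all $\phi\in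 L^p(\mathbb{S}^{n-1},\mathbb{R})$, where $u=P_\alpha[\phi]$. ${}_2F_1$ denotes the Gauss hypergeometric series $\sum_{k\ge0}\frac{(a)_k(b)_k}{(c)_k}\frac{s^k}{k!}$ with $(a)_k$ the Pochhammer symbol. *)

theory Defs
  imports "HOL-Analysis.Analysis" "HOL-Probability.Probability"
begin

text \<open>Normalized surface measure on the unit sphere of a Euclidean space, obtained as the
  push-forward of the normalized Lebesgue measure on the punctured unit ball under radial
  projection (this is the normalized rotation-invariant surface measure).\<close>
definition sphere_measure :: "'a::euclidean_space measure" where
  "sphere_measure = distr (uniform_measure lborel (ball 0 1 - {0}))
      (restrict_space borel (sphere 0 1)) sgn"

definition in_Lp :: "'a measure \<Rightarrow> ereal \<Rightarrow> ('a \<Rightarrow> real) \<Rightarrow> bool" where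
  "in_Lp M p f \<longleftrightarrow> f \<in> borel_measurable M \<and>
     (if p = \<infinity> then esssup M (\<lambda>x. ereal \<bar>f x\<bar>) < \<infinity>
      else integrable M (\<lambda>x. \<bar>f x\<bar> powr real_of_ereal p))"

definition Lp_norm :: "'a measure \<Rightarrow> ereal \<Rightarrow> ('a \<Rightarrow> real) \<Rightarrow> real" where
  "Lp_norm M p f = (if p = \<infinity> then real_of_ereal (esssup M (\<lambda>x. ereal \<bar>f x\<bar>))
     else (\<integral>x. \<bar>f x\<bar> powr real_of_ereal p \<partial>M) powr (1 / real_of_ereal p))"

definition PS_const :: "nat \<Rightarrow> real \<Rightarrow> real" where
  "PS_const n \<alpha> = Gamma ((real n - \<alpha>) / 2) * Gamma (1 - \<alpha> / 2) /
     (Gamma (real n / 2) * Gamma (1 - \<alpha>))"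

definition PS_kernel :: "real \<Rightarrow> 'a::euclidean_space \<Rightarrow> 'a \<Rightarrow> real" where
  "PS_kernel \<alpha> x \<zeta> = PS_const DIM('a) \<alpha> * (1 - (norm x)\<^sup>2) powr (1 - \<alpha>) /
     norm (x - \<zeta>) powr (real DIM('a) - \<alpha>)"

definition PS_integral :: "real \<Rightarrow> ('a::euclidean_space \<Rightarrow> real) \<Rightarrow> 'a \<Rightarrow> real" where
  "PS_integral \<alpha> \<phi> x = (\<integral>\<zeta>. PS_kernel \<alpha> x \<zeta> * \<phi> \<zeta> \<partial>sphere_measure)"

text \<open>Gradient of a real function at a point (meaningful where it is differentiable).\<close>
definition grad :: "('a::euclidean_space \<Rightarrow> real) \<Rightarrow> 'a \<Rightarrow> 'a" where
  "grad u x = (SOME g. GDERIV u x :> g)"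

definition hyp2F1 :: "real \<Rightarrow> real \<Rightarrow> real \<Rightarrow> real \<Rightarrow> real" where
  "hyp2F1 a b c s = (\<Sum>k. pochhammer a k * pochhammer b k / pochhammer c k * s ^ k / fact k)"

text \<open>The optimal constant C_{alpha,q}(x), where p is the exponent conjugate to q.\<close>
definition opt_const :: "real \<Rightarrow> ereal \<Rightarrow> 'a::euclidean_space \<Rightarrow> real" where
  "opt_const \<alpha> p x = Inf {K. \<forall>\<phi>. in_Lp sphere_measure p \<phi> \<longrightarrow>
      norm (grad (PS_integral \<alpha> \<phi>) x) \<le> K * Lp_norm sphere_measure p \<phi>}"

definition I_fun :: "real \<Rightarrow> real \<Rightarrow> 'a::euclidean_space \<Rightarrow> 'a \<Rightarrow> real" where
  "I_fun \<alpha> q x l = (\<integral>\<eta>. norm (\<eta> - x) powr ((real DIM('a) - \<alpha>) * q - 2 * real DIM('a) + 2)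
      * \<bar>inner \<eta> l\<bar> powr q \<partial>sphere_measure)"

definition J_fun :: "real \<Rightarrow> real \<Rightarrow> 'a::euclidean_space \<Rightarrow> real" where
  "J_fun \<alpha> q x = (let n = real DIM('a); r = norm x; c = \<bar>2 - \<alpha> - n\<bar> / (n - \<alpha>) in
      q * r * c * (1 + c * r) powr (q - 1) *
      hyp2F1 (n - 1 - q * (n - \<alpha>) / 2) ((n - q * (n - \<alpha>)) / 2) (n / 2) (r\<^sup>2))"

definition grad_bound :: "real \<Rightarrow> real \<Rightarrow> 'a::euclidean_space \<Rightarrow> real" where
  "grad_bound \<alpha> q x = (let n = real DIM('a) in
     (n - \<alpha>) * PS_const DIM('a) \<alpha> / (1 - (norm x)\<^sup>2) powr ((n * (q - 1) + 1) / q) *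
     ((SUP l\<in>sphere 0 1. I_fun \<alpha> q x l) + J_fun \<alpha> q x) powr (1 / q))"

end

theory Submission
  imports Defs "HOL-Real_Asymp.Real_Asymp"
begin

text \<open>
  For \<open>norm x < 1\<close> let \<open>chord x\<close> be the involution of the unit sphere exchanging the endpoints of each
  chord through \<open>x\<close>. Writing \<open>\<eta> = chord x \<zeta>\<close>, the gradient of the kernel at \<open>x\<close> is a scalar multiple of
  \<open>\<eta> + c *\<^sub>R x\<close> with \<open>c = (2 - \<alpha> - n) / (n - \<alpha>)\<close>. By duality the optimal constant is the supremum over
  unit vectors \<open>l\<close> of the \<open>L\<^sup>q\<close> norm of its component along \<open>l\<close>; substituting \<open>\<zeta> = chord x \<eta>\<close> turns this
  into the integral of \<open>norm (\<eta> - x) powr ((n - \<alpha>) * q - 2 * n + 2) * \<bar>(\<eta> + c *\<^sub>R x) \<bullet> l\<bar> powr q\<close>. When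
  \<open>c *\<^sub>R x = 0\<close> this is \<open>I_fun\<close>; otherwise the error is bounded by convexity and is a multiple of the
  integral of a power of \<open>norm (\<eta> - x)\<close>, which is a hypergeometric function of \<open>(norm x)\<^sup>2\<close>.

  The Jacobian of \<open>chord x\<close> comes from the change of variables formula on the ball: with
  \<open>recenter x y = y - norm y *\<^sub>R x\<close> the homogeneous extension satisfies
  \<open>recenter x (chord x y) = k y *\<^sub>R recenter x y\<close> with \<open>k\<close> homogeneous of degree 0, and both sides have
  derivatives whose determinants are those of rank one perturbations of scalar maps.
\<close>

section \<open>Change of variables in Euclidean spaces\<close>

text \<open>The constant \<open>c\<close> appears when the direction \<open>x - \<zeta>\<close> in
  the gradient of the kernel is traded for the endpoint \<open>chord x \<zeta>\<close>: a multiple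
  of \<open>x\<close> is left over. It vanishes exactly for \<open>\<alpha> = 2 - n\<close>, where
  the kernel is the hyperbolic Poisson kernel
  \<open>((1 - |x|^2) / |x - \<zeta>|^2)^(n - 1)\<close>. Together with \<open>x = 0\<close> this is
  the case in which nothing has to be estimated after the duality step, hence the two cases of the
  sharpness claim. As \<open>sphere_measure\<close> comes from the ball, the sphere is handled
  without charts: a map of the sphere is extended to the punctured ball with degree 1, and for a
  norm-preserving extension the surface Jacobian is the full determinant. The invariance formula for
  \<open>chord x\<close> serves twice, once for the substitution and once differentiated at
  \<open>x = 0\<close>, where it becomes integration by parts on the sphere. The latter yields a
  second order equation for the power means of \<open>norm (\<eta> - x)\<close>, and this equation
  is what identifies them with a hypergeometric function.\<close>

text \<open>The change of variables theorem of the library is stated for \<open>real ^ 'n\<close> with a finite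
  well-ordered index type; \<open>'a coord\<close> is such a type with \<open>DIM('a)\<close> elements.\<close>

typedef (overloaded) 'a coord = "{..<DIM('a::euclidean_space)}"
  by (rule exI[of _ 0]) simp

instantiation coord :: (euclidean_space) wellorder
begin

definition less_eq_coord :: "'a coord \<Rightarrow> 'a coord \<Rightarrow> bool" where
  "i \<le> j \<longleftrightarrow> Rep_coord i \<le> Rep_coord j"

definition less_coord :: "'a coord \<Rightarrow> 'a coord \<Rightarrow> bool" where
  "i < j \<longleftrightarrow> Rep_coord i < Rep_coord j"

instance
proof
  fix P :: "'a coord \<Rightarrow> bool" and i
  assume step: "\<And>i. (\<And>j. j < i \<Longrightarrow> P j) \<Longrightarrow> P i"
  show "P i"
    by (induction i rule: measure_induct_rule[where f = Rep_coord])
      (use step in \<open>auto simp: less_coord_def\<close>)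
qed (auto simp: less_eq_coord_def less_coord_def Rep_coord_inject)

end

instance coord :: (euclidean_space) finite
proof
  have "(UNIV :: 'a coord set) = Abs_coord ` {..<DIM('a)}"
    by (metis type_definition.Abs_image type_definition_coord)
  then show "finite (UNIV :: 'a coord set)"
    by (metis finite_imageI finite_lessThan)
qed

section \<open>Orthonormal coordinates and Lebesgue measure\<close>

definition coord_basis :: "'a::euclidean_space coord \<Rightarrow> 'a" where
  "coord_basis = (SOME f. bij_betw f UNIV Basis)"

lemma bij_coord_basis: "bij_betw coord_basis UNIV (Basis :: 'a::euclidean_space set)"
proof -
  have "bij_betw Rep_coord (UNIV :: 'a coord set) {..<DIM('a)}"
    by (metis UNIV_I bij_betw_def inj_on_def type_definition.Rep_inject
        type_definition.Rep_range type_definition_coord)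
  then have "card (UNIV :: 'a coord set) = DIM('a)"
    by (simp add: bij_betw_same_card)
  then have "\<exists>f :: 'a coord \<Rightarrow> 'a. bij_betw f UNIV Basis"
    by (intro finite_same_card_bij) auto
  then show ?thesis
    unfolding coord_basis_def by (rule someI_ex)
qed

lemma coord_basis_in_Basis [simp]: "coord_basis i \<in> Basis"
  using bij_coord_basis by (auto simp: bij_betw_def)

lemma card_coord: "CARD('a::euclidean_space coord) = DIM('a)"
  using bij_betw_same_card[OF bij_coord_basis] .

lemma inner_coord_basis: "coord_basis i \<bullet> coord_basis j = (if i = j then 1 else 0)"
  using bij_coord_basis by (auto simp: inner_Basis bij_betw_def inj_on_def)

definition of_coords :: "real ^ 'a::euclidean_space coord \<Rightarrow> 'a" where
  "of_coords v = (\<Sum>i\<in>UNIV. (v $ i) *\<^sub>R coord_basis i)"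

definition to_coords :: "'a::euclidean_space \<Rightarrow> real ^ 'a coord" where
  "to_coords y = (\<chi> i. y \<bullet> coord_basis i)"

lemma of_coords_inner_basis: "of_coords v \<bullet> coord_basis i = v $ i"
  unfolding of_coords_def inner_sum_left inner_scaleR_left inner_coord_basis
  by (subst sum.remove[of _ i]) auto

lemma to_of_coords [simp]: "to_coords (of_coords v) = v"
  by (simp add: to_coords_def of_coords_inner_basis vec_eq_iff)

lemma of_to_coords [simp]: "of_coords (to_coords y) = y"
proof (rule euclidean_eqI)
  fix b :: 'a assume "b \<in> Basis"
  then obtain i where "b = coord_basis i"
    using bij_coord_basis unfolding bij_betw_def by blast
  then show "of_coords (to_coords y) \<bullet> b = y \<bullet> b"
    by (simp add: of_coords_inner_basis to_coords_def)
qed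

lemma inner_to_coords: "to_coords u \<bullet> to_coords v = u \<bullet> v"
proof -
  have "u \<bullet> v = (\<Sum>b\<in>Basis. (u \<bullet> b) * (v \<bullet> b))"
    by (rule euclidean_inner)
  also have "\<dots> = (\<Sum>i\<in>UNIV. (u \<bullet> coord_basis i) * (v \<bullet> coord_basis i))"
    by (rule sum.reindex_bij_betw[OF bij_coord_basis, symmetric])
  finally show ?thesis
    by (simp add: inner_vec_def to_coords_def)
qed

lemma linear_to_coords: "linear to_coords"
  by (rule linearI) (simp_all add: to_coords_def vec_eq_iff inner_add_left)

lemma linear_of_coords: "linear of_coords"
  by (rule linearI)
    (simp_all add: of_coords_def scaleR_left_distrib sum.distrib scaleR_right.sum)

lemma borel_measurable_of_coords [measurable]: "of_coords \<in> borel_measurable borel"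
  by (intro borel_measurable_continuous_onI linear_continuous_on linear_linear[THEN iffD2] linear_of_coords)

lemma borel_measurable_to_coords [measurable]: "to_coords \<in> borel_measurable borel"
  by (intro borel_measurable_continuous_onI linear_continuous_on linear_linear[THEN iffD2] linear_to_coords)

text \<open>Lebesgue measure is characterised by the volumes of boxes, and orthonormal coordinates
  carry boxes to boxes with the same side lengths.\<close>

lemma lborel_eq_distr_of_coords: "lborel = distr lborel borel (of_coords :: _ \<Rightarrow> 'a::euclidean_space)"
proof (rule lborel_eqI)
  fix l u :: 'a
  assume lu: "\<And>b. b \<in> Basis \<Longrightarrow> l \<bullet> b \<le> u \<bullet> b"
  have box: "of_coords -` box l u = box (to_coords l) (to_coords u)"
  proof (intro set_eqI iffI)
    fix v assume v: "v \<in> of_coords -` box l u"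
    then show "v \<in> box (to_coords l) (to_coords u)"
      by (auto simp: mem_box Basis_vec_def inner_axis to_coords_def of_coords_inner_basis
          dest: bspec[of _ _ "coord_basis _"])
  next
    fix v assume v: "v \<in> box (to_coords l) (to_coords u)"
    show "v \<in> of_coords -` box l u"
      unfolding vimage_eq mem_box
    proof
      fix b :: 'a assume "b \<in> Basis"
      then obtain i where b: "b = coord_basis i"
        using bij_coord_basis unfolding bij_betw_def by blast
      have "axis i 1 \<in> (Basis :: (real ^ 'a coord) set)"
        by (auto simp: Basis_vec_def)
      then have "to_coords l $ i < v $ i \<and> v $ i < to_coords u $ i"
        using v unfolding mem_box by (metis inner_axis inner_real_def mult.right_neutral)
      then show "l \<bullet> b < of_coords v \<bullet> b \<and> of_coords v \<bullet> b < u \<bullet> b"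
        by (simp add: b of_coords_inner_basis to_coords_def)
    qed
  qed
  have "(\<Prod>b\<in>Basis. (to_coords u - to_coords l) \<bullet> b) = (\<Prod>i\<in>UNIV. (u - l) \<bullet> coord_basis i)"
    by (subst prod.reindex_bij_betw[of "\<lambda>i. axis i 1" UNIV, symmetric])
      (auto simp: Basis_vec_def bij_betw_def inj_on_def axis_eq_axis inner_axis to_coords_def inner_diff_left)
  also have "\<dots> = (\<Prod>b\<in>Basis. (u - l) \<bullet> b)"
    by (rule prod.reindex_bij_betw[OF bij_coord_basis])
  finally have prod: "(\<Prod>b\<in>Basis. (to_coords u - to_coords l) \<bullet> b) = (\<Prod>b\<in>Basis. (u - l) \<bullet> b)" .
  have "emeasure (distr lborel borel of_coords) (box l u) = emeasure lborel (box (to_coords l) (to_coords u))"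
    by (simp add: emeasure_distr box)
  also have "\<dots> = ennreal (\<Prod>b\<in>Basis. (to_coords u - to_coords l) \<bullet> b)"
    by (rule emeasure_lborel_box) (auto simp: Basis_vec_def inner_axis to_coords_def lu)
  finally show "emeasure (distr lborel borel of_coords) (box l u) = ennreal (\<Prod>b\<in>Basis. (u - l) \<bullet> b)"
    unfolding prod .
qed simp

section \<open>Determinants of endomorphisms and rank one perturbations\<close>

definition ldet :: "('a::euclidean_space \<Rightarrow> 'a) \<Rightarrow> real" where
  "ldet f = det (matrix (to_coords \<circ> f \<circ> of_coords))"

lemma ldet_compose:
  assumes "linear f" "linear g"
  shows "ldet (f \<circ> g) = ldet f * ldet g"
proof -
  have *: "to_coords \<circ> (f \<circ> g) \<circ> of_coords = (to_coords \<circ> f \<circ> of_coords) \<circ> (to_coords \<circ> g \<circ> of_coords)"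
    by (auto simp: fun_eq_iff)
  have "linear (to_coords \<circ> f \<circ> of_coords)" "linear (to_coords \<circ> g \<circ> of_coords)"
    by (intro linear_compose linear_of_coords linear_to_coords assms)+
  then show ?thesis
    unfolding ldet_def * by (subst matrix_compose) (simp_all add: det_mul)
qed

text \<open>The matrix determinant lemma. Conjugation with an orthogonal \<open>Q\<close> that sends
  the axis \<open>k\<close> to the direction of \<open>b\<close> keeps the determinant and confines
  the perturbation to column \<open>k\<close>, where Cramer's rule reads it off.\<close>

lemma det_matrix_add_rank_one:
  fixes a b :: "real ^ 'n"
  shows "det (matrix (\<lambda>v. v + (b \<bullet> v) *\<^sub>R a)) = 1 + a \<bullet> b"
proof (cases "b = 0")
  case True
  then show ?thesis
    by (simp add: matrix_id[unfolded id_def])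
next
  case False
  obtain k :: 'n where True by simp
  define f where "f = (\<lambda>v. v + (b \<bullet> v) *\<^sub>R a)"
  have "linear f"
    by (rule linearI) (auto simp: f_def inner_add_right algebra_simps)
  have "norm (sgn b) = 1"
    using False by (simp add: norm_sgn)
  then obtain Q where Q: "orthogonal_matrix Q" "Q *v axis k 1 = sgn b"
    using orthogonal_matrix_exists_basis by metis
  define h where "h = (\<lambda>v. Q *v v)"
  define h' where "h' = (\<lambda>v. transpose Q *v v)"
  have hh': "h' (h v) = v" for v
    using Q unfolding h_def h'_def matrix_vector_mul_assoc by (simp add: orthogonal_matrix)
  have inner_h: "h u \<bullet> h v = u \<bullet> v" for u v
    using Q by (metis h_def matrix_of_matrix_vector_mul matrix_vector_mul_linear
        orthogonal_transformation_def orthogonal_transformation_matrix)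
  have lin: "linear h" "linear h'"
    unfolding h_def h'_def by (simp_all add: matrix_vector_mul_linear)
  have bh: "b = norm b *\<^sub>R h (axis k 1)"
    using False by (simp add: h_def Q sgn_div_norm)
  define a' where "a' = h' a"
  have "h' \<circ> f \<circ> h = (\<lambda>v. v + (norm b * (v $ k)) *\<^sub>R a')"
  proof
    fix v
    have "b \<bullet> h v = norm b * (v $ k)"
      by (subst bh) (simp add: inner_h inner_axis')
    then show "(h' \<circ> f \<circ> h) v = v + (norm b * (v $ k)) *\<^sub>R a'"
      by (simp add: f_def a'_def linear_add[OF lin(2)] linear_scale[OF lin(2)] hh')
  qed
  \<comment> \<open>The conjugate is the identity with column \<open>k\<close> replaced. The new
    column is written as \<open>mat 1\<close> applied to a vector to fit the shape of
    \<open>cramer_lemma\<close>.\<close>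
  then have "matrix (h' \<circ> f \<circ> h) = (\<chi> i j. if j = k then (mat 1 *v (axis k 1 + norm b *\<^sub>R a')) $ i else mat 1 $ i $ j)"
    unfolding matrix_vector_mul_lid by (auto simp: vec_eq_iff matrix_def axis_def mat_def)
  then have "det (matrix (h' \<circ> f \<circ> h)) = (axis k 1 + norm b *\<^sub>R a') $ k"
    by (simp only: cramer_lemma det_I mult_1_right)
  also have "\<dots> = 1 + a \<bullet> b"
  proof -
    have "a = h a'"
      using Q unfolding h_def a'_def h'_def matrix_vector_mul_assoc by (simp add: orthogonal_matrix_def)
    then have "a \<bullet> b = norm b * (h a' \<bullet> h (axis k 1))"
      using bh by (metis inner_scaleR_right)
    then show ?thesis
      by (simp add: inner_h inner_axis)
  qed
  finally have "det (matrix (h' \<circ> f \<circ> h)) = 1 + a \<bullet> b" .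
  moreover have "det (matrix (h' \<circ> f \<circ> h)) = det (matrix h' ** matrix h) * det (matrix f)"
    using lin \<open>linear f\<close> by (simp add: matrix_compose linear_compose det_mul)
  moreover have "matrix h' ** matrix h = mat 1"
  proof -
    have "h' \<circ> h = id"
      using hh' by auto
    then show ?thesis
      using lin by (metis matrix_compose matrix_id_mat_1)
  qed
  ultimately show ?thesis
    by (simp add: f_def)
qed

lemma ldet_add_rank_one:
  fixes a b :: "'a::euclidean_space"
  shows "ldet (\<lambda>v. v + (b \<bullet> v) *\<^sub>R a) = 1 + a \<bullet> b"
proof -
  have "to_coords \<circ> (\<lambda>v. v + (b \<bullet> v) *\<^sub>R a) \<circ> of_coords =
      (\<lambda>v. v + (to_coords b \<bullet> v) *\<^sub>R to_coords a)"
  proof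
    fix v :: "real ^ 'a coord"
    have "b \<bullet> of_coords v = to_coords b \<bullet> v"
      by (metis inner_to_coords to_of_coords)
    then show "(to_coords \<circ> (\<lambda>v. v + (b \<bullet> v) *\<^sub>R a) \<circ> of_coords) v = v + (to_coords b \<bullet> v) *\<^sub>R to_coords a"
      by (simp add: linear_add[OF linear_to_coords] linear_scale[OF linear_to_coords])
  qed
  then show ?thesis
    by (simp add: ldet_def det_matrix_add_rank_one inner_to_coords)
qed

lemma ldet_scaleR: "ldet (\<lambda>v :: 'a::euclidean_space. s *\<^sub>R v) = s ^ DIM('a)"
proof -
  have "to_coords \<circ> (\<lambda>v :: 'a. s *\<^sub>R v) \<circ> of_coords = (\<lambda>v. s *\<^sub>R v)"
    by (auto simp: fun_eq_iff linear_scale[OF linear_to_coords])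
  then show ?thesis
    by (simp add: ldet_def det_matrix_scaleR card_coord)
qed

text \<open>Transport of \<open>has_absolute_integral_change_of_variables\<close> along
  \<open>of_coords\<close>. The Jacobian is passed as a separate Borel function \<open>D\<close>,
  because \<open>g'\<close> comes without any measurability and is a derivative only on
  \<open>S\<close>.\<close>

lemma integral_lborel_change_of_variables:
  fixes g :: "'a::euclidean_space \<Rightarrow> 'a" and f D :: "'a \<Rightarrow> real"
  assumes S: "S \<in> sets borel"
    and der: "\<And>y. y \<in> S \<Longrightarrow> (g has_derivative g' y) (at y)"
    and inj: "inj_on g S" and im: "g ` S \<in> sets borel"
    and g [measurable]: "g \<in> borel_measurable borel"
    and D [measurable]: "D \<in> borel_measurable borel"
    and f [measurable]: "f \<in> borel_measurable borel"
    and det: "\<And>y. y \<in> S \<Longrightarrow> \<bar>ldet (g' y)\<bar> = D y"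
    and int: "set_integrable lborel (g ` S) f"
  shows "(LINT y:S|lborel. D y * f (g y)) = (LINT y:g ` S|lborel. f y)"
proof -
  note [measurable] = S im
  define G where "G = to_coords \<circ> g \<circ> of_coords"
  define G' where "G' = (\<lambda>v. to_coords \<circ> g' (of_coords v) \<circ> of_coords)"
  define T :: "(real ^ 'a coord) set" where "T = of_coords -` S"
  \<comment> \<open>Real values are embedded in \<open>real ^ 1\<close>, since the theorem applied
    below concerns integrands with values in a space \<open>real ^ 'n\<close>.\<close>
  define F :: "real ^ 'a coord \<Rightarrow> real ^ 1" where "F = (\<lambda>v. vec (f (of_coords v)))"
  have bij: "bij (of_coords :: _ \<Rightarrow> 'a)"
    by (metis bij_betw_def inj_def of_to_coords surj_def to_of_coords)
  have T [measurable]: "T \<in> sets borel"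
    unfolding T_def using measurable_sets[OF borel_measurable_of_coords S] by simp
  have GT: "G ` T = of_coords -` (g ` S)"
  proof (intro set_eqI iffI)
    fix v assume "v \<in> G ` T"
    then show "v \<in> of_coords -` (g ` S)" by (auto simp: G_def T_def)
  next
    fix v assume "v \<in> of_coords -` (g ` S)"
    then obtain y where "y \<in> S" "of_coords v = g y" by auto
    then have "v = G (to_coords y)" "to_coords y \<in> T"
      by (simp_all add: G_def T_def) (metis to_of_coords)
    then show "v \<in> G ` T" by blast
  qed
  then have GT_sets [measurable]: "G ` T \<in> sets borel"
    using measurable_sets[OF borel_measurable_of_coords im] by simp
  have [measurable]: "G \<in> borel_measurable borel"
    unfolding G_def by measurable
  have derG: "(G has_derivative G' v) (at v within T)" if "v \<in> T" for v
  proof -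
    have "(of_coords has_derivative of_coords) (at v within T)"
      by (simp add: linear_imp_has_derivative linear_of_coords)
    moreover have "(g has_derivative g' (of_coords v)) (at (of_coords v) within (of_coords ` T))"
      using der that by (auto simp: T_def intro: has_derivative_at_withinI)
    ultimately have "((g \<circ> of_coords) has_derivative (g' (of_coords v) \<circ> of_coords)) (at v within T)"
      by (rule diff_chain_within)
    moreover have "(to_coords has_derivative to_coords) (at ((g \<circ> of_coords) v) within ((g \<circ> of_coords) ` T))"
      by (simp add: linear_imp_has_derivative linear_to_coords)
    ultimately show ?thesis
      unfolding G_def G'_def o_assoc[symmetric] by (rule diff_chain_within)
  qed
  have injG: "inj_on G T"
  proof (rule inj_onI)
    fix u v assume uv: "u \<in> T" "v \<in> T" "G u = G v"
    then have "g (of_coords u) = g (of_coords v)"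
      unfolding G_def by (metis comp_apply of_to_coords)
    then have "of_coords u = of_coords v"
      using uv inj by (auto simp: T_def inj_on_def)
    then show "u = v"
      by (metis to_of_coords)
  qed
  have Fg: "F (G v) = vec (f (g (of_coords v)))" for v
    by (simp add: F_def G_def)
  have detG: "\<bar>det (matrix (G' v))\<bar> = D (of_coords v)" if "v \<in> T" for v
    using det that by (simp add: T_def G'_def ldet_def)
  have meas_vec: "(\<lambda>v. vec (h v) :: real ^ 1) \<in> borel_measurable borel" if "h \<in> borel_measurable borel"
    for h :: "real ^ 'a coord \<Rightarrow> real"
    using that by (subst borel_measurable_euclidean_space) (auto simp: Basis_vec_def inner_axis)
  have set_int: "set_integrable lborel (of_coords -` A) (h \<circ> of_coords) \<longleftrightarrow> set_integrable lborel A h"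
    and int_eq: "(LINT v:of_coords -` A|lborel. h (of_coords v)) = (LINT y:A|lborel. h y)"
    if [measurable]: "A \<in> sets borel" "h \<in> borel_measurable borel" for A and h :: "'a \<Rightarrow> real"
  proof -
    have "set_integrable lborel A h \<longleftrightarrow> integrable (distr lborel borel of_coords) (\<lambda>y. indicator A y *\<^sub>R h y)"
      unfolding set_integrable_def by (subst lborel_eq_distr_of_coords) (rule refl)
    also have "\<dots> \<longleftrightarrow> set_integrable lborel (of_coords -` A) (h \<circ> of_coords)"
      unfolding set_integrable_def by (subst integrable_distr_eq) (auto simp: indicator_def o_def)
    finally show "set_integrable lborel (of_coords -` A) (h \<circ> of_coords) \<longleftrightarrow> set_integrable lborel A h"
      by simp
    have "(LINT y:A|lborel. h y) = (LINT y|distr lborel borel of_coords. indicator A y *\<^sub>R h y)"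
      unfolding set_lebesgue_integral_def by (subst lborel_eq_distr_of_coords) (rule refl)
    also have "\<dots> = (LINT v:of_coords -` A|lborel. h (of_coords v))"
      unfolding set_lebesgue_integral_def by (subst integral_distr) (auto simp: indicator_def)
    finally show "(LINT v:of_coords -` A|lborel. h (of_coords v)) = (LINT y:A|lborel. h y)"
      by simp
  qed
  \<comment> \<open>The bridge from Lebesgue set integrals over \<open>lborel\<close> to gauge
    integrals of functions with values in \<open>real ^ 1\<close>.\<close>
  have component: "set_integrable lborel A h \<longleftrightarrow> (\<lambda>v. vec (h v) :: real ^ 1) absolutely_integrable_on A"
    "set_integrable lborel A h \<Longrightarrow> integral A (\<lambda>v. vec (h v) :: real ^ 1) = vec (LINT v:A|lborel. h v)"
    if [measurable]: "A \<in> sets borel" "h \<in> borel_measurable borel" for A and h :: "real ^ 'a coord \<Rightarrow> real"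
  proof -
    have leb: "set_integrable lebesgue A h \<longleftrightarrow> set_integrable lborel A h"
      unfolding set_integrable_def by (rule integrable_completion) measurable
    have comp: "(\<lambda>v. vec (h v) :: real ^ 1) absolutely_integrable_on A \<longleftrightarrow> h absolutely_integrable_on A"
      by (subst absolutely_integrable_componentwise_iff) (auto simp: Basis_vec_def inner_axis)
    show 1: "set_integrable lborel A h \<longleftrightarrow> (\<lambda>v. vec (h v) :: real ^ 1) absolutely_integrable_on A"
      using leb comp by blast
    assume si: "set_integrable lborel A h"
    have "(LINT v:A|lebesgue. h v) = (LINT v:A|lborel. h v)"
      unfolding set_lebesgue_integral_def by (rule integral_completion) measurable
    then have "(h has_integral (LINT v:A|lborel. h v)) A"
      using has_integral_set_lebesgue[of A h] si leb by simp
    then have "((\<lambda>v. vec (h v) :: real ^ 1) has_integral vec (LINT v:A|lborel. h v)) A"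
      by (subst has_integral_componentwise_iff) (auto simp: Basis_vec_def inner_axis)
    then show "integral A (\<lambda>v. vec (h v) :: real ^ 1) = vec (LINT v:A|lborel. h v)"
      by (rule integral_unique)
  qed
  have sF: "set_integrable lborel (G ` T) (f \<circ> of_coords)"
    unfolding GT using set_int[OF im f] int by simp
  have F_abs: "F absolutely_integrable_on (G ` T)"
    and F_int: "integral (G ` T) F = vec (LINT v:G ` T|lborel. f (of_coords v))"
    using component[OF GT_sets, of "f \<circ> of_coords"] sF by (simp_all add: F_def o_def)
  define b where "b = integral (G ` T) F"
  have cv: "(\<lambda>v. \<bar>det (matrix (G' v))\<bar> *\<^sub>R F (G v)) absolutely_integrable_on T \<and>
      integral T (\<lambda>v. \<bar>det (matrix (G' v))\<bar> *\<^sub>R F (G v)) = b"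
    by (subst has_absolute_integral_change_of_variables[OF _ derG injG])
      (use F_abs b_def T in \<open>auto intro: sets_completionI_sets\<close>)
  let ?k = "\<lambda>v. D (of_coords v) * f (g (of_coords v))"
  have eqT: "\<bar>det (matrix (G' v))\<bar> *\<^sub>R F (G v) = vec (?k v)" if "v \<in> T" for v
    using detG[OF that] by (simp add: Fg vec_eq_iff)
  have "(\<lambda>v. vec (?k v) :: real ^ 1) absolutely_integrable_on T"
    using cv set_integrable_cong[of lebesgue lebesgue T T, OF refl refl eqT] by auto
  moreover have "integral T (\<lambda>v. vec (?k v) :: real ^ 1) = b"
    unfolding conjunct2[OF cv, symmetric] by (rule integral_cong) (rule eqT[symmetric])
  ultimately have "vec (LINT v:T|lborel. ?k v) = b"
    using component[OF T, of ?k] by simp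
  then have "(LINT v:T|lborel. ?k v) = (LINT v:G ` T|lborel. f (of_coords v))"
    by (metis b_def F_int vec_component)
  then show ?thesis
    unfolding GT unfolding T_def using int_eq[OF S, of "\<lambda>y. D y * f (g y)"] int_eq[OF im f] by simp
qed

section \<open>The chord involution and the surface measure\<close>

text \<open>For \<open>norm x < 1\<close>, \<open>chord x\<close> is the positively homogeneous extension of the involution of the
  unit sphere that maps a point to the other endpoint of the chord through \<open>x\<close>.\<close>

definition recenter :: "'a::euclidean_space \<Rightarrow> 'a \<Rightarrow> 'a" where
  "recenter x y = y - norm y *\<^sub>R x"

text \<open>For unit \<open>y\<close> this expresses the power of the point \<open>x\<close>: the
  distances from \<open>x\<close> to the two ends of a chord have product
  \<open>1 - (norm x)\<^sup>2\<close>, and the sign puts the ends on opposite sides of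
  \<open>x\<close>. The powers of \<open>norm y\<close> make the ratio homogeneous of degree
  0.\<close>

definition chord_ratio :: "'a::euclidean_space \<Rightarrow> 'a \<Rightarrow> real" where
  "chord_ratio x y = - ((1 - (norm x)\<^sup>2) * (norm y)\<^sup>2 / (norm (recenter x y))\<^sup>2)"

definition chord :: "'a::euclidean_space \<Rightarrow> 'a \<Rightarrow> 'a" where
  "chord x y = norm y *\<^sub>R x + chord_ratio x y *\<^sub>R recenter x y"

lemma one_minus_norm_sq_pos:
  assumes "norm (x :: 'a::real_normed_vector) < 1"
  shows "0 < 1 - (norm x)\<^sup>2"
  using assms by (simp add: power_less_one_iff)

lemma recenter_eq_0_iff:
  assumes "norm x < 1"
  shows "recenter x y = 0 \<longleftrightarrow> y = 0"
proof
  assume "recenter x y = 0"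
  then have "norm y = norm y * norm x"
    unfolding recenter_def by (metis abs_norm_cancel norm_scaleR right_minus_eq)
  then show "y = 0"
    using assms by auto
qed (simp add: recenter_def)

lemma norm_add_scaleR_sq:
  fixes u v :: "'a::real_inner"
  shows "(norm (u + t *\<^sub>R v))\<^sup>2 = (norm u)\<^sup>2 + 2 * t * (u \<bullet> v) + t\<^sup>2 * (norm v)\<^sup>2"
  unfolding power2_norm_eq_inner
  by (simp add: inner_add_left inner_add_right inner_commute algebra_simps power2_eq_square)

lemma norm_recenter_sq:
  "(norm (recenter x y))\<^sup>2 = norm y * (norm y * (1 + (norm x)\<^sup>2) - 2 * (x \<bullet> y))"
  using norm_add_scaleR_sq[of y "- norm y" x]
  by (simp add: recenter_def inner_commute algebra_simps power2_eq_square)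

context
  fixes x :: "'a::euclidean_space"
  assumes x: "norm x < 1"
begin

lemma chord_ratio_neg:
  assumes "y \<noteq> 0"
  shows "chord_ratio x y < 0"
  using assms one_minus_norm_sq_pos[OF x] recenter_eq_0_iff[OF x, of y] by (simp add: chord_ratio_def)

lemma chord_ratio_times_norm_recenter:
  assumes "y \<noteq> 0"
  shows "chord_ratio x y * (norm (recenter x y))\<^sup>2 = - ((1 - (norm x)\<^sup>2) * (norm y)\<^sup>2)"
  using assms recenter_eq_0_iff[OF x, of y] by (simp add: chord_ratio_def)

text \<open>The condition that \<open>norm y *\<^sub>R x + k *\<^sub>R recenter x y\<close> has norm
  \<open>norm y\<close> is a quadratic equation in \<open>k\<close>. One root is
  \<open>k = 1\<close>, which gives back \<open>y\<close>; by Vieta the other root is the product of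
  the roots, and this is \<open>chord_ratio x y\<close>.\<close>

lemma norm_chord:
  assumes "y \<noteq> 0"
  shows "norm (chord x y) = norm y"
proof -
  let ?k = "chord_ratio x y" and ?s = "recenter x y"
  have k: "?k * (norm ?s)\<^sup>2 = - ((1 - (norm x)\<^sup>2) * (norm y)\<^sup>2)"
    using assms by (rule chord_ratio_times_norm_recenter)
  have "(norm (?s + norm y *\<^sub>R x))\<^sup>2 = (norm ?s)\<^sup>2 + 2 * norm y * (x \<bullet> ?s) + (norm y)\<^sup>2 * (norm x)\<^sup>2"
    unfolding norm_add_scaleR_sq by (simp add: inner_commute)
  then have s: "2 * norm y * (x \<bullet> ?s) = (1 - (norm x)\<^sup>2) * (norm y)\<^sup>2 - (norm ?s)\<^sup>2"
    by (simp add: recenter_def algebra_simps)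
  have "(norm (chord x y))\<^sup>2 = (norm y)\<^sup>2 * (norm x)\<^sup>2 + ?k * (2 * norm y * (x \<bullet> ?s)) + ?k * (?k * (norm ?s)\<^sup>2)"
    unfolding chord_def norm_add_scaleR_sq by (simp add: power_mult_distrib algebra_simps power2_eq_square)
  also have "\<dots> = (norm y)\<^sup>2 * (norm x)\<^sup>2 - ?k * (norm ?s)\<^sup>2"
    unfolding s arg_cong[OF k, of "(*) ?k"] by (simp add: algebra_simps)
  also have "\<dots> = (norm y)\<^sup>2"
    unfolding k by (simp add: algebra_simps)
  finally show ?thesis
    by simp
qed

lemma chord_eq_0_iff: "chord x y = 0 \<longleftrightarrow> y = 0"
  by (metis chord_def add_0 norm_chord norm_eq_zero scale_zero_left scale_zero_right recenter_eq_0_iff x)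

lemma recenter_chord:
  assumes "y \<noteq> 0"
  shows "recenter x (chord x y) = chord_ratio x y *\<^sub>R recenter x y"
  unfolding recenter_def[of x "chord x y"] norm_chord[OF assms] by (simp add: chord_def)

lemma chord_chord: "chord x (chord x y) = y"
proof (cases "y = 0")
  case False
  have "chord_ratio x (chord x y) = inverse (chord_ratio x y)"
  proof -
    have "chord_ratio x (chord x y) = - ((1 - (norm x)\<^sup>2) * (norm y)\<^sup>2 / ((chord_ratio x y)\<^sup>2 * (norm (recenter x y))\<^sup>2))"
      unfolding chord_ratio_def[of x "chord x y"] recenter_chord[OF False] norm_chord[OF False]
      by (simp add: power_mult_distrib)
    also have "\<dots> = chord_ratio x y / (chord_ratio x y)\<^sup>2"
      by (simp add: chord_ratio_def[of x y] mult.commute)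
    finally show ?thesis
      by (simp add: power2_eq_square inverse_eq_divide)
  qed
  then show ?thesis
    unfolding chord_def[of x "chord x y"] norm_chord[OF False] recenter_chord[OF False]
    using chord_ratio_neg[OF False] by (simp add: recenter_def)
qed (simp add: chord_eq_0_iff)

text \<open>Divided by \<open>norm y\<close>, the two sides compare
  \<open>1 - x \<bullet> sgn z\<close> at \<open>z = chord x y\<close> and at \<open>z = y\<close>.
  These numbers are the determinants of the derivative of \<open>recenter x\<close> at the two
  points.\<close>

lemma norm_minus_inner_chord:
  assumes "y \<noteq> 0"
  shows "norm y - x \<bullet> chord x y = - chord_ratio x y * (norm y - x \<bullet> y)"
proof -
  have "norm y * (chord_ratio x y * (norm y * (1 + (norm x)\<^sup>2) - 2 * (x \<bullet> y))) = norm y * (- ((1 - (norm x)\<^sup>2) * norm y))"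
    using chord_ratio_times_norm_recenter[OF assms] unfolding norm_recenter_sq
    by (simp add: power2_eq_square algebra_simps)
  then have "chord_ratio x y * (norm y * (1 + (norm x)\<^sup>2) - 2 * (x \<bullet> y)) = - ((1 - (norm x)\<^sup>2) * norm y)"
    using assms by (metis mult_left_cancel norm_eq_zero)
  then show ?thesis
    unfolding chord_def recenter_def
    by (simp add: inner_add_right inner_diff_right algebra_simps flip: power2_norm_eq_inner)
qed

lemma has_derivative_recenter:
  assumes "y \<noteq> 0"
  shows "(recenter z has_derivative (\<lambda>v. v + (sgn y \<bullet> v) *\<^sub>R (- z))) (at y)"
  unfolding recenter_def using has_derivative_norm[OF assms]
  by (auto intro!: derivative_eq_intros simp: inner_commute)

lemma chord_ratio_scaleR: "0 < t \<Longrightarrow> chord_ratio x (t *\<^sub>R y) = chord_ratio x y"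
proof -
  assume "0 < t"
  then have "recenter x (t *\<^sub>R y) = t *\<^sub>R recenter x y"
    by (simp add: recenter_def algebra_simps)
  then show ?thesis
    using \<open>0 < t\<close> by (simp add: chord_ratio_def power_mult_distrib)
qed

lemma chord_scaleR: "0 < t \<Longrightarrow> chord x (t *\<^sub>R y) = t *\<^sub>R chord x y"
  unfolding chord_def chord_ratio_scaleR by (simp add: recenter_def algebra_simps)

text \<open>The orthogonality is Euler's relation for a function of degree 0. It gives determinant 1
  to the rank one perturbation in direction \<open>y\<close> that appears in the derivative of
  \<open>chord x\<close>.\<close>

lemma gderiv_chord_ratio:
  assumes "y \<noteq> 0"
  obtains m where "GDERIV (chord_ratio x) y :> m" "m \<bullet> y = 0"
proof -
  have "recenter x y \<noteq> 0"
    using assms x by (simp add: recenter_eq_0_iff)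
  have "recenter x differentiable (at y)"
    using has_derivative_recenter[OF assms] by (rule differentiableI)
  then have "chord_ratio x differentiable (at y)"
    unfolding chord_ratio_def using \<open>recenter x y \<noteq> 0\<close> assms
    by (intro derivative_intros differentiable_compose[of norm "recenter x"]) auto
  then obtain k' where k': "(chord_ratio x has_derivative k') (at y)"
    unfolding differentiable_def by blast
  have "linear k'"
    using k' has_derivative_linear by blast
  define m where "m = (\<Sum>b\<in>Basis. k' b *\<^sub>R b)"
  have k'm: "k' v = v \<bullet> m" for v
  proof -
    have "k' v = k' (\<Sum>b\<in>Basis. (v \<bullet> b) *\<^sub>R b)"
      by (simp add: euclidean_representation)
    also have "\<dots> = v \<bullet> m"
      using \<open>linear k'\<close> by (simp add: m_def linear_sum linear_scale inner_sum_right mult.commute)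
    finally show ?thesis .
  qed
  have "((\<lambda>t. chord_ratio x (t *\<^sub>R y)) has_derivative (\<lambda>t. k' (t *\<^sub>R y))) (at 1)"
    by (rule has_derivative_compose[where g = "chord_ratio x"])
      (auto intro!: derivative_eq_intros simp: k')
  moreover have "((\<lambda>t. chord_ratio x (t *\<^sub>R y)) has_derivative (\<lambda>t. 0)) (at 1)"
    by (rule has_derivative_transform_within_open[OF has_derivative_const, where s = "{0<..}"])
      (auto simp: chord_ratio_scaleR)
  ultimately have "(\<lambda>t. k' (t *\<^sub>R y)) = (\<lambda>t. 0)"
    by (rule has_derivative_unique)
  then have "k' y = 0"
    by (metis scaleR_one)
  then show ?thesis
    using that[of m] k' k'm[abs_def] by (simp add: gderiv_def inner_commute)
qed

text \<open>With \<open>k = chord_ratio x y\<close> and \<open>z = chord x y\<close>, comparing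
  determinants gives \<open>(1 - x \<bullet> sgn z) * ldet P = (1 - x \<bullet> sgn y) * k ^
  DIM('a)\<close>. The factor on the left is \<open>- k\<close> times the one on the right, so one
  power of \<open>k\<close> cancels and the exponent becomes the dimension of the sphere.\<close>

lemma has_derivative_chord:
  assumes "y \<noteq> 0"
  obtains P where "(chord x has_derivative P) (at y)"
    "\<bar>ldet P\<bar> = \<bar>chord_ratio x y\<bar> ^ (DIM('a) - 1)"
proof -
  let ?k = "chord_ratio x y" and ?z = "chord x y"
  obtain m where m: "GDERIV (chord_ratio x) y :> m" "m \<bullet> y = 0"
    using gderiv_chord_ratio[OF assms] .
  define S where "S = (\<lambda>z v. v + (sgn z \<bullet> v) *\<^sub>R (- x))"
  have k: "(chord_ratio x has_derivative (\<lambda>v. v \<bullet> m)) (at y)"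
    using m by (simp add: gderiv_def)
  have s: "(recenter x has_derivative S y) (at y)"
    unfolding S_def by (rule has_derivative_recenter[OF assms])
  have n: "(norm has_derivative (\<lambda>v. v \<bullet> sgn y)) (at y)"
    using assms by (rule has_derivative_norm)
  define P where "P = (\<lambda>v. (v \<bullet> sgn y) *\<^sub>R x + (?k *\<^sub>R S y v + (v \<bullet> m) *\<^sub>R recenter x y))"
  have P: "(chord x has_derivative P) (at y)"
    unfolding chord_def[abs_def] P_def
    by (intro has_derivative_add has_derivative_scaleR k s has_derivative_scaleR_left n)
  have z: "?z \<noteq> 0"
    using assms by (simp add: chord_eq_0_iff)
  have "((\<lambda>y. recenter x (chord x y)) has_derivative (\<lambda>v. S ?z (P v))) (at y)"
    by (rule has_derivative_compose[OF P]) (unfold S_def, rule has_derivative_recenter[OF z])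
  moreover have "((\<lambda>y. recenter x (chord x y)) has_derivative (\<lambda>v. ?k *\<^sub>R S y v + (v \<bullet> m) *\<^sub>R recenter x y)) (at y)"
    by (rule has_derivative_transform_within_open[OF has_derivative_scaleR[OF k s], where s = "- {0}"])
      (use assms in \<open>auto simp: recenter_chord\<close>)
  ultimately have "(\<lambda>v. S ?z (P v)) = (\<lambda>v. ?k *\<^sub>R S y v + (v \<bullet> m) *\<^sub>R recenter x y)"
    by (rule has_derivative_unique)
  \<comment> \<open>By homogeneity \<open>recenter x y = S y y\<close>, because
    \<open>sgn y \<bullet> y = norm y\<close>. Hence \<open>S y\<close> can be factored out of both
    summands.\<close>
  also have "\<dots> = S y \<circ> ((\<lambda>v. ?k *\<^sub>R v) \<circ> (\<lambda>v. v + (m \<bullet> v) *\<^sub>R (inverse ?k *\<^sub>R y)))"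
  proof
    fix v
    have "sgn y \<bullet> y = norm y"
      using assms by (simp add: sgn_div_norm dot_square_norm power2_eq_square)
    moreover have k_inv: "?k * inverse ?k = 1"
      using chord_ratio_neg[OF assms] by simp
    moreover have cancel: "?k * (t * inverse ?k) = t" for t
      using k_inv by (simp add: mult.left_commute)
    ultimately show "?k *\<^sub>R S y v + (v \<bullet> m) *\<^sub>R recenter x y
        = (S y \<circ> ((\<lambda>v. ?k *\<^sub>R v) \<circ> (\<lambda>v. v + (m \<bullet> v) *\<^sub>R (inverse ?k *\<^sub>R y)))) v"
      by (simp add: k_inv cancel S_def recenter_def algebra_simps inner_add_right inner_commute)
  qed
  finally have SP: "S ?z \<circ> P = S y \<circ> ((\<lambda>v. ?k *\<^sub>R v) \<circ> (\<lambda>v. v + (m \<bullet> v) *\<^sub>R (inverse ?k *\<^sub>R y)))"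
    by (simp add: o_def)
  have linS: "linear (S z)" for z
    unfolding S_def by (rule linearI) (auto simp: inner_add_right algebra_simps)
  have lin1: "linear (\<lambda>v. v + (m \<bullet> v) *\<^sub>R (inverse ?k *\<^sub>R y))"
    by (rule linearI) (auto simp: inner_add_right algebra_simps)
  have lin2: "linear (\<lambda>v :: 'a. ?k *\<^sub>R v)"
    by simp
  have "linear P"
    using P has_derivative_linear by blast
  then have "ldet (S ?z) * ldet P = ldet (S y) * (ldet (\<lambda>v :: 'a. ?k *\<^sub>R v) * ldet (\<lambda>v. v + (m \<bullet> v) *\<^sub>R (inverse ?k *\<^sub>R y)))"
    using arg_cong[OF SP, of ldet] linS lin1 lin2 by (simp only: ldet_compose linear_compose)
  also have "ldet (\<lambda>v. v + (m \<bullet> v) *\<^sub>R (inverse ?k *\<^sub>R y)) = 1"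
    using m by (subst ldet_add_rank_one) (simp add: inner_commute)
  finally have *: "(1 - x \<bullet> sgn ?z) * ldet P = (1 - x \<bullet> sgn y) * ?k ^ DIM('a)"
    unfolding S_def ldet_add_rank_one ldet_scaleR by simp
  have pos: "1 - x \<bullet> sgn y > 0"
  proof -
    have "x \<bullet> sgn y \<le> norm x * norm (sgn y)"
      by (rule norm_cauchy_schwarz)
    then show ?thesis
      using x assms by (simp add: norm_sgn)
  qed
  have "1 - x \<bullet> sgn ?z = - ?k * (1 - x \<bullet> sgn y)"
    using norm_minus_inner_chord[OF assms] assms
    by (simp add: sgn_div_norm norm_chord field_simps)
  note z_eq = this
  have "?k ^ DIM('a) = ?k * ?k ^ (DIM('a) - 1)"
    by (metis DIM_positive power_minus_mult mult.commute)
  then have "(- ?k * (1 - x \<bullet> sgn y)) * ldet P = (- ?k * (1 - x \<bullet> sgn y)) * (- (?k ^ (DIM('a) - 1)))"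
    using * unfolding z_eq by simp
  then have "ldet P = - (?k ^ (DIM('a) - 1))"
    using pos chord_ratio_neg[OF assms]
    by (metis less_irrefl mult_left_cancel neg_0_less_iff_less no_zero_divisors)
  then show ?thesis
    using that[OF P] by (simp add: power_abs)
qed

end

lemma borel_measurable_recenter [measurable]: "recenter x \<in> borel_measurable borel"
  unfolding recenter_def[abs_def] by measurable

lemma borel_measurable_chord_ratio [measurable]: "chord_ratio x \<in> borel_measurable borel"
  unfolding chord_ratio_def[abs_def] by measurable

lemma borel_measurable_chord [measurable]: "chord x \<in> borel_measurable borel"
  unfolding chord_def[abs_def] by measurable

section \<open>The surface measure as a radial projection\<close>

lemma emeasure_punctured_ball:
  "emeasure lborel (ball 0 1 - {0 :: 'a::euclidean_space}) \<noteq> 0"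
  "emeasure lborel (ball 0 1 - {0 :: 'a::euclidean_space}) \<noteq> \<infinity>"
proof -
  have "emeasure lborel (ball 0 1 - {0 :: 'a}) = emeasure lborel (ball 0 1 :: 'a set)"
    by (rule emeasure_Diff_null_set) auto
  moreover have "emeasure lborel (ball 0 1 :: 'a set) \<noteq> 0"
    using content_ball_pos[of 1 "0 :: 'a"] by (auto simp: measure_def)
  ultimately show "emeasure lborel (ball 0 1 - {0 :: 'a::euclidean_space}) \<noteq> 0"
    "emeasure lborel (ball 0 1 - {0 :: 'a::euclidean_space}) \<noteq> \<infinity>"
    using emeasure_lborel_ball_finite[of "0::'a" 1] by auto
qed

lemma space_sphere_measure [simp]: "space sphere_measure = sphere 0 1"
  by (simp add: sphere_measure_def space_restrict_space)

lemma sets_sphere_measure [measurable_cong]: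
  "sets sphere_measure = sets (restrict_space borel (sphere 0 1))"
  by (simp add: sphere_measure_def)

text \<open>Radial projection is not measurable into the sphere, because \<open>sgn 0 = 0\<close>; its value on this
  null set is changed.\<close>

lemma sphere_measure_eq_distr:
  fixes e :: "'a::euclidean_space"
  assumes "norm e = 1"
  shows "(\<lambda>y. if y = 0 then e else sgn y) \<in> uniform_measure lborel (ball 0 1 - {0}) \<rightarrow>\<^sub>M restrict_space borel (sphere 0 1)"
    "sphere_measure = distr (uniform_measure lborel (ball 0 1 - {0}))
      (restrict_space borel (sphere 0 1)) (\<lambda>y. if y = 0 then e else sgn y)"
proof -
  let ?U = "uniform_measure lborel (ball 0 1 - {0 :: 'a})"
  let ?s = "\<lambda>y. if y = 0 then e else sgn y"
  show "?s \<in> ?U \<rightarrow>\<^sub>M restrict_space borel (sphere 0 1)"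
    using assms by (intro measurable_restrict_space2) (auto simp: norm_sgn)
  have "emeasure ?U (sgn -` A) = emeasure ?U (?s -` A)" if "A \<in> sets (restrict_space borel (sphere 0 1))" for A
  proof -
    have [measurable]: "A \<in> sets borel"
      using that by (auto simp: sets_restrict_space)
    have "(sgn :: 'a \<Rightarrow> 'a) \<in> borel_measurable borel" "?s \<in> borel_measurable borel"
      by measurable
    from this[THEN measurable_sets_borel, OF \<open>A \<in> sets borel\<close>]
    have meas: "sgn -` A \<in> sets borel" "?s -` A \<in> sets borel" .
    have "(ball 0 1 - {0}) \<inter> sgn -` A = (ball 0 1 - {0}) \<inter> ?s -` A"
      by auto
    then show ?thesis
      using meas by (simp add: emeasure_uniform_measure)
  qed
  note eq = this
  show "sphere_measure = distr ?U (restrict_space borel (sphere 0 1)) ?s"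
    unfolding sphere_measure_def distr_def
  proof (rule measure_of_eq)
    fix A assume "A \<in> sigma_sets (space (restrict_space borel (sphere (0 :: 'a) 1))) (sets (restrict_space borel (sphere 0 1)))"
    then have "A \<in> sets (restrict_space borel (sphere 0 1))"
      by (simp only: sets.sigma_sets_eq)
    then show "emeasure ?U (sgn -` A \<inter> space ?U) = emeasure ?U (?s -` A \<inter> space ?U)"
      using eq by simp
  qed (rule sets.space_closed)
qed

lemma prob_space_sphere_measure: "prob_space (sphere_measure :: 'a::euclidean_space measure)"
proof -
  obtain e :: 'a where "norm e = 1"
    using vector_choose_size zero_le_one by blast
  show ?thesis
    unfolding sphere_measure_eq_distr(2)[OF \<open>norm e = 1\<close>]
    by (intro prob_space.prob_space_distr prob_space_uniform_measure emeasure_punctured_ball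
        sphere_measure_eq_distr(1)[OF \<open>norm e = 1\<close>])
qed

text \<open>Sphere integrals become averages of degree 0 functions over the punctured ball, where
  the change of variables formula for \<open>lborel\<close> applies.\<close>

lemma integral_sphere_measure:
  fixes h :: "'a::euclidean_space \<Rightarrow> real"
  assumes h [measurable]: "h \<in> borel_measurable borel"
  defines "B \<equiv> ball 0 1 - {0 :: 'a}"
  shows "integrable sphere_measure h \<longleftrightarrow> set_integrable lborel B (\<lambda>y. h (sgn y))"
    and "(\<integral>\<eta>. h \<eta> \<partial>sphere_measure) = (LINT y:B|lborel. h (sgn y)) / measure lborel B"
proof -
  obtain e :: 'a where "norm e = 1"
    using vector_choose_size zero_le_one by blast
  define s where "s = (\<lambda>y. if y = 0 then e else sgn y)"
  note distr = sphere_measure_eq_distr[OF \<open>norm e = 1\<close>, folded s_def B_def]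
  have [measurable]: "B \<in> sets borel" "s \<in> borel_measurable borel"
    by (auto simp: B_def s_def)
  have h': "h \<in> borel_measurable (restrict_space borel (sphere 0 1))"
    by (rule measurable_restrict_space1) measurable
  have mB2: "emeasure lborel B = ennreal (measure lborel B)"
    using emeasure_punctured_ball(2)[where 'a = 'a] unfolding B_def
    by (intro emeasure_eq_ennreal_measure) simp
  then have "measure lborel B \<noteq> 0"
    using emeasure_punctured_ball(1)[where 'a = 'a] unfolding B_def by fastforce
  then have mB1: "measure lborel B > 0"
    by (simp add: zero_less_measure_iff)
  have U: "uniform_measure lborel B = density lborel (\<lambda>y. ennreal (indicator B y / measure lborel B))"
    unfolding uniform_measure_def mB2
    by (intro density_cong) (use mB1 in \<open>auto simp: divide_ennreal indicator_def simp flip: ennreal_1\<close>)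
  have sB: "indicator B y * h (s y) = indicator B y * h (sgn y)" for y
    by (auto simp: B_def s_def indicator_def)
  have "integrable sphere_measure h \<longleftrightarrow> integrable (uniform_measure lborel B) (\<lambda>y. h (s y))"
    unfolding distr(2) by (rule integrable_distr_eq[OF distr(1) h'])
  also have "\<dots> \<longleftrightarrow> integrable lborel (\<lambda>y. (indicator B y / measure lborel B) * h (s y))"
    unfolding U by (subst integrable_density) auto
  also have "\<dots> \<longleftrightarrow> integrable lborel (\<lambda>y. inverse (measure lborel B) * (indicator B y * h (sgn y)))"
    unfolding sB[symmetric] by (simp add: field_simps)
  also have "\<dots> \<longleftrightarrow> set_integrable lborel B (\<lambda>y. h (sgn y))"
    using mB1 by (simp add: set_integrable_def)
  finally show "integrable sphere_measure h \<longleftrightarrow> set_integrable lborel B (\<lambda>y. h (sgn y))" .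
  have "(\<integral>\<eta>. h \<eta> \<partial>sphere_measure) = (\<integral>y. h (s y) \<partial>uniform_measure lborel B)"
    unfolding distr(2) by (rule integral_distr[OF distr(1) h'])
  also have "\<dots> = (\<integral>y. (indicator B y / measure lborel B) * h (s y) \<partial>lborel)"
    unfolding U by (subst integral_density) auto
  also have "\<dots> = (\<integral>y. inverse (measure lborel B) * (indicator B y * h (sgn y)) \<partial>lborel)"
    unfolding sB[symmetric] by (simp add: field_simps)
  also have "\<dots> = (LINT y:B|lborel. h (sgn y)) / measure lborel B"
    by (simp add: set_lebesgue_integral_def field_simps)
  finally show "(\<integral>\<eta>. h \<eta> \<partial>sphere_measure) = (LINT y:B|lborel. h (sgn y)) / measure lborel B" .
qed

text \<open>Since \<open>chord x\<close> preserves norms and is an involution, it maps the punctured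
  ball bijectively onto itself; being homogeneous, it commutes with \<open>sgn\<close>. The Jacobian
  on the ball has degree 0 and therefore descends to the sphere.\<close>

lemma integral_sphere_chord:
  fixes h :: "'a::euclidean_space \<Rightarrow> real"
  assumes x: "norm x < 1" and h [measurable]: "h \<in> borel_measurable borel"
    and int: "integrable sphere_measure h"
  shows "(\<integral>\<eta>. \<bar>chord_ratio x \<eta>\<bar> ^ (DIM('a) - 1) * h (chord x \<eta>) \<partial>sphere_measure) = (\<integral>\<zeta>. h \<zeta> \<partial>sphere_measure)"
proof -
  define B where "B = ball 0 1 - {0 :: 'a}"
  have [measurable]: "B \<in> sets borel"
    by (simp add: B_def)
  have "\<forall>y. \<exists>P. y \<noteq> 0 \<longrightarrow> (chord x has_derivative P) (at y) \<and>
      \<bar>ldet P\<bar> = \<bar>chord_ratio x y\<bar> ^ (DIM('a) - 1)"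
    using has_derivative_chord[OF x] by metis
  then obtain P where P: "\<And>y. y \<noteq> 0 \<Longrightarrow> (chord x has_derivative P y) (at y)"
    "\<And>y. y \<noteq> 0 \<Longrightarrow> \<bar>ldet (P y)\<bar> = \<bar>chord_ratio x y\<bar> ^ (DIM('a) - 1)"
    by metis
  have inj: "inj_on (chord x) B"
    by (metis chord_chord[OF x] inj_onI)
  have sub: "chord x y \<in> B" if "y \<in> B" for y
    using that norm_chord[OF x] chord_eq_0_iff[OF x] by (auto simp: B_def)
  have im: "chord x ` B = B"
    using sub chord_chord[OF x] by (metis image_subset_iff subsetI subset_antisym image_eqI)
  have sgn: "chord_ratio x (sgn y) = chord_ratio x y" "chord x (sgn y) = sgn (chord x y)" if "y \<in> B" for y
    using that chord_ratio_scaleR[OF x, of "inverse (norm y)" y] chord_scaleR[OF x, of "inverse (norm y)" y]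
      norm_chord[OF x, of y]
    by (auto simp: B_def sgn_div_norm)
  have "(\<integral>\<eta>. \<bar>chord_ratio x \<eta>\<bar> ^ (DIM('a) - 1) * h (chord x \<eta>) \<partial>sphere_measure)
      = (LINT y:B|lborel. \<bar>chord_ratio x (sgn y)\<bar> ^ (DIM('a) - 1) * h (chord x (sgn y))) / measure lborel B"
    unfolding B_def by (rule integral_sphere_measure(2)) measurable
  also have "(LINT y:B|lborel. \<bar>chord_ratio x (sgn y)\<bar> ^ (DIM('a) - 1) * h (chord x (sgn y)))
      = (LINT y:B|lborel. \<bar>chord_ratio x y\<bar> ^ (DIM('a) - 1) * h (sgn (chord x y)))"
    by (rule set_lebesgue_integral_cong) (auto simp: sgn)
  also have "\<dots> = (LINT y:chord x ` B|lborel. h (sgn y))"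
    by (rule integral_lborel_change_of_variables[where g' = P])
      (use P inj im integral_sphere_measure(1)[OF h] int in \<open>auto simp: B_def\<close>)
  also have "(LINT y:chord x ` B|lborel. h (sgn y)) / measure lborel B = (\<integral>\<zeta>. h \<zeta> \<partial>sphere_measure)"
    unfolding im using integral_sphere_measure(2)[OF h] by (simp add: B_def)
  finally show ?thesis .
qed

section \<open>Differentiation and integration by parts on the sphere\<close>

text \<open>The mean value theorem bounds the increments of \<open>f\<close> by \<open>B\<close>,
  and dominated convergence is applied to the remainder quotient \<open>q\<close>. That quotient
  contains the gradient at \<open>x\<close> only, so measurability of \<open>D\<close> is assumed at
  this one point.\<close>

lemma GDERIV_integral:
  fixes f :: "'a::euclidean_space \<Rightarrow> 'm \<Rightarrow> real" and D :: "'a \<Rightarrow> 'm \<Rightarrow> 'a"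
  assumes r: "0 < r"
    and f_int: "\<And>y. y \<in> ball x r \<Longrightarrow> integrable M (f y)"
    and der: "\<And>y \<eta>. y \<in> ball x r \<Longrightarrow> \<eta> \<in> space M \<Longrightarrow> GDERIV (\<lambda>y. f y \<eta>) y :> D y \<eta>"
    and bnd: "\<And>y \<eta>. y \<in> ball x r \<Longrightarrow> \<eta> \<in> space M \<Longrightarrow> norm (D y \<eta>) \<le> B \<eta>"
    and B: "integrable M B"
    and Dm [measurable]: "D x \<in> borel_measurable M"
  shows "integrable M (D x)" and "GDERIV (\<lambda>y. \<integral>\<eta>. f y \<eta> \<partial>M) x :> (\<integral>\<eta>. D x \<eta> \<partial>M)"
proof -
  have xr: "x \<in> ball x r"
    using r by simp
  show D_int: "integrable M (D x)"
    by (rule Bochner_Integration.integrable_bound[OF B])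
      (use bnd[OF xr] in \<open>auto intro!: AE_I2 intro: order_trans[OF _ abs_ge_self]\<close>)
  have lip: "\<bar>f y \<eta> - f x \<eta>\<bar> \<le> B \<eta> * norm (y - x)" if "y \<in> ball x r" "\<eta> \<in> space M" for y \<eta>
  proof -
    have "norm (f y \<eta> - f x \<eta>) \<le> B \<eta> * norm (y - x)"
    proof (rule differentiable_bound[of "ball x r" "\<lambda>y. f y \<eta>" "\<lambda>y h. h \<bullet> D y \<eta>"])
      show "((\<lambda>y. f y \<eta>) has_derivative (\<lambda>h. h \<bullet> D z \<eta>)) (at z within ball x r)" if "z \<in> ball x r" for z
        using der[OF that \<open>\<eta> \<in> space M\<close>] by (auto simp: gderiv_def intro: has_derivative_at_withinI)
      show "onorm (\<lambda>h. h \<bullet> D z \<eta>) \<le> B \<eta>" if "z \<in> ball x r" for z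
      proof (rule onorm_le)
        fix h
        have "norm (h \<bullet> D z \<eta>) \<le> norm (D z \<eta>) * norm h"
          by (metis Cauchy_Schwarz_ineq2 mult.commute real_norm_def)
        also have "\<dots> \<le> B \<eta> * norm h"
          using bnd[OF that \<open>\<eta> \<in> space M\<close>] by (rule mult_right_mono) simp
        finally show "norm (h \<bullet> D z \<eta>) \<le> B \<eta> * norm h" .
      qed
    qed (use that xr in auto)
    then show ?thesis
      by simp
  qed
  define q where "q = (\<lambda>y \<eta>. \<bar>f y \<eta> - f x \<eta> - (y - x) \<bullet> D x \<eta>\<bar> / norm (y - x))"
  have q_bnd: "\<bar>q y \<eta>\<bar> \<le> 2 * B \<eta>" if "y \<in> ball x r" "\<eta> \<in> space M" for y \<eta>
  proof (cases "y = x")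
    case False
    have "\<bar>(y - x) \<bullet> D x \<eta>\<bar> \<le> norm (y - x) * B \<eta>"
      using Cauchy_Schwarz_ineq2[of "y - x" "D x \<eta>"] bnd[OF xr that(2)]
      by (meson mult_left_mono norm_ge_zero order_trans)
    then have "\<bar>f y \<eta> - f x \<eta> - (y - x) \<bullet> D x \<eta>\<bar> \<le> B \<eta> * norm (y - x) + norm (y - x) * B \<eta>"
      using lip[OF that] by linarith
    then show ?thesis
      using False by (simp add: q_def field_simps)
  next
    case True
    have "0 \<le> B \<eta>"
      using bnd[OF xr that(2)] norm_ge_zero order_trans by blast
    then show ?thesis
      using True by (simp add: q_def)
  qed
  have "((\<lambda>y. norm ((\<integral>\<eta>. f y \<eta> \<partial>M) - (\<integral>\<eta>. f x \<eta> \<partial>M) - (y - x) \<bullet> (\<integral>\<eta>. D x \<eta> \<partial>M)) / norm (y - x)) \<longlongrightarrow> 0) (at x)"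
    unfolding tendsto_at_iff_sequentially
  proof (intro allI impI)
    fix X assume X: "\<forall>i. X i \<in> UNIV - {x}" "X \<longlonglongrightarrow> x"
    \<comment> \<open>Early terms of the sequence may lie outside the ball, where no bound is
      available; the value 0 there keeps every term dominated and does not affect the limit.\<close>
    define h where "h = (\<lambda>i \<eta>. if X i \<in> ball x r then q (X i) \<eta> else 0)"
    have ev: "eventually (\<lambda>i. X i \<in> ball x r) sequentially"
      using X(2) r by (auto dest: tendstoD simp: dist_commute)
    have "(\<lambda>i. \<integral>\<eta>. h i \<eta> \<partial>M) \<longlonglongrightarrow> (\<integral>\<eta>. 0 \<partial>M)"
    proof (rule integral_dominated_convergence[where w = "\<lambda>\<eta>. 2 * B \<eta>"])
      show "h i \<in> borel_measurable M" for i
      proof (cases "X i \<in> ball x r")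
        case True
        have [measurable]: "f (X i) \<in> borel_measurable M" "f x \<in> borel_measurable M"
          using f_int True xr by auto
        show ?thesis
          using True unfolding h_def q_def by simp
      qed (simp add: h_def)
      show "AE \<eta> in M. (\<lambda>i. h i \<eta>) \<longlonglongrightarrow> 0"
      proof (rule AE_I2)
        fix \<eta> assume \<eta>: "\<eta> \<in> space M"
        have "((\<lambda>y. f y \<eta>) has_derivative (\<lambda>h. h \<bullet> D x \<eta>)) (at x)"
          using der[OF xr \<eta>] by (simp add: gderiv_def)
        then have "((\<lambda>y. q y \<eta>) \<longlongrightarrow> 0) (at x)"
          unfolding has_derivative_iff_norm q_def by simp
        then have "(\<lambda>i. q (X i) \<eta>) \<longlonglongrightarrow> 0"
          using X unfolding tendsto_at_iff_sequentially by (auto simp: o_def)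
        then show "(\<lambda>i. h i \<eta>) \<longlonglongrightarrow> 0"
          by (rule Lim_transform_eventually) (use ev in eventually_elim, simp add: h_def)
      qed
      show "AE \<eta> in M. norm (h i \<eta>) \<le> 2 * B \<eta>" for i
      proof (rule AE_I2)
        fix \<eta> assume \<eta>: "\<eta> \<in> space M"
        have "0 \<le> B \<eta>"
          using bnd[OF xr \<eta>] norm_ge_zero order_trans by blast
        then show "norm (h i \<eta>) \<le> 2 * B \<eta>"
          using q_bnd[OF _ \<eta>] by (simp add: h_def)
      qed
    qed (use B in auto)
    then have lim: "(\<lambda>i. \<integral>\<eta>. h i \<eta> \<partial>M) \<longlonglongrightarrow> 0"
      by simp
    show "((\<lambda>y. norm ((\<integral>\<eta>. f y \<eta> \<partial>M) - (\<integral>\<eta>. f x \<eta> \<partial>M) - (y - x) \<bullet> (\<integral>\<eta>. D x \<eta> \<partial>M)) / norm (y - x)) \<circ> X) \<longlonglongrightarrow> 0"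
    proof (rule tendsto_sandwich[OF _ _ tendsto_const lim])
      show "eventually (\<lambda>i. ((\<lambda>y. norm ((\<integral>\<eta>. f y \<eta> \<partial>M) - (\<integral>\<eta>. f x \<eta> \<partial>M) - (y - x) \<bullet> (\<integral>\<eta>. D x \<eta> \<partial>M)) / norm (y - x)) \<circ> X) i \<le> (\<integral>\<eta>. h i \<eta> \<partial>M)) sequentially"
        using ev
      proof eventually_elim
        case (elim i)
        have int: "integrable M (\<lambda>\<eta>. f (X i) \<eta> - f x \<eta> - (X i - x) \<bullet> D x \<eta>)"
          using f_int[OF elim] f_int[OF xr] D_int by simp
        have "(\<integral>\<eta>. f (X i) \<eta> \<partial>M) - (\<integral>\<eta>. f x \<eta> \<partial>M) - (X i - x) \<bullet> (\<integral>\<eta>. D x \<eta> \<partial>M)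
            = (\<integral>\<eta>. f (X i) \<eta> - f x \<eta> - (X i - x) \<bullet> D x \<eta> \<partial>M)"
          using f_int[OF elim] f_int[OF xr] D_int by simp
        also have "\<bar>\<dots>\<bar> \<le> (\<integral>\<eta>. \<bar>f (X i) \<eta> - f x \<eta> - (X i - x) \<bullet> D x \<eta>\<bar> \<partial>M)"
          by (rule integral_abs_bound)
        finally show ?case
          using elim by (simp add: h_def q_def divide_right_mono)
      qed
    qed (simp add: eventually_sequentially)
  qed
  then show "GDERIV (\<lambda>y. \<integral>\<eta>. f y \<eta> \<partial>M) x :> (\<integral>\<eta>. D x \<eta> \<partial>M)"
    unfolding gderiv_def has_derivative_iff_norm by (simp add: bounded_linear_inner_left)
qed

section \<open>Continuous and zonal functions on the sphere\<close>

lemma borel_measurable_sphere_continuous: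
  fixes f :: "'a::euclidean_space \<Rightarrow> 'b::topological_space"
  assumes "continuous_on (sphere 0 1) f"
  shows "f \<in> borel_measurable sphere_measure"
proof -
  have "f \<in> borel_measurable (restrict_space borel (sphere 0 1))"
    using assms by (rule borel_measurable_continuous_on_restrict)
  then show ?thesis
    by (simp add: measurable_cong_sets[OF sets_sphere_measure refl])
qed

lemma integrable_sphere_continuous:
  fixes f :: "'a::euclidean_space \<Rightarrow> 'b::euclidean_space"
  assumes "continuous_on (sphere 0 1) f"
  shows "integrable sphere_measure f"
proof -
  interpret prob_space "sphere_measure :: 'a measure"
    by (rule prob_space_sphere_measure)
  have "bounded (f ` sphere 0 1)"
    by (intro compact_imp_bounded compact_continuous_image assms) simp
  then obtain C where "\<And>\<eta>. \<eta> \<in> sphere 0 1 \<Longrightarrow> norm (f \<eta>) \<le> C"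
    unfolding bounded_iff by (meson image_eqI)
  then show ?thesis
    by (intro integrable_const_bound[where B = C] AE_I2 borel_measurable_sphere_continuous assms) simp
qed

lemma inner_sphere_bound:
  assumes "norm e = 1" "\<eta> \<in> sphere 0 1"
  shows "\<eta> \<bullet> e \<in> {-1..1}"
  using Cauchy_Schwarz_ineq2[of \<eta> e] assms by auto

lemma integrable_sphere_zonal:
  fixes e :: "'a::euclidean_space" and k :: "real \<Rightarrow> real"
  assumes "norm e = 1" "continuous_on {-1..1} k"
  shows "integrable sphere_measure (\<lambda>\<eta>. k (\<eta> \<bullet> e))"
  by (intro integrable_sphere_continuous continuous_on_compose2[OF assms(2)] continuous_intros)
    (use inner_sphere_bound[OF assms(1)] in auto)

text \<open>A constant dominates the derivative: \<open>k'\<close> is continuous on the compact set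
  \<open>cball r d \<times> {-1..1}\<close>, which contains all pairs
  \<open>(s, \<eta> \<bullet> e)\<close> with \<open>s\<close> near \<open>r\<close>.\<close>

lemma DERIV_sphere_zonal:
  fixes e :: "'a::euclidean_space" and k k' :: "real \<Rightarrow> real \<Rightarrow> real"
  assumes e: "norm e = 1" and d: "0 < d"
    and k: "continuous_on (cball r d \<times> {-1..1}) (\<lambda>(s, t). k s t)"
    and k': "continuous_on (cball r d \<times> {-1..1}) (\<lambda>(s, t). k' s t)"
    and der: "\<And>s t. s \<in> ball r d \<Longrightarrow> t \<in> {-1..1} \<Longrightarrow> ((\<lambda>s. k s t) has_real_derivative k' s t) (at s)"
  shows "((\<lambda>s. \<integral>\<eta>. k s (\<eta> \<bullet> e) \<partial>sphere_measure) has_real_derivative (\<integral>\<eta>. k' r (\<eta> \<bullet> e) \<partial>sphere_measure)) (at r)"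
proof -
  interpret prob_space "sphere_measure :: 'a measure"
    by (rule prob_space_sphere_measure)
  have slice: "continuous_on {-1..1} (g s)" if "continuous_on (cball r d \<times> {-1..1}) (\<lambda>(s, t). g s t)" "s \<in> ball r d"
    for g :: "real \<Rightarrow> real \<Rightarrow> real" and s
  proof -
    have "continuous_on {-1..1} (\<lambda>t. (\<lambda>(s, t). g s t) (s, t))"
      by (rule continuous_on_compose2[OF that(1)]) (use that(2) in \<open>auto intro!: continuous_intros\<close>)
    then show ?thesis
      by simp
  qed
  have "bounded ((\<lambda>(s, t). k' s t) ` (cball r d \<times> {-1..1}))"
    by (intro compact_imp_bounded compact_continuous_image k' compact_Times) auto
  then obtain C where C: "\<And>s t. s \<in> cball r d \<Longrightarrow> t \<in> {-1..1} \<Longrightarrow> norm (k' s t) \<le> C"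
    unfolding bounded_iff by fastforce
  have "GDERIV (\<lambda>s. \<integral>\<eta>. k s (\<eta> \<bullet> e) \<partial>sphere_measure) r :> (\<integral>\<eta>. k' r (\<eta> \<bullet> e) \<partial>sphere_measure)"
  proof (rule GDERIV_integral(2)[OF d, where B = "\<lambda>_. C"])
    show "integrable sphere_measure (\<lambda>\<eta>. k s (\<eta> \<bullet> e))" if "s \<in> ball r d" for s
      using integrable_sphere_zonal[OF e slice[OF k that]] .
    show "GDERIV (\<lambda>s. k s (\<eta> \<bullet> e)) s :> k' s (\<eta> \<bullet> e)" if "s \<in> ball r d" "\<eta> \<in> space sphere_measure" for s \<eta>
      using der[OF that(1)] inner_sphere_bound[OF e] that(2) by simp
    show "norm (k' s (\<eta> \<bullet> e)) \<le> C" if "s \<in> ball r d" "\<eta> \<in> space sphere_measure" for s \<eta>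
      using C[of s "\<eta> \<bullet> e"] inner_sphere_bound[OF e] that by simp
    show "(\<lambda>\<eta>. k' r (\<eta> \<bullet> e)) \<in> borel_measurable sphere_measure"
      using integrable_sphere_zonal[OF e slice[OF k']] d by auto
  qed simp
  then show ?thesis
    by simp
qed

lemma one_minus_two_mult_add_sq_pos:
  fixes r t :: real
  assumes "\<bar>r\<bar> < 1" "t \<in> {-1..1}"
  shows "0 < 1 - 2 * r * t + r\<^sup>2"
proof -
  have "\<bar>r * t\<bar> \<le> \<bar>r\<bar> * 1"
    unfolding abs_mult using assms by (intro mult_left_mono) auto
  then have "(1 - \<bar>r\<bar>)\<^sup>2 \<le> 1 - 2 * r * t + r\<^sup>2"
    by (simp add: power2_diff)
  moreover have "0 < (1 - \<bar>r\<bar>)\<^sup>2"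
    using assms by simp
  ultimately show ?thesis
    by linarith
qed

lemma norm_sphere_diff_sq:
  fixes e \<eta> :: "'a::euclidean_space"
  assumes "norm e = 1" "norm \<eta> = 1"
  shows "(norm (\<eta> - r *\<^sub>R e))\<^sup>2 = 1 - 2 * r * (\<eta> \<bullet> e) + r\<^sup>2"
  using norm_add_scaleR_sq[of \<eta> "- r" e] assms by simp

text \<open>Integration by parts on the sphere for zonal functions, obtained as the derivative at
  \<open>\<epsilon> = 0\<close> of the invariance formula \<open>integral_sphere_chord\<close> at the point \<open>\<epsilon> *\<^sub>R e\<close>.\<close>

lemma integral_sphere_zonal_by_parts:
  fixes e :: "'a::euclidean_space" and H H' :: "real \<Rightarrow> real"
  assumes e: "norm e = 1"
    and H [measurable]: "H \<in> borel_measurable borel"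
    and der: "\<And>t. t \<in> {-1..1} \<Longrightarrow> (H has_real_derivative H' t) (at t)"
    and H': "continuous_on {-1..1} H'"
    and dim: "2 \<le> DIM('a)"
  shows "(\<integral>\<eta>. (real DIM('a) - 1) * (\<eta> \<bullet> e) * H (- (\<eta> \<bullet> e)) + (1 - (\<eta> \<bullet> e)\<^sup>2) * H' (- (\<eta> \<bullet> e)) \<partial>sphere_measure) = 0"
proof -
  define m where "m = DIM('a) - 1"
  \<comment> \<open>For unit \<open>\<eta>\<close> with \<open>t = \<eta> \<bullet> e\<close>,
    \<open>w s t\<close> is the squared distance from \<open>s *\<^sub>R e\<close> to
    \<open>\<eta>\<close>, \<open>rho s t\<close> is the negated chord ratio, and
    \<open>tau s t\<close> is the component along \<open>e\<close> of the other endpoint of the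
    chord. The primed functions are derivatives in \<open>s\<close>.\<close>
  define w where "w = (\<lambda>s t :: real. 1 - 2 * s * t + s\<^sup>2)"
  define rho where "rho = (\<lambda>s t. (1 - s\<^sup>2) / w s t)"
  define tau where "tau = (\<lambda>s t. s - rho s t * (t - s))"
  define rho' where "rho' = (\<lambda>s t. (- 2 * s * w s t - (1 - s\<^sup>2) * (- 2 * t + 2 * s)) / (w s t)\<^sup>2)"
  define tau' where "tau' = (\<lambda>s t. 1 - (rho' s t * (t - s) - rho s t))"
  define k where "k = (\<lambda>s t. rho s t ^ m * H (tau s t))"
  define k' where "k' = (\<lambda>s t. real m * rho s t ^ (m - 1) * rho' s t * H (tau s t) + rho s t ^ m * (H' (tau s t) * tau' s t))"
  have wpos: "0 < w s t" if "\<bar>s\<bar> < 1" "t \<in> {-1..1}" for s t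
    using one_minus_two_mult_add_sq_pos[OF that] by (simp add: w_def)
  have tau_bound: "tau s t \<in> {-1..1}" if "\<bar>s\<bar> < 1" "t \<in> {-1..1}" for s t
  proof -
    have w: "0 < w s t" by (rule wpos[OF that])
    have s2: "s\<^sup>2 < 1" using that by (simp add: abs_square_less_1)
    have p: "tau s t * w s t = s * w s t - (1 - s\<^sup>2) * (t - s)"
      using w by (simp add: tau_def rho_def field_simps)
    \<comment> \<open>The two factorisations make the signs of \<open>1 - tau s t\<close> and
      \<open>1 + tau s t\<close> evident.\<close>
    have "w s t - tau s t * w s t = (1 - s)\<^sup>2 * (1 + t)"
      unfolding p unfolding w_def by (simp add: algebra_simps power2_eq_square)
    moreover have "w s t + tau s t * w s t = (1 + s)\<^sup>2 * (1 - t)"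
      unfolding p unfolding w_def by (simp add: algebra_simps power2_eq_square)
    ultimately have "w s t * (1 - tau s t) = (1 - s)\<^sup>2 * (1 + t)" "w s t * (1 + tau s t) = (1 + s)\<^sup>2 * (1 - t)"
      by (simp_all only: right_diff_distrib distrib_left mult_1_right mult.commute[of "tau s t"])
    moreover have "0 \<le> (1 - s)\<^sup>2 * (1 + t)" "0 \<le> (1 + s)\<^sup>2 * (1 - t)"
      using that by simp_all
    ultimately have "0 \<le> w s t * (1 - tau s t)" "0 \<le> w s t * (1 + tau s t)"
      by simp_all
    then show ?thesis
      using w by (simp add: zero_le_mult_iff)
  qed
  have const: "(\<integral>\<eta>. k s (\<eta> \<bullet> e) \<partial>sphere_measure) = (\<integral>\<eta>. H (\<eta> \<bullet> e) \<partial>sphere_measure)" if s: "\<bar>s\<bar> < 1" for s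
  proof -
    have x: "norm (s *\<^sub>R e) < 1"
      using s e by simp
    have contH: "continuous_on {-1..1} H"
      by (meson der DERIV_continuous continuous_at_imp_continuous_on)
    have "(\<integral>\<eta>. \<bar>chord_ratio (s *\<^sub>R e) \<eta>\<bar> ^ (DIM('a) - 1) * H (chord (s *\<^sub>R e) \<eta> \<bullet> e) \<partial>sphere_measure)
        = (\<integral>\<eta>. H (\<eta> \<bullet> e) \<partial>sphere_measure)"
      by (rule integral_sphere_chord[OF x, of "\<lambda>\<eta>. H (\<eta> \<bullet> e)"])
        (use integrable_sphere_zonal[OF e contH] in auto)
    moreover have "(\<integral>\<eta>. \<bar>chord_ratio (s *\<^sub>R e) \<eta>\<bar> ^ (DIM('a) - 1) * H (chord (s *\<^sub>R e) \<eta> \<bullet> e) \<partial>sphere_measure)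
        = (\<integral>\<eta>. k s (\<eta> \<bullet> e) \<partial>sphere_measure)"
    proof (rule Bochner_Integration.integral_cong[OF refl])
      fix \<eta> :: 'a assume "\<eta> \<in> space sphere_measure"
      then have \<eta>: "norm \<eta> = 1" and t: "\<eta> \<bullet> e \<in> {-1..1}"
        using inner_sphere_bound[OF e] by auto
      have ratio: "chord_ratio (s *\<^sub>R e) \<eta> = - rho s (\<eta> \<bullet> e)"
        using \<eta> e norm_sphere_diff_sq[OF e \<eta>] by (simp add: chord_ratio_def rho_def w_def recenter_def)
      have "s\<^sup>2 \<le> 1"
        using s by (simp add: abs_square_le_1)
      then have "0 \<le> rho s (\<eta> \<bullet> e)"
        using wpos[OF s t] by (simp add: rho_def)
      moreover have "chord (s *\<^sub>R e) \<eta> \<bullet> e = tau s (\<eta> \<bullet> e)"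
        using \<eta> e by (simp add: chord_def ratio tau_def recenter_def inner_add_left inner_diff_left dot_square_norm)
      ultimately show "\<bar>chord_ratio (s *\<^sub>R e) \<eta>\<bar> ^ (DIM('a) - 1) * H (chord (s *\<^sub>R e) \<eta> \<bullet> e) = k s (\<eta> \<bullet> e)"
        by (simp add: k_def ratio m_def)
    qed
    ultimately show ?thesis
      by simp
  qed
  let ?C = "cball 0 (1/2) \<times> {-1..1 :: real}"
  have wne: "w s t \<noteq> 0" if "\<bar>s\<bar> * 2 \<le> 1" "-1 \<le> t" "t \<le> 1" for s t
    using wpos[of s t] that by auto
  have cw: "continuous_on ?C (\<lambda>(s, t). w s t)"
    unfolding w_def by (auto simp: case_prod_unfold intro!: continuous_intros)
  have crho: "continuous_on ?C (\<lambda>(s, t). rho s t)"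
    using cw unfolding rho_def by (auto simp: case_prod_unfold intro!: continuous_intros dest: wne)
  have crho': "continuous_on ?C (\<lambda>(s, t). rho' s t)"
    using cw unfolding rho'_def by (auto simp: case_prod_unfold intro!: continuous_intros dest: wne)
  have ctau: "continuous_on ?C (\<lambda>(s, t). tau s t)"
    using crho unfolding tau_def by (auto simp: case_prod_unfold intro!: continuous_intros)
  have ctau': "continuous_on ?C (\<lambda>(s, t). tau' s t)"
    using crho crho' unfolding tau'_def by (auto simp: case_prod_unfold intro!: continuous_intros)
  have comp: "continuous_on ?C (\<lambda>(s, t). g (tau s t))" if "continuous_on {-1..1} g" for g :: "real \<Rightarrow> real"
    using continuous_on_compose2[OF that ctau] tau_bound by (fastforce simp: case_prod_unfold)
  have "continuous_on {-1..1} H"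
    by (meson der DERIV_continuous continuous_at_imp_continuous_on)
  note cH = comp[OF this] and cH' = comp[OF H']
  have ck: "continuous_on ?C (\<lambda>(s, t). k s t)"
    using crho cH unfolding k_def by (auto simp: case_prod_unfold intro!: continuous_intros)
  have ck': "continuous_on ?C (\<lambda>(s, t). k' s t)"
    using crho crho' ctau' cH cH' unfolding k'_def by (auto simp: case_prod_unfold intro!: continuous_intros)
  have derk: "((\<lambda>s. k s t) has_real_derivative k' s t) (at s)" if st: "s \<in> ball 0 (1/2)" "t \<in> {-1..1}" for s t
  proof -
    have s: "\<bar>s\<bar> < 1" using st by auto
    have "((\<lambda>s. w s t) has_real_derivative (- 2 * t + 2 * s)) (at s)"
      unfolding w_def by (auto intro!: derivative_eq_intros)
    then have drho: "((\<lambda>s. rho s t) has_real_derivative rho' s t) (at s)"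
      unfolding rho_def rho'_def using wpos[OF s st(2)]
      by (auto intro!: derivative_eq_intros simp: power2_eq_square)
    then have dtau: "((\<lambda>s. tau s t) has_real_derivative tau' s t) (at s)"
      unfolding tau_def tau'_def by (auto intro!: derivative_eq_intros)
    have "((\<lambda>s. H (tau s t)) has_real_derivative H' (tau s t) * tau' s t) (at s)"
      by (rule DERIV_chain2[OF der dtau]) (rule tau_bound[OF s st(2)])
    with drho show ?thesis
      unfolding k_def k'_def by (auto intro!: derivative_eq_intros)
  qed
  have "((\<lambda>s. \<integral>\<eta>. k s (\<eta> \<bullet> e) \<partial>sphere_measure) has_real_derivative (\<integral>\<eta>. k' 0 (\<eta> \<bullet> e) \<partial>sphere_measure)) (at 0)"
    by (rule DERIV_sphere_zonal[OF e _ ck ck' derk]) auto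
  moreover have "((\<lambda>s. \<integral>\<eta>. k s (\<eta> \<bullet> e) \<partial>sphere_measure) has_real_derivative 0) (at 0)"
    by (rule has_field_derivative_transform_within_open[OF DERIV_const, where S = "ball 0 1"])
      (auto simp: const)
  ultimately have "(\<integral>\<eta>. k' 0 (\<eta> \<bullet> e) \<partial>sphere_measure) = 0"
    by (rule DERIV_unique)
  \<comment> \<open>At \<open>s = 0\<close> the chord map is the antipodal map:
    \<open>rho = 1\<close> and \<open>tau = - t\<close>, which explains the reflected arguments of
    \<open>H\<close>. Moreover \<open>rho' = 2 * t\<close> and
    \<open>tau' = 2 * (1 - t\<^sup>2)\<close>.\<close>
  moreover have "k' 0 t = 2 * ((real DIM('a) - 1) * t * H (- t) + (1 - t\<^sup>2) * H' (- t))" for t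
    using dim by (simp add: k'_def m_def rho_def rho'_def tau_def tau'_def w_def algebra_simps
        power2_eq_square of_nat_diff)
  ultimately have "2 * (\<integral>\<eta>. (real DIM('a) - 1) * (\<eta> \<bullet> e) * H (- (\<eta> \<bullet> e)) + (1 - (\<eta> \<bullet> e)\<^sup>2) * H' (- (\<eta> \<bullet> e)) \<partial>sphere_measure) = 0"
    by (simp only: integral_mult_right_zero)
  then show ?thesis
    by simp
qed

section \<open>Power means of the distance to a point\<close>

lemma hyp2F1_coeff_summable:
  fixes a b c z :: real
  assumes c: "0 < c" and z: "\<bar>z\<bar> < 1"
  shows "summable (\<lambda>k. pochhammer a k * pochhammer b k / (pochhammer c k * fact k) * z ^ k)"
proof -
  let ?t = "\<lambda>k. pochhammer a k * pochhammer b k / (pochhammer c k * fact k) * z ^ k"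
  let ?q = "\<lambda>k. \<bar>(a + real k) * (b + real k) / ((c + real k) * (1 + real k)) * z\<bar>"
  have "?q \<longlonglongrightarrow> \<bar>1 * z\<bar>"
    by (intro tendsto_intros) real_asymp
  then have "eventually (\<lambda>k. ?q k < (\<bar>z\<bar> + 1) / 2) sequentially"
    by (rule order_tendstoD) (use z in simp)
  then obtain N where N: "\<And>k. N \<le> k \<Longrightarrow> ?q k < (\<bar>z\<bar> + 1) / 2"
    unfolding eventually_sequentially by blast
  show ?thesis
  proof (rule summable_ratio_test[where c = "(\<bar>z\<bar> + 1) / 2" and N = N])
    fix k assume "N \<le> k"
    have "?t (Suc k) = ((a + real k) * (b + real k) / ((c + real k) * (1 + real k)) * z) * ?t k"
      by (simp add: pochhammer_rec' mult_ac)
    then have "norm (?t (Suc k)) = ?q k * norm (?t k)"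
      by (metis abs_mult real_norm_def)
    also have "\<dots> \<le> (\<bar>z\<bar> + 1) / 2 * norm (?t k)"
      using N[OF \<open>N \<le> k\<close>] by (intro mult_right_mono) auto
    finally show "norm (?t (Suc k)) \<le> (\<bar>z\<bar> + 1) / 2 * norm (?t k)" .
  qed (use z in simp)
qed

lemma hyp2F1_0: "hyp2F1 a b c 0 = 1"
proof -
  have "(\<lambda>k. pochhammer a k * pochhammer b k / pochhammer c k * 0 ^ k / fact k) sums
      (\<Sum>k\<in>{0}. pochhammer a k * pochhammer b k / pochhammer c k * 0 ^ k / fact k)"
    by (rule sums_finite) auto
  then show ?thesis
    unfolding hyp2F1_def by (simp add: sums_iff)
qed

text \<open>Gauss's equation amounts, coefficient by coefficient, to the recursion
  \<open>(k + 1) * (c + k) * u (Suc k) = (a + k) * (b + k) * u k\<close> of the Pochhammer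
  quotients; \<open>0 < c\<close> keeps their denominators away from 0.\<close>

lemma hyp2F1_ODE:
  fixes a b c :: real
  assumes c: "0 < c"
  obtains F1 F2 where
    "\<And>z. \<bar>z\<bar> < 1 \<Longrightarrow> (hyp2F1 a b c has_real_derivative F1 z) (at z)"
    "\<And>z. \<bar>z\<bar> < 1 \<Longrightarrow> (F1 has_real_derivative F2 z) (at z)"
    "\<And>z. \<bar>z\<bar> < 1 \<Longrightarrow> z * (1 - z) * F2 z + (c - (a + b + 1) * z) * F1 z - a * b * hyp2F1 a b c z = 0"
proof -
  define u where "u = (\<lambda>k. pochhammer a k * pochhammer b k / (pochhammer c k * fact k))"
  have F: "hyp2F1 a b c = (\<lambda>z. \<Sum>k. u k * z ^ k)"
    by (simp add: hyp2F1_def u_def fun_eq_iff divide_simps)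
  define F1 where "F1 = (\<lambda>z. \<Sum>k. diffs u k * z ^ k)"
  define F2 where "F2 = (\<lambda>z. \<Sum>k. diffs (diffs u) k * z ^ k)"
  have s0: "summable (\<lambda>k. u k * z ^ k)" if "\<bar>z\<bar> < 1" for z
    unfolding u_def using c that by (rule hyp2F1_coeff_summable)
  have s1: "summable (\<lambda>k. diffs u k * z ^ k)" if "\<bar>z\<bar> < 1" for z
    using termdiff_converges[of z 1 u] s0 that by simp
  have s2: "summable (\<lambda>k. diffs (diffs u) k * z ^ k)" if "\<bar>z\<bar> < 1" for z
    using termdiff_converges[of z 1 "diffs u"] s1 that by simp
  have d1: "(hyp2F1 a b c has_real_derivative F1 z) (at z)" if "\<bar>z\<bar> < 1" for z
    unfolding F F1_def by (rule termdiffs_strong'[where K = 1]) (use s0 that in auto)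
  have d2: "(F1 has_real_derivative F2 z) (at z)" if "\<bar>z\<bar> < 1" for z
    unfolding F1_def F2_def by (rule termdiffs_strong'[where K = 1]) (use s1 that in auto)
  have ode: "z * (1 - z) * F2 z + (c - (a + b + 1) * z) * F1 z - a * b * hyp2F1 a b c z = 0"
    if z: "\<bar>z\<bar> < 1" for z
  proof -
    have rec: "(real k + 1) * (c + real k) * u (Suc k) = (a + real k) * (b + real k) * u k" for k
    proof -
      have "u (Suc k) = (a + real k) * (b + real k) / ((c + real k) * (1 + real k)) * u k"
        by (simp add: u_def pochhammer_rec' mult_ac)
      moreover have "c + real k \<noteq> 0" "1 + real k \<noteq> 0"
        using c by auto
      ultimately show ?thesis
        by (simp add: add.commute)
    qed
    have 0: "(\<lambda>k. u k * z ^ k) sums hyp2F1 a b c z"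
      unfolding F using s0[OF z] by (rule summable_sums)
    have 1: "(\<lambda>k. (real k + 1) * u (Suc k) * z ^ k) sums F1 z"
      using summable_sums[OF s1[OF z]] by (simp add: F1_def diffs_def add.commute)
    have 2: "(\<lambda>k. (real k + 1) * (real k + 2) * u (Suc (Suc k)) * z ^ k) sums F2 z"
      using summable_sums[OF s2[OF z]] by (simp add: F2_def diffs_def algebra_simps)
    \<comment> \<open>Multiplication by \<open>z\<close> shifts the index. In each of these three
      series the term at \<open>k = 0\<close> carries the factor \<open>real k\<close>, so the shift
      adds no boundary term.\<close>
    have z1: "(\<lambda>k. real k * u k * z ^ k) sums (z * F1 z)"
      using sums_mult[OF 1, of z]
      by (subst sums_Suc_iff[symmetric, where f = "\<lambda>k. real k * u k * z ^ k", simplified])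
        (simp add: mult_ac add.commute)
    have z2: "(\<lambda>k. real k * (real k + 1) * u (Suc k) * z ^ k) sums (z * F2 z)"
      using sums_mult[OF 2, of z]
      by (subst sums_Suc_iff[symmetric, where f = "\<lambda>k. real k * (real k + 1) * u (Suc k) * z ^ k", simplified])
        (simp add: mult_ac add.commute)
    have z3: "(\<lambda>k. real k * (real k - 1) * u k * z ^ k) sums (z * (z * F2 z))"
      using sums_mult[OF z2, of z]
      by (subst sums_Suc_iff[symmetric, where f = "\<lambda>k. real k * (real k - 1) * u k * z ^ k", simplified])
        (simp add: mult_ac add.commute)
    have "(\<lambda>k. real k * (real k + 1) * u (Suc k) * z ^ k - real k * (real k - 1) * u k * z ^ k
        + c * ((real k + 1) * u (Suc k) * z ^ k) - (a + b + 1) * (real k * u k * z ^ k) - a * b * (u k * z ^ k))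
      sums (z * F2 z - z * (z * F2 z) + c * F1 z - (a + b + 1) * (z * F1 z) - a * b * hyp2F1 a b c z)"
      by (intro sums_add sums_diff sums_mult 0 1 z1 z2 z3)
    moreover have "real k * (real k + 1) * u (Suc k) * z ^ k - real k * (real k - 1) * u k * z ^ k
        + c * ((real k + 1) * u (Suc k) * z ^ k) - (a + b + 1) * (real k * u k * z ^ k) - a * b * (u k * z ^ k) = 0" for k
    proof -
      have "real k * (real k + 1) * u (Suc k) * z ^ k - real k * (real k - 1) * u k * z ^ k
        + c * ((real k + 1) * u (Suc k) * z ^ k) - (a + b + 1) * (real k * u k * z ^ k) - a * b * (u k * z ^ k)
        = ((real k + 1) * (c + real k) * u (Suc k) - (a + real k) * (b + real k) * u k) * z ^ k"
        by (simp add: algebra_simps)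
      then show ?thesis
        unfolding rec by simp
    qed
    ultimately have "z * F2 z - z * (z * F2 z) + c * F1 z - (a + b + 1) * (z * F1 z) - a * b * hyp2F1 a b c z = 0"
      by (simp add: sums_iff)
    then show ?thesis
      by (simp add: algebra_simps)
  qed
  show ?thesis
    using that d1 d2 ode by blast
qed

section \<open>Power means as solutions of the hypergeometric equation\<close>

context
  fixes e :: "'a::euclidean_space" and a :: real
  assumes e: "norm e = 1" and dim: "2 \<le> DIM('a)"
begin

text \<open>By the law of cosines, the squared distance from \<open>r *\<^sub>R e\<close> to a unit
  vector whose inner product with \<open>e\<close> is \<open>t\<close>. Below, \<open>m0\<close> is
  a power of it, and \<open>m1\<close>, \<open>m2\<close> are the first two derivatives of
  \<open>m0\<close> in \<open>r\<close>.\<close>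

private definition w :: "real \<Rightarrow> real \<Rightarrow> real" where
  "w r t = 1 - 2 * r * t + r\<^sup>2"

private definition m0 :: "real \<Rightarrow> real \<Rightarrow> real" where
  "m0 r t = w r t powr a"

private definition m1 :: "real \<Rightarrow> real \<Rightarrow> real" where
  "m1 r t = 2 * a * (r - t) * w r t powr (a - 1)"

private definition m2 :: "real \<Rightarrow> real \<Rightarrow> real" where
  "m2 r t = 2 * a * w r t powr (a - 1) + 4 * a * (a - 1) * (r - t)\<^sup>2 * w r t powr (a - 2)"

private lemma w_pos: "\<bar>r\<bar> < 1 \<Longrightarrow> t \<in> {-1..1} \<Longrightarrow> 0 < w r t"
  unfolding w_def by (rule one_minus_two_mult_add_sq_pos)

private lemma cball_sub:
  assumes "\<bar>r\<bar> < 1" "s \<in> cball r ((1 - \<bar>r\<bar>) / 2)"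
  shows "\<bar>s\<bar> < 1"
  using assms by (auto simp: dist_real_def abs_if split: if_splits)

private lemma cont_w:
  assumes "\<bar>r\<bar> < 1"
  shows "continuous_on (cball r ((1 - \<bar>r\<bar>) / 2) \<times> {-1..1}) (\<lambda>(s, t). w s t powr p)"
proof -
  have "w (fst z) (snd z) \<noteq> 0" if "z \<in> cball r ((1 - \<bar>r\<bar>) / 2) \<times> {-1..1}" for z
    using w_pos[OF cball_sub[OF assms]] that by (metis less_irrefl mem_Times_iff)
  then show ?thesis
    unfolding case_prod_unfold by (intro continuous_on_powr continuous_intros) (auto simp: w_def intro!: continuous_intros)
qed

private lemma cont_m:
  assumes "\<bar>r\<bar> < 1"
  shows "continuous_on (cball r ((1 - \<bar>r\<bar>) / 2) \<times> {-1..1}) (\<lambda>(s, t). m0 s t)"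
    "continuous_on (cball r ((1 - \<bar>r\<bar>) / 2) \<times> {-1..1}) (\<lambda>(s, t). m1 s t)"
    "continuous_on (cball r ((1 - \<bar>r\<bar>) / 2) \<times> {-1..1}) (\<lambda>(s, t). m2 s t)"
  unfolding m0_def m1_def m2_def case_prod_unfold
  by (intro continuous_on_add continuous_on_mult continuous_on_diff continuous_on_power continuous_on_const
      continuous_on_fst continuous_on_snd continuous_on_id cont_w[OF assms, unfolded case_prod_unfold])+

private lemma der_m:
  assumes "\<bar>s\<bar> < 1" "t \<in> {-1..1}"
  shows "((\<lambda>s. m0 s t) has_real_derivative m1 s t) (at s)"
    "((\<lambda>s. m1 s t) has_real_derivative m2 s t) (at s)"
proof -
  have dw: "((\<lambda>s. w s t) has_real_derivative (2 * s - 2 * t)) (at s)"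
    unfolding w_def by (auto intro!: derivative_eq_intros)
  have dp: "((\<lambda>s. w s t powr p) has_real_derivative (p * w s t powr (p - 1) * (2 * s - 2 * t))) (at s)" for p
    using DERIV_chain2[OF has_real_derivative_powr[OF w_pos[OF assms]] dw] by simp
  show "((\<lambda>s. m0 s t) has_real_derivative m1 s t) (at s)"
    unfolding m0_def m1_def by (rule DERIV_cong[OF dp]) (simp add: algebra_simps)
  show "((\<lambda>s. m1 s t) has_real_derivative m2 s t) (at s)"
    unfolding m1_def m2_def
    by (rule DERIV_cong, rule DERIV_mult[OF _ dp], auto intro!: derivative_eq_intros)
      (simp add: algebra_simps power2_eq_square)
qed

private definition M :: "(real \<Rightarrow> real \<Rightarrow> real) \<Rightarrow> real \<Rightarrow> real" where
  "M m r = (\<integral>\<eta>. m r (\<eta> \<bullet> e) \<partial>sphere_measure)"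

private lemma DERIV_M:
  assumes "\<bar>r\<bar> < 1"
  shows "(M m0 has_real_derivative M m1 r) (at r)" "(M m1 has_real_derivative M m2 r) (at r)"
proof -
  have d: "0 < (1 - \<bar>r\<bar>) / 2"
    using assms by simp
  have sub: "\<bar>s\<bar> < 1" if "s \<in> ball r ((1 - \<bar>r\<bar>) / 2)" for s
    using cball_sub[OF assms, of s] that by auto
  show "(M m0 has_real_derivative M m1 r) (at r)"
    unfolding M_def
    by (rule DERIV_sphere_zonal[OF e d cont_m(1,2)[OF assms] der_m(1)[OF sub]])
  show "(M m1 has_real_derivative M m2 r) (at r)"
    unfolding M_def
    by (rule DERIV_sphere_zonal[OF e d cont_m(2,3)[OF assms] der_m(2)[OF sub]])
qed

private lemma cont_w_slice:
  assumes "\<bar>r\<bar> < 1"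
  shows "continuous_on {-1..1} (\<lambda>t. w r t powr p)"
proof -
  have "w r t \<noteq> 0" if "t \<in> {-1..1}" for t
    using w_pos[OF assms that] by simp
  then show ?thesis
    by (intro continuous_on_powr) (auto simp: w_def intro!: continuous_intros)
qed

private lemma integrable_m:
  assumes "\<bar>r\<bar> < 1"
  shows "integrable sphere_measure (\<lambda>\<eta>. m0 r (\<eta> \<bullet> e))"
    "integrable sphere_measure (\<lambda>\<eta>. m1 r (\<eta> \<bullet> e))"
    "integrable sphere_measure (\<lambda>\<eta>. m2 r (\<eta> \<bullet> e))"
  by (intro integrable_sphere_zonal[OF e];
      auto simp: m0_def[abs_def] m1_def[abs_def] m2_def[abs_def] intro!: continuous_intros cont_w_slice[OF assms])+

text \<open>This is Gauss's equation with parameters \<open>- a\<close>,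
  \<open>1 - a - n / 2\<close>, \<open>n / 2\<close> after the substitution
  \<open>z = r\<^sup>2\<close>, multiplied by \<open>4 * r\<close>. It holds because the same
  combination of \<open>m0\<close>, \<open>m1\<close>, \<open>m2\<close> is pointwise a multiple of
  an integrand that integrates to 0 by parts.\<close>

private lemma ODE_M:
  assumes r: "\<bar>r\<bar> < 1"
  defines "n \<equiv> real DIM('a)"
  shows "(1 - r\<^sup>2) * r * M m2 r + ((n - 1) + (n - 3 + 4 * a) * r\<^sup>2) * M m1 r
      - 2 * a * (2 * a + n - 2) * r * M m0 r = 0"
proof -
  \<comment> \<open>The argument \<open>- t\<close> compensates the reflection in the formula for
    integration by parts, so that \<open>H (- t)\<close> is
    \<open>w r t powr (a - 1)\<close>.\<close>
  define H where "H = (\<lambda>t :: real. w r (- t) powr (a - 1))"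
  define H' where "H' = (\<lambda>t :: real. 2 * r * (a - 1) * w r (- t) powr (a - 2))"
  have parts: "(\<integral>\<eta>. (n - 1) * (\<eta> \<bullet> e) * H (- (\<eta> \<bullet> e)) + (1 - (\<eta> \<bullet> e)\<^sup>2) * H' (- (\<eta> \<bullet> e)) \<partial>sphere_measure) = 0"
    unfolding n_def
  proof (rule integral_sphere_zonal_by_parts[OF e _ _ _ dim])
    show "H \<in> borel_measurable borel"
      unfolding H_def w_def by measurable
    show "(H has_real_derivative H' t) (at t)" if "t \<in> {-1..1}" for t
    proof -
      have "- t \<in> {-1..1}" using that by auto
      then have pos: "0 < w r (- t)" by (rule w_pos[OF r])
      have dw: "((\<lambda>t. w r (- t)) has_real_derivative (2 * r)) (at t)"
        unfolding w_def by (auto intro!: derivative_eq_intros)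
      show ?thesis
        unfolding H_def H'_def using DERIV_chain2[OF has_real_derivative_powr[OF pos] dw]
        by (rule DERIV_cong) simp
    qed
    have "continuous_on {-1..1} (\<lambda>t. w r (- t) powr (a - 2))"
      by (rule continuous_on_compose2[OF cont_w_slice[OF r]]) (auto intro!: continuous_intros)
    then show "continuous_on {-1..1} H'"
      unfolding H'_def by (auto intro!: continuous_intros)
  qed
  have pt: "(1 - r\<^sup>2) * r * m2 r t + ((n - 1) + (n - 3 + 4 * a) * r\<^sup>2) * m1 r t
      - 2 * a * (2 * a + n - 2) * r * m0 r t
      = (- 2 * a * (1 - r\<^sup>2)) * ((n - 1) * t * H (- t) + (1 - t\<^sup>2) * H' (- t))" if "t \<in> {-1..1}" for t
  proof -
    have pos: "0 < w r t"
      by (rule w_pos[OF r that])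
    \<comment> \<open>With the lowest power of \<open>w\<close> factored out, the identity becomes
      polynomial in \<open>r\<close>, \<open>t\<close>, \<open>a\<close> and
      \<open>n\<close>.\<close>
    define W where "W = w r t powr (a - 2)"
    have W1: "w r t powr (a - 1) = W * w r t"
      using pos powr_add[of "w r t" "a - 2" 1] by (simp add: W_def)
    have W0: "w r t powr a = W * w r t * w r t"
      using pos powr_add[of "w r t" "a - 2" 2] by (simp add: W_def power2_eq_square)
    show ?thesis
      unfolding m0_def m1_def m2_def H_def H'_def minus_minus W_def[symmetric] W1 W0
      unfolding w_def by algebra
  qed
  have "(1 - r\<^sup>2) * r * M m2 r + ((n - 1) + (n - 3 + 4 * a) * r\<^sup>2) * M m1 r
      - 2 * a * (2 * a + n - 2) * r * M m0 r
    = (\<integral>\<eta>. (1 - r\<^sup>2) * r * m2 r (\<eta> \<bullet> e) + ((n - 1) + (n - 3 + 4 * a) * r\<^sup>2) * m1 r (\<eta> \<bullet> e)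
      - 2 * a * (2 * a + n - 2) * r * m0 r (\<eta> \<bullet> e) \<partial>sphere_measure)"
    unfolding M_def using integrable_m[OF r] by simp
  also have "\<dots> = (\<integral>\<eta>. (- 2 * a * (1 - r\<^sup>2)) *
      ((n - 1) * (\<eta> \<bullet> e) * H (- (\<eta> \<bullet> e)) + (1 - (\<eta> \<bullet> e)\<^sup>2) * H' (- (\<eta> \<bullet> e))) \<partial>sphere_measure)"
    by (rule Bochner_Integration.integral_cong[OF refl], rule pt, rule inner_sphere_bound[OF e]) simp
  also have "\<dots> = 0"
    using parts by (simp only: integral_mult_right_zero mult_zero_right)
  finally show ?thesis .
qed

private lemma M_pos:
  assumes r: "\<bar>r\<bar> < 1"
  shows "0 < M m0 r"
proof -
  interpret prob_space "sphere_measure :: 'a measure"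
    by (rule prob_space_sphere_measure)
  have pos: "0 < m0 r (\<eta> \<bullet> e)" if "\<eta> \<in> space sphere_measure" for \<eta>
  proof -
    have "0 < w r (\<eta> \<bullet> e)"
      using that by (intro w_pos[OF r inner_sphere_bound[OF e]]) simp
    then show ?thesis
      by (simp add: m0_def)
  qed
  have "0 \<le> M m0 r"
    unfolding M_def using pos by (intro Bochner_Integration.integral_nonneg) (simp add: less_imp_le)
  moreover have "M m0 r \<noteq> 0"
  proof
    assume "M m0 r = 0"
    then have "AE \<eta> in sphere_measure. m0 r (\<eta> \<bullet> e) = 0"
      unfolding M_def using integrable_m(1)[OF r] pos
      by (subst (asm) integral_nonneg_eq_0_iff_AE) (auto intro!: AE_I2 simp: less_imp_le)
    then have "AE \<eta> in (sphere_measure :: 'a measure). False"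
      by (rule AE_mp) (use pos in \<open>fastforce intro!: AE_I2\<close>)
    then show False
      by simp
  qed
  ultimately show ?thesis
    by simp
qed

text \<open>Both sides solve the same second order equation in \<open>r\<close>. The Wronskian times the integrating
  factor \<open>r ^ (n - 1) * (1 - r\<^sup>2) powr (2 - n - 2 * a)\<close> is constant and vanishes at \<open>0\<close>, so the
  quotient of the two solutions is constant; the integral is positive, so it can be divided by.\<close>

lemma integral_sphere_zonal_powr:
  assumes r: "0 \<le> r" "r < 1"
  defines "n \<equiv> real DIM('a)"
  shows "(\<integral>\<eta>. (1 - 2 * r * (\<eta> \<bullet> e) + r\<^sup>2) powr a \<partial>sphere_measure)
    = hyp2F1 (- a) (1 - a - n / 2) (n / 2) (r\<^sup>2)"
proof -
  interpret prob_space "sphere_measure :: 'a measure"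
    by (rule prob_space_sphere_measure)
  have n: "2 \<le> n"
    using dim by (simp add: n_def)
  define F where "F = hyp2F1 (- a) (1 - a - n / 2) (n / 2)"
  obtain F1 F2 where F1: "\<And>z. \<bar>z\<bar> < 1 \<Longrightarrow> (F has_real_derivative F1 z) (at z)"
    and F2: "\<And>z. \<bar>z\<bar> < 1 \<Longrightarrow> (F1 has_real_derivative F2 z) (at z)"
    and F_ode: "\<And>z. \<bar>z\<bar> < 1 \<Longrightarrow>
      z * (1 - z) * F2 z + (n / 2 - (- a + (1 - a - n / 2) + 1) * z) * F1 z - (- a) * (1 - a - n / 2) * F z = 0"
    using hyp2F1_ODE[of "n / 2" "- a" "1 - a - n / 2"] n unfolding F_def by auto
  define f where "f = (\<lambda>r. F (r\<^sup>2))"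
  define f1 where "f1 = (\<lambda>r. 2 * r * F1 (r\<^sup>2))"
  define f2 where "f2 = (\<lambda>r. 2 * F1 (r\<^sup>2) + 4 * r\<^sup>2 * F2 (r\<^sup>2))"
  have sq: "\<bar>s\<^sup>2\<bar> < 1" if "\<bar>s\<bar> < 1" for s :: real
    using that by (simp add: abs_square_less_1)
  have dsq: "((\<lambda>s :: real. s\<^sup>2) has_real_derivative 2 * s) (at s)" for s
    by (auto intro!: derivative_eq_intros)
  have df: "(f has_real_derivative f1 s) (at s)" if "\<bar>s\<bar> < 1" for s
    unfolding f_def f1_def
    by (rule DERIV_cong[OF DERIV_chain2[OF F1[OF sq[OF that]] dsq]]) simp
  have df1: "(f1 has_real_derivative f2 s) (at s)" if "\<bar>s\<bar> < 1" for s
    unfolding f1_def f2_def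
    by (rule DERIV_cong, rule DERIV_mult[OF _ DERIV_chain2[OF F2[OF sq[OF that]] dsq]],
        auto intro!: derivative_eq_intros simp: power2_eq_square algebra_simps)
  have f_ode: "(1 - s\<^sup>2) * s * f2 s + ((n - 1) + (n - 3 + 4 * a) * s\<^sup>2) * f1 s
      - 2 * a * (2 * a + n - 2) * s * f s = 0" if "\<bar>s\<bar> < 1" for s
  proof -
    have "(1 - s\<^sup>2) * s * f2 s + ((n - 1) + (n - 3 + 4 * a) * s\<^sup>2) * f1 s
      - 2 * a * (2 * a + n - 2) * s * f s
      = 4 * s * (s\<^sup>2 * (1 - s\<^sup>2) * F2 (s\<^sup>2) + (n / 2 - (- a + (1 - a - n / 2) + 1) * s\<^sup>2) * F1 (s\<^sup>2) - (- a) * (1 - a - n / 2) * F (s\<^sup>2))"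
      unfolding f_def f1_def f2_def by (simp add: field_simps power2_eq_square)
    then show ?thesis
      using F_ode[OF sq[OF that]] by simp
  qed
  define V where "V = (\<lambda>s. f1 s * M m0 s - f s * M m1 s)"
  \<comment> \<open>The exponent solves \<open>- (n - 1) - 2 * \<kappa> = n - 3 + 4 * a\<close>.
    Then the logarithmic derivative of \<open>p\<close> is the coefficient of the first derivative
    in the equation divided by that of the second.\<close>
  define \<kappa> where "\<kappa> = 2 - n - 2 * a"
  define p where "p = (\<lambda>s :: real. s ^ (DIM('a) - 1) * (1 - s\<^sup>2) powr \<kappa>)"
  define p' where "p' = (\<lambda>s :: real. (n - 1) * s ^ (DIM('a) - 2) * (1 - s\<^sup>2) powr \<kappa>
      + s ^ (DIM('a) - 1) * (\<kappa> * (1 - s\<^sup>2) powr (\<kappa> - 1) * (- 2 * s)))"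
  have dV: "(V has_real_derivative (f2 s * M m0 s - f s * M m2 s)) (at s)" if "\<bar>s\<bar> < 1" for s
    unfolding V_def
    by (rule DERIV_cong[OF DERIV_diff[OF DERIV_mult[OF df1[OF that] DERIV_M(1)[OF that]]
          DERIV_mult[OF df[OF that] DERIV_M(2)[OF that]]]]) (simp add: algebra_simps)
  have dp: "(p has_real_derivative p' s) (at s)" if "\<bar>s\<bar> < 1" for s
  proof -
    have pos: "0 < 1 - s\<^sup>2"
      using sq[OF that] by simp
    have "((\<lambda>s :: real. 1 - s\<^sup>2) has_real_derivative - 2 * s) (at s)"
      by (auto intro!: derivative_eq_intros)
    from DERIV_chain2[OF has_real_derivative_powr[OF pos] this]
    have d2: "((\<lambda>s. (1 - s\<^sup>2) powr \<kappa>) has_real_derivative (\<kappa> * (1 - s\<^sup>2) powr (\<kappa> - 1) * (- 2 * s))) (at s)" .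
    have d1: "((\<lambda>s. s ^ (DIM('a) - 1)) has_real_derivative ((n - 1) * s ^ (DIM('a) - 2))) (at s)"
      using DERIV_pow[of "DIM('a) - 1" s] dim by (simp add: n_def of_nat_diff numeral_2_eq_2)
    show ?thesis
      unfolding p_def p'_def by (rule DERIV_cong[OF DERIV_mult[OF d1 d2]]) (simp add: algebra_simps)
  qed
  have dpV: "((\<lambda>s. p s * V s) has_real_derivative 0) (at s)" if s: "0 < s" "s < 1" for s
  proof -
    have s': "\<bar>s\<bar> < 1" using s by simp
    have pos: "0 < 1 - s\<^sup>2"
      using sq[OF s'] by simp
    define P where "P = s ^ (DIM('a) - 2) * (1 - s\<^sup>2) powr (\<kappa> - 1)"
    have e1: "s ^ (DIM('a) - 1) = s ^ (DIM('a) - 2) * s"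
      using dim by (metis Suc_1 Suc_diff_Suc Suc_le_lessD power_Suc2 diff_Suc_Suc minus_nat.diff_0 One_nat_def)
    have e2: "(1 - s\<^sup>2) powr \<kappa> = (1 - s\<^sup>2) powr (\<kappa> - 1) * (1 - s\<^sup>2)"
      using pos powr_add[of "1 - s\<^sup>2" "\<kappa> - 1" 1] by simp
    have p: "p s = P * s * (1 - s\<^sup>2)"
      unfolding p_def e1 e2 P_def by simp
    have p': "p' s = P * ((n - 1) + (n - 3 + 4 * a) * s\<^sup>2)"
      unfolding p'_def e1 e2 P_def by (simp add: \<kappa>_def algebra_simps power2_eq_square)
    have "p' s * V s + (f2 s * M m0 s - f s * M m2 s) * p s
      = P * (M m0 s * ((1 - s\<^sup>2) * s * f2 s + ((n - 1) + (n - 3 + 4 * a) * s\<^sup>2) * f1 s - 2 * a * (2 * a + n - 2) * s * f s)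
         - f s * ((1 - s\<^sup>2) * s * M m2 s + ((n - 1) + (n - 3 + 4 * a) * s\<^sup>2) * M m1 s - 2 * a * (2 * a + n - 2) * s * M m0 s))"
      unfolding p p' V_def by (simp add: algebra_simps)
    also have "\<dots> = 0"
      using f_ode[OF s'] ODE_M[OF s'] by (simp add: n_def)
    finally show ?thesis
      using DERIV_mult[OF dp[OF s'] dV[OF s']] by simp
  qed
  have V0: "V s = 0" if s: "0 < s" "s < 1" for s
  proof -
    have cont: "continuous_on {0..s} (\<lambda>s. p s * V s)"
    proof (intro continuous_at_imp_continuous_on ballI)
      fix t assume "t \<in> {0..s}"
      then have "\<bar>t\<bar> < 1" using s by auto
      then show "isCont (\<lambda>s. p s * V s) t"
        using DERIV_isCont[OF dp] DERIV_isCont[OF dV] by (intro isCont_mult) auto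
    qed
    have "p s * V s = p 0 * V 0"
      by (rule DERIV_isconst2[OF s(1) cont]) (use dpV s in auto)
    also have "p 0 = 0"
      using dim by (simp add: p_def)
    finally have "p s * V s = 0"
      by simp
    moreover have "0 < 1 - s\<^sup>2"
      using sq[of s] s by simp
    then have "p s \<noteq> 0"
      using s by (simp add: p_def)
    ultimately show ?thesis
      by simp
  qed
  have "f r / M m0 r = f 0 / M m0 0"
  proof (cases "r = 0")
    case False
    then have "0 < r" using r by simp
    have dq: "((\<lambda>s. f s / M m0 s) has_real_derivative (V s / (M m0 s)\<^sup>2)) (at s)" if "\<bar>s\<bar> < 1" for s
      unfolding V_def power2_eq_square
      using DERIV_divide[OF df[OF that] DERIV_M(1)[OF that]] M_pos[OF that] by simp
    have cont: "continuous_on {0..r} (\<lambda>s. f s / M m0 s)"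
    proof (intro continuous_at_imp_continuous_on ballI)
      fix t assume "t \<in> {0..r}"
      then have "\<bar>t\<bar> < 1" using r by auto
      then show "isCont (\<lambda>s. f s / M m0 s) t"
        using DERIV_isCont[OF dq] by auto
    qed
    show ?thesis
    proof (rule DERIV_isconst2[OF \<open>0 < r\<close> cont])
      fix s assume "0 < s" "s < r"
      then show "((\<lambda>s. f s / M m0 s) has_real_derivative 0) (at s)"
        using dq[of s] V0[of s] r by simp
    qed (use \<open>0 < r\<close> in auto)
  qed simp
  moreover have "f 0 = 1"
    by (simp add: f_def F_def hyp2F1_0)
  moreover have "M m0 0 = 1"
    using prob_space by (simp add: M_def m0_def w_def)
  ultimately have "M m0 r = f r"
    using M_pos[of r] r by (simp add: field_simps)
  then show ?thesis
    by (simp add: M_def m0_def w_def f_def F_def)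
qed

end

lemma integral_sphere_dist_powr:
  fixes x :: "'a::euclidean_space"
  assumes x: "norm x < 1" and dim: "2 \<le> DIM('a)"
  shows "(\<integral>\<eta>. norm (\<eta> - x) powr p \<partial>sphere_measure)
    = hyp2F1 (- p / 2) (1 - p / 2 - real DIM('a) / 2) (real DIM('a) / 2) ((norm x)\<^sup>2)"
proof -
  obtain e :: 'a where e: "norm e = 1" "x = norm x *\<^sub>R e"
  proof (cases "x = 0")
    case True
    then show ?thesis
      using that vector_choose_size[of 1] by (metis norm_zero scale_zero_left zero_le_one)
  next
    case False
    then show ?thesis
      using that[of "sgn x"] by (simp add: norm_sgn sgn_div_norm)
  qed
  have "(\<integral>\<eta>. norm (\<eta> - x) powr p \<partial>sphere_measure)
      = (\<integral>\<eta>. (1 - 2 * norm x * (\<eta> \<bullet> e) + (norm x)\<^sup>2) powr (p / 2) \<partial>sphere_measure)"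
  proof (rule Bochner_Integration.integral_cong[OF refl])
    fix \<eta> :: 'a assume "\<eta> \<in> space sphere_measure"
    then have \<eta>: "norm \<eta> = 1"
      by simp
    then have "\<eta> \<noteq> x"
      using x by auto
    then have "norm (\<eta> - x) powr p = ((norm (\<eta> - x))\<^sup>2) powr (p / 2)"
      by (simp add: powr_powr flip: powr_numeral)
    also have "(norm (\<eta> - x))\<^sup>2 = 1 - 2 * norm x * (\<eta> \<bullet> e) + (norm x)\<^sup>2"
      using norm_sphere_diff_sq[OF e(1) \<eta>, of "norm x"] e(2) by simp
    finally show "norm (\<eta> - x) powr p = (1 - 2 * norm x * (\<eta> \<bullet> e) + (norm x)\<^sup>2) powr (p / 2)" .
  qed
  also have "\<dots> = hyp2F1 (- (p / 2)) (1 - p / 2 - real DIM('a) / 2) (real DIM('a) / 2) ((norm x)\<^sup>2)"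
    by (rule integral_sphere_zonal_powr[OF e(1) dim]) (use x in auto)
  finally show ?thesis
    by simp
qed

section \<open>Hoelder duality\<close>

text \<open>The hypotheses of the final theorem on \<open>p\<close> and \<open>q\<close>, bundled.
  The endpoint \<open>p = 1\<close> is outside the range, as its conjugate exponent is infinite
  while \<open>q\<close> is a real number.\<close>

definition conjugate_exponents :: "ereal \<Rightarrow> real \<Rightarrow> bool" where
  "conjugate_exponents p q \<longleftrightarrow> 1 < p \<and> 1 \<le> q \<and>
     (p = \<infinity> \<and> q = 1 \<or> p \<noteq> \<infinity> \<and> 1 / real_of_ereal p + 1 / q = 1)"

lemma conjugate_exponents_cases:
  assumes "conjugate_exponents p q"
  obtains "p = \<infinity>" "q = 1"
  | P where "p = ereal P" "1 < P" "1 < q" "1 / P + 1 / q = 1"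
proof (cases "p = \<infinity>")
  case False
  then obtain P where P: "p = ereal P" "1 < P"
    using assms unfolding conjugate_exponents_def by (cases p) auto
  then have pq: "1 / P + 1 / q = 1"
    using assms False by (simp add: conjugate_exponents_def)
  have "q \<noteq> 1"
    using P(2) pq by auto
  then have "1 < q"
    using assms by (simp add: conjugate_exponents_def)
  then show ?thesis
    using that(2) P pq by blast
qed (use that(1) assms in \<open>auto simp: conjugate_exponents_def\<close>)

context prob_space
begin

text \<open>\<open>Lp_norm\<close> passes through \<open>real_of_ereal\<close>, which sends infinite
  values to 0. Total mass 1 keeps the essential supremum from being negative infinity and
  \<open>in_Lp\<close> keeps it from being positive infinity, so the conversion is faithful.\<close>

lemma esssup_abs:
  assumes "in_Lp M \<infinity> f"
  shows "0 \<le> Lp_norm M \<infinity> f" "AE x in M. \<bar>f x\<bar> \<le> Lp_norm M \<infinity> f"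
proof -
  have f [measurable]: "f \<in> borel_measurable M" and fin: "esssup M (\<lambda>x. ereal \<bar>f x\<bar>) < \<infinity>"
    using assms by (auto simp: in_Lp_def)
  have "esssup M (\<lambda>x. 0 :: ereal) \<le> esssup M (\<lambda>x. ereal \<bar>f x\<bar>)"
    by (rule esssup_mono) auto
  then have nonneg: "0 \<le> esssup M (\<lambda>x. ereal \<bar>f x\<bar>)"
    by (simp add: esssup_const emeasure_space_1)
  then have eq: "esssup M (\<lambda>x. ereal \<bar>f x\<bar>) = ereal (Lp_norm M \<infinity> f)"
    using fin by (simp add: Lp_norm_def ereal_real)
  show "0 \<le> Lp_norm M \<infinity> f"
    using nonneg by (simp add: eq)
  show "AE x in M. \<bar>f x\<bar> \<le> Lp_norm M \<infinity> f"
    using esssup_AE[where M = M and f = "\<lambda>x. ereal \<bar>f x\<bar>"] by (simp add: eq)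
qed

lemma Lp_norm_nonneg:
  assumes "in_Lp M p f"
  shows "0 \<le> Lp_norm M p f"
proof (cases "p = \<infinity>")
  case True
  then show ?thesis
    using assms esssup_abs by blast
qed (simp add: Lp_norm_def)

lemma in_Lp_imp_integrable:
  assumes pq: "conjugate_exponents p q" and f: "in_Lp M p f"
  shows "integrable M f"
  using pq
proof (cases rule: conjugate_exponents_cases)
  case 1
  then show ?thesis
    using f esssup_abs(2)[of f] by (intro integrable_const_bound) (auto simp: in_Lp_def)
next
  case (2 P)
  have "integrable M (\<lambda>x. \<bar>f x\<bar> powr P)"
    using f 2 by (simp add: in_Lp_def)
  then have "integrable M (\<lambda>x. 1 + \<bar>f x\<bar> powr P)"
    by simp
  then show ?thesis
  proof (rule Bochner_Integration.integrable_bound)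
    show "AE x in M. norm (f x) \<le> norm (1 + \<bar>f x\<bar> powr P)"
    proof (rule AE_I2)
      fix x
      have "\<bar>f x\<bar> \<le> 1 + \<bar>f x\<bar> powr P"
      proof (cases "\<bar>f x\<bar> \<le> 1")
        case False
        then have "\<bar>f x\<bar> powr 1 \<le> \<bar>f x\<bar> powr P"
          using 2 by (intro powr_mono) auto
        then show ?thesis
          using False by simp
      qed (simp add: add_increasing2)
      then show "norm (f x) \<le> norm (1 + \<bar>f x\<bar> powr P)"
        by simp
    qed
  qed (use f in \<open>simp add: in_Lp_def\<close>)
qed

text \<open>For finite \<open>p\<close>, Young's inequality is applied pointwise to \<open>f\<close>
  and \<open>g\<close> divided by their norms \<open>c\<close> and \<open>d\<close>; after
  integration the two terms add up to \<open>1 / P + 1 / q = 1\<close>. For infinite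
  \<open>p\<close> the almost everywhere bound on \<open>f\<close> suffices.\<close>

lemma Hoelder_inequality:
  assumes pq: "conjugate_exponents p q" and f: "in_Lp M p f"
    and g [measurable]: "g \<in> borel_measurable M" and gq: "integrable M (\<lambda>x. \<bar>g x\<bar> powr q)"
  shows "\<bar>\<integral>x. f x * g x \<partial>M\<bar> \<le> (\<integral>x. \<bar>g x\<bar> powr q \<partial>M) powr (1 / q) * Lp_norm M p f"
  using pq
proof (cases rule: conjugate_exponents_cases)
  case 1
  have int: "integrable M (\<lambda>x. \<bar>g x\<bar>)"
    using gq 1 by simp
  have [measurable]: "f \<in> borel_measurable M"
    using f by (simp add: in_Lp_def)
  have N: "0 \<le> Lp_norm M p f" "AE x in M. \<bar>f x\<bar> \<le> Lp_norm M p f"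
    using f esssup_abs[of f] 1 by auto
  have bound: "AE x in M. \<bar>f x * g x\<bar> \<le> \<bar>g x\<bar> * Lp_norm M p f"
    using N(2) by eventually_elim (metis abs_ge_zero abs_mult mult.commute mult_left_mono)
  have "integrable M (\<lambda>x. \<bar>f x * g x\<bar>)"
    by (rule Bochner_Integration.integrable_bound[of _ "\<lambda>x. \<bar>g x\<bar> * Lp_norm M p f"])
      (use int bound N(1) in auto)
  then have "(\<integral>x. \<bar>f x * g x\<bar> \<partial>M) \<le> (\<integral>x. \<bar>g x\<bar> * Lp_norm M p f \<partial>M)"
    using int bound by (intro integral_mono_AE) auto
  then show ?thesis
    using 1 by (intro order_trans[OF integral_abs_bound]) simp
next
  case (2 P)
  have [measurable]: "f \<in> borel_measurable M"
    using f by (simp add: in_Lp_def)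
  have fP: "integrable M (\<lambda>x. \<bar>f x\<bar> powr P)"
    using f 2 by (simp add: in_Lp_def)
  define A where "A = (\<integral>x. \<bar>f x\<bar> powr P \<partial>M)"
  define B where "B = (\<integral>x. \<bar>g x\<bar> powr q \<partial>M)"
  have norm: "Lp_norm M p f = A powr (1 / P)"
    using 2 by (simp add: Lp_norm_def A_def)
  have "0 \<le> A" "0 \<le> B"
    by (simp_all add: A_def B_def)
  show ?thesis
  \<comment> \<open>The normalisation divides by both norms; if one of them is 0, the product
    \<open>f x * g x\<close> vanishes almost everywhere.\<close>
  proof (cases "A = 0 \<or> B = 0")
    case True
    then have "(AE x in M. \<bar>f x\<bar> powr P = 0) \<or> (AE x in M. \<bar>g x\<bar> powr q = 0)"
      unfolding A_def B_def using fP gq by (auto simp: integral_nonneg_eq_0_iff_AE)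
    then have "AE x in M. f x * g x = 0"
      by auto
    then have "(\<integral>x. f x * g x \<partial>M) = 0"
      by (rule integral_eq_zero_AE)
    then show ?thesis
      by (simp add: norm)
  next
    case False
    then have pos: "0 < A" "0 < B"
      using \<open>0 \<le> A\<close> \<open>0 \<le> B\<close> by auto
    define c where "c = A powr (1 / P)"
    define d where "d = B powr (1 / q)"
    have cd: "0 < c" "0 < d" "c powr P = A" "d powr q = B"
      using pos 2 by (simp_all add: c_def d_def powr_powr)
    have young: "\<bar>f x * g x\<bar> \<le> c * d * (\<bar>f x\<bar> powr P / (A * P) + \<bar>g x\<bar> powr q / (B * q))" for x
    proof -
      have "(\<bar>f x\<bar> / c) * (\<bar>g x\<bar> / d) \<le> (\<bar>f x\<bar> / c) powr P / P + (\<bar>g x\<bar> / d) powr q / q"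
        using 2 cd by (intro Youngs_inequality) auto
      also have "\<dots> = \<bar>f x\<bar> powr P / (A * P) + \<bar>g x\<bar> powr q / (B * q)"
        using cd by (simp add: powr_divide)
      finally have "c * d * ((\<bar>f x\<bar> / c) * (\<bar>g x\<bar> / d)) \<le> c * d * (\<bar>f x\<bar> powr P / (A * P) + \<bar>g x\<bar> powr q / (B * q))"
        using cd by (intro mult_left_mono) auto
      then show ?thesis
        using cd by (simp add: abs_mult)
    qed
    have int: "integrable M (\<lambda>x. c * d * (\<bar>f x\<bar> powr P / (A * P) + \<bar>g x\<bar> powr q / (B * q)))"
      using fP gq by simp
    then have "integrable M (\<lambda>x. f x * g x)"
      by (rule Bochner_Integration.integrable_bound)
        (auto intro!: AE_I2 intro: order_trans[OF young abs_ge_self])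
    then have "(\<integral>x. \<bar>f x * g x\<bar> \<partial>M) \<le> (\<integral>x. c * d * (\<bar>f x\<bar> powr P / (A * P) + \<bar>g x\<bar> powr q / (B * q)) \<partial>M)"
      by (intro integral_mono int young) auto
    also have "\<dots> = c * d * (A / (A * P) + B / (B * q))"
      using fP gq by (simp add: A_def B_def)
    also have "\<dots> = c * d"
      using pos 2(4) by simp
    finally show ?thesis
      unfolding norm B_def[symmetric] c_def d_def
      by (intro order_trans[OF integral_abs_bound]) (simp add: mult.commute)
  qed
qed

text \<open>The functional is tested on the equality case
  \<open>sgn (g x) * \<bar>g x\<bar> powr (q - 1)\<close> of Hoelder's inequality, which for
  \<open>q = 1\<close> is just \<open>sgn (g x)\<close>.\<close>

lemma Hoelder_extremal:
  assumes pq: "conjugate_exponents p q"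
    and g [measurable]: "g \<in> borel_measurable M" and gq: "integrable M (\<lambda>x. \<bar>g x\<bar> powr q)"
    and K: "\<And>f. in_Lp M p f \<Longrightarrow> \<bar>\<integral>x. f x * g x \<partial>M\<bar> \<le> K * Lp_norm M p f"
  shows "(\<integral>x. \<bar>g x\<bar> powr q \<partial>M) powr (1 / q) \<le> K"
proof -
  \<comment> \<open>Testing with the constant 1 gives \<open>0 \<le> K\<close>. This covers
    \<open>g\<close> vanishing almost everywhere, and \<open>q = 1\<close>, where the norm of the
    test function is only known to be at most 1.\<close>
  have "in_Lp M p (\<lambda>_. 1)" "Lp_norm M p (\<lambda>_. 1) = 1"
    using emeasure_space_1 prob_space by (auto simp: in_Lp_def Lp_norm_def esssup_const)
  from K[OF this(1)] this(2) have K0: "0 \<le> K"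
    by simp
  show ?thesis
    using pq
  proof (cases rule: conjugate_exponents_cases)
    case 1
    have le: "esssup M (\<lambda>x. ereal \<bar>sgn (g x)\<bar>) \<le> ereal 1"
      by (rule esssup_I) (auto simp: sgn_if)
    then have Lp: "in_Lp M p (\<lambda>x. sgn (g x))"
      using 1 by (auto simp: in_Lp_def)
    have "Lp_norm M p (\<lambda>x. sgn (g x)) \<le> 1"
      using le Lp_norm_nonneg[OF Lp] 1 by (simp add: Lp_norm_def)
        (metis ereal_less_eq(3) ereal_real' le one_ereal_def order_antisym_conv real_of_ereal_le_1)
    moreover have "(\<integral>x. sgn (g x) * g x \<partial>M) = (\<integral>x. \<bar>g x\<bar> \<partial>M)"
      by (simp add: abs_sgn mult.commute)
    ultimately have "(\<integral>x. \<bar>g x\<bar> \<partial>M) \<le> K * 1"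
      using K[OF Lp] mult_left_mono[OF _ K0] by (metis abs_ge_self order_trans)
    then show ?thesis
      using 1 by simp
  next
    case (2 P)
    define f where "f = (\<lambda>x. sgn (g x) * \<bar>g x\<bar> powr (q - 1))"
    have exps: "(q - 1) * P = q"
      using 2 by (simp add: field_simps)
    have fP: "\<bar>f x\<bar> powr P = \<bar>g x\<bar> powr q" for x
      using exps by (cases "g x = 0") (simp_all add: f_def abs_mult powr_powr abs_sgn_eq)
    have fg: "f x * g x = \<bar>g x\<bar> powr q" for x
    proof (cases "g x = 0")
      case False
      have "f x * g x = \<bar>g x\<bar> powr 1 * \<bar>g x\<bar> powr (q - 1)"
        using False by (simp add: f_def sgn_if)
      then show ?thesis
        unfolding powr_add[symmetric] by simp
    qed (simp add: f_def)
    define A where "A = (\<integral>x. \<bar>g x\<bar> powr q \<partial>M)"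
    have "in_Lp M p f"
      using 2 gq unfolding in_Lp_def by (simp add: fP) (simp add: f_def)
    moreover have "Lp_norm M p f = A powr (1 / P)"
      using 2 by (simp add: Lp_norm_def fP A_def)
    moreover have "0 \<le> A"
      by (simp add: A_def)
    ultimately have le: "A \<le> K * A powr (1 / P)"
      using K[of f] by (simp add: fg A_def)
    show ?thesis
    proof (cases "A = 0")
      case False
      then have "0 < A"
        using \<open>0 \<le> A\<close> by simp
      have "A powr (1 / P) * A powr (1 / q) = A powr 1"
        unfolding powr_add[symmetric] 2(4) ..
      also have "\<dots> \<le> A powr (1 / P) * K"
        using le \<open>0 < A\<close> by (simp add: mult.commute)
      finally show ?thesis
        using \<open>0 < A\<close> by (simp add: A_def)
    qed (use K0 in \<open>simp add: A_def\<close>)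
  qed
qed

end

section \<open>The gradient of the Poisson--Szegoe integral\<close>

text \<open>Adding both endpoint values gives one bound for increasing and decreasing powers alike,
  so the sign of the exponent need not be tracked in the domination arguments.\<close>

lemma powr_le_sum_endpoints:
  fixes t s :: real
  assumes "0 < lo" "lo \<le> t" "t \<le> hi"
  shows "t powr s \<le> lo powr s + hi powr s"
proof (cases "0 \<le> s")
  case True
  then have "t powr s \<le> hi powr s"
    using assms by (intro powr_mono2) auto
  then show ?thesis
    by (simp add: add_increasing)
next
  case False
  then have "t powr s \<le> lo powr s"
    using assms by (intro powr_mono2') auto
  then show ?thesis
    by (simp add: add_increasing2)
qed

lemma GDERIV_norm_diff_powr:
  fixes y \<eta> :: "'a::euclidean_space"
  assumes "y \<noteq> \<eta>"
  shows "GDERIV (\<lambda>y. norm (y - \<eta>) powr s) y :> (s * norm (y - \<eta>) powr (s - 2)) *\<^sub>R (y - \<eta>)"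
proof -
  have "GDERIV (\<lambda>y. norm (y - \<eta>)) y :> sgn (y - \<eta>)"
  proof -
    have "((\<lambda>y. y - \<eta>) has_derivative (\<lambda>h. h)) (at y)"
      by (auto intro!: derivative_eq_intros)
    from has_derivative_compose[OF this has_derivative_norm] show ?thesis
      using assms by (simp add: gderiv_def)
  qed
  moreover have "0 < norm (y - \<eta>)"
    using assms by simp
  from has_real_derivative_powr[OF this, of s]
  have "DERIV (\<lambda>t. t powr s) (norm (y - \<eta>)) :> s * norm (y - \<eta>) powr (s - 1)" .
  ultimately have "GDERIV (\<lambda>y. norm (y - \<eta>) powr s) y :> (s * norm (y - \<eta>) powr (s - 1)) *\<^sub>R sgn (y - \<eta>)"
    by (rule GDERIV_DERIV_compose)
  moreover have "norm (y - \<eta>) powr (s - 1) = norm (y - \<eta>) powr (s - 2) * norm (y - \<eta>)"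
    using powr_add[of "norm (y - \<eta>)" "s - 2" 1] by simp
  moreover have "s * (norm (y - \<eta>) powr (s - 2) * norm (y - \<eta>)) * inverse (norm (y - \<eta>)) = s * norm (y - \<eta>) powr (s - 2)"
    using assms by simp
  ultimately show ?thesis
    by (simp only: sgn_div_norm scaleR_scaleR)
qed

lemma norm_diff_sphere_bounds:
  fixes x y \<eta> :: "'a::euclidean_space"
  assumes "norm x < 1" "y \<in> ball x ((1 - norm x) / 2)" "norm \<eta> = 1"
  shows "(1 - norm x) / 2 \<le> norm (y - \<eta>)" "norm (y - \<eta>) \<le> 2" "y \<noteq> \<eta>"
proof -
  have 1: "norm (y - x) < (1 - norm x) / 2"
    using assms by (simp add: dist_norm norm_minus_commute)
  have "norm y \<le> norm x + norm (y - x)"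
    by (metis add_diff_cancel_left' add.commute diff_add_cancel norm_triangle_ineq)
  then have 2: "norm y < (1 + norm x) / 2"
    using 1 by (simp add: field_simps)
  have "1 \<le> norm y + norm (y - \<eta>)"
    by (metis assms(3) norm_minus_commute norm_triangle_sub)
  then show lo: "(1 - norm x) / 2 \<le> norm (y - \<eta>)"
    using 2 by (simp add: field_simps)
  show "norm (y - \<eta>) \<le> 2"
    using norm_triangle_ineq4[of y \<eta>] 2 assms by (simp add: field_simps)
  show "y \<noteq> \<eta>"
    using lo assms by auto
qed

text \<open>On the ball around \<open>x\<close> with radius half the distance to the sphere,
  \<open>norm (y - \<eta>)\<close> stays between that radius and 2. Every power of it is thus
  bounded uniformly, and a multiple of \<open>\<bar>\<phi> \<eta>\<bar>\<close> dominates.\<close>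

lemma GDERIV_integral_sphere_dist_powr:
  fixes x :: "'a::euclidean_space" and \<phi> :: "'a \<Rightarrow> real"
  assumes x: "norm x < 1" and \<phi>: "integrable sphere_measure \<phi>"
  shows "integrable sphere_measure (\<lambda>\<eta>. norm (x - \<eta>) powr s * \<phi> \<eta>)"
    and "integrable sphere_measure (\<lambda>\<eta>. (s * norm (x - \<eta>) powr (s - 2) * \<phi> \<eta>) *\<^sub>R (x - \<eta>))"
    and "GDERIV (\<lambda>y. \<integral>\<eta>. norm (y - \<eta>) powr s * \<phi> \<eta> \<partial>sphere_measure) x :>
      (\<integral>\<eta>. (s * norm (x - \<eta>) powr (s - 2) * \<phi> \<eta>) *\<^sub>R (x - \<eta>) \<partial>sphere_measure)"
proof -
  define lo where "lo = (1 - norm x) / 2"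
  define C where "C = (\<lambda>s :: real. lo powr s + 2 powr s)"
  have lo: "0 < lo"
    using x by (simp add: lo_def)
  note bounds = norm_diff_sphere_bounds[OF x, folded lo_def]
  have C: "norm (y - \<eta>) powr s \<le> C s" if "y \<in> ball x lo" "norm \<eta> = 1" for y \<eta> s
    unfolding C_def using bounds[OF that] lo by (intro powr_le_sum_endpoints) auto
  have [measurable]: "\<phi> \<in> borel_measurable sphere_measure"
    using \<phi> by auto
  have meas [measurable]: "(\<lambda>\<eta>. y - \<eta>) \<in> borel_measurable sphere_measure" for y :: 'a
    by (rule borel_measurable_sphere_continuous) (intro continuous_intros)
  have int: "integrable sphere_measure (\<lambda>\<eta>. norm (y - \<eta>) powr s * \<phi> \<eta>)" if y: "y \<in> ball x lo" for y
  proof (rule Bochner_Integration.integrable_bound[of _ "\<lambda>\<eta>. C s * \<phi> \<eta>"])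
    show "AE \<eta> in sphere_measure. norm (norm (y - \<eta>) powr s * \<phi> \<eta>) \<le> norm (C s * \<phi> \<eta>)"
    proof (rule AE_I2)
      fix \<eta> :: 'a assume "\<eta> \<in> space sphere_measure"
      then have "norm (y - \<eta>) powr s \<le> C s"
        using C[OF y] by simp
      then show "norm (norm (y - \<eta>) powr s * \<phi> \<eta>) \<le> norm (C s * \<phi> \<eta>)"
        by (simp add: abs_mult mult_right_mono)
    qed
  qed (use \<phi> in auto)
  show "integrable sphere_measure (\<lambda>\<eta>. norm (x - \<eta>) powr s * \<phi> \<eta>)"
    using int[of x] lo by simp
  let ?D = "\<lambda>y \<eta>. (s * norm (y - \<eta>) powr (s - 2) * \<phi> \<eta>) *\<^sub>R (y - \<eta>)"
  have der: "GDERIV (\<lambda>y. norm (y - \<eta>) powr s * \<phi> \<eta>) y :> ?D y \<eta>"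
    if "y \<in> ball x lo" "\<eta> \<in> space sphere_measure" for y \<eta>
  proof -
    have "GDERIV (\<lambda>y. norm (y - \<eta>) powr s) y :> (s * norm (y - \<eta>) powr (s - 2)) *\<^sub>R (y - \<eta>)"
      using bounds(3)[OF that(1)] that(2) by (intro GDERIV_norm_diff_powr) simp
    from GDERIV_mult[OF this GDERIV_const[of "\<phi> \<eta>"]] show ?thesis
      by (simp add: mult.commute)
  qed
  have bnd: "norm (?D y \<eta>) \<le> \<bar>s\<bar> * C (s - 1) * \<bar>\<phi> \<eta>\<bar>"
    if "y \<in> ball x lo" "\<eta> \<in> space sphere_measure" for y \<eta>
  proof -
    have \<eta>: "norm \<eta> = 1"
      using that by simp
    have "norm (?D y \<eta>) = \<bar>s\<bar> * (norm (y - \<eta>) powr (s - 2) * norm (y - \<eta>)) * \<bar>\<phi> \<eta>\<bar>"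
      by (simp add: abs_mult)
    also have "norm (y - \<eta>) powr (s - 2) * norm (y - \<eta>) = norm (y - \<eta>) powr (s - 1)"
      using powr_add[of "norm (y - \<eta>)" "s - 2" 1] by simp
    also have "\<bar>s\<bar> * norm (y - \<eta>) powr (s - 1) * \<bar>\<phi> \<eta>\<bar> \<le> \<bar>s\<bar> * C (s - 1) * \<bar>\<phi> \<eta>\<bar>"
      by (intro mult_right_mono mult_left_mono C that \<eta>) auto
    finally show ?thesis .
  qed
  have B: "integrable sphere_measure (\<lambda>\<eta>. \<bar>s\<bar> * C (s - 1) * \<bar>\<phi> \<eta>\<bar>)"
    using \<phi> by simp
  have Dm: "?D x \<in> borel_measurable sphere_measure"
    by measurable
  show "integrable sphere_measure (?D x)"
    by (rule GDERIV_integral(1)[OF lo int der bnd B Dm])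
  show "GDERIV (\<lambda>y. \<integral>\<eta>. norm (y - \<eta>) powr s * \<phi> \<eta> \<partial>sphere_measure) x :> (\<integral>\<eta>. ?D x \<eta> \<partial>sphere_measure)"
    by (rule GDERIV_integral(2)[OF lo int der bnd B Dm])
qed

text \<open>The gradient of \<open>PS_kernel \<alpha> x \<zeta>\<close> with respect to \<open>x\<close>, written with the other endpoint of the
  chord from \<open>\<zeta>\<close> through \<open>x\<close>.\<close>

definition PS_kernel_grad :: "real \<Rightarrow> 'a::euclidean_space \<Rightarrow> 'a \<Rightarrow> 'a" where
  "PS_kernel_grad \<alpha> x \<zeta> = (- ((real DIM('a) - \<alpha>) * PS_const DIM('a) \<alpha> * (1 - (norm x)\<^sup>2) powr (- \<alpha>)
      * norm (x - \<zeta>) powr (- (real DIM('a) - \<alpha>)))) *\<^sub>R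
      (chord x \<zeta> + ((2 - \<alpha> - real DIM('a)) / (real DIM('a) - \<alpha>)) *\<^sub>R x)"

lemma chord_ratio_sphere:
  assumes "norm \<eta> = 1"
  shows "chord_ratio x \<eta> = - ((1 - (norm x)\<^sup>2) / (norm (\<eta> - x))\<^sup>2)"
  using assms by (simp add: chord_ratio_def recenter_def)

lemma chord_sphere:
  assumes "norm \<eta> = 1"
  shows "chord x \<eta> = x + chord_ratio x \<eta> *\<^sub>R (\<eta> - x)"
  using assms by (simp add: chord_def recenter_def)

lemma GDERIV_PS_integral:
  fixes x :: "'a::euclidean_space" and \<phi> :: "'a \<Rightarrow> real"
  assumes x: "norm x < 1" and \<alpha>: "\<alpha> < real DIM('a)" and \<phi>: "integrable sphere_measure \<phi>"
  shows "integrable sphere_measure (\<lambda>\<zeta>. \<phi> \<zeta> *\<^sub>R PS_kernel_grad \<alpha> x \<zeta>)"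
    and "GDERIV (PS_integral \<alpha> \<phi>) x :> (\<integral>\<zeta>. \<phi> \<zeta> *\<^sub>R PS_kernel_grad \<alpha> x \<zeta> \<partial>sphere_measure)"
proof -
  define n where "n = real DIM('a)"
  define C where "C = PS_const DIM('a) \<alpha>"
  define R where "R = 1 - (norm x)\<^sup>2"
  have R: "0 < R"
    unfolding R_def using x by (rule one_minus_norm_sq_pos)
  define s where "s = - (n - \<alpha>)"
  have s: "s \<noteq> 0"
    using \<alpha> by (simp add: s_def n_def)
  note deriv = GDERIV_integral_sphere_dist_powr[OF x \<phi>, of s]
  define T where "T = (\<lambda>y. \<integral>\<zeta>. norm (y - \<zeta>) powr s * \<phi> \<zeta> \<partial>sphere_measure)"
  have PS: "PS_integral \<alpha> \<phi> = (\<lambda>y. (C * (1 - (norm y)\<^sup>2) powr (1 - \<alpha>)) * T y)"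
  proof
    fix y
    have "PS_kernel \<alpha> y \<zeta> * \<phi> \<zeta> = (C * (1 - (norm y)\<^sup>2) powr (1 - \<alpha>)) * (norm (y - \<zeta>) powr s * \<phi> \<zeta>)" for \<zeta>
      unfolding PS_kernel_def C_def s_def n_def powr_minus by (simp add: divide_inverse mult_ac)
    then show "PS_integral \<alpha> \<phi> y = (C * (1 - (norm y)\<^sup>2) powr (1 - \<alpha>)) * T y"
      unfolding PS_integral_def T_def by (simp only: integral_mult_right_zero)
  qed
  have "GDERIV (\<lambda>y. 1 - (norm y)\<^sup>2) x :> (- 2) *\<^sub>R x"
    unfolding gderiv_def power2_norm_eq_inner
    by (auto intro!: derivative_eq_intros simp: inner_commute)
  moreover have "DERIV (\<lambda>t. C * t powr (1 - \<alpha>)) (1 - (norm x)\<^sup>2) :> C * ((1 - \<alpha>) * R powr (- \<alpha>))"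
    using DERIV_cmult[OF has_real_derivative_powr[OF R, of "1 - \<alpha>"], of C] by (simp add: R_def)
  ultimately have "GDERIV (\<lambda>y. C * (1 - (norm y)\<^sup>2) powr (1 - \<alpha>)) x :> (C * ((1 - \<alpha>) * R powr (- \<alpha>))) *\<^sub>R ((- 2) *\<^sub>R x)"
    by (rule GDERIV_DERIV_compose)
  from GDERIV_mult[OF this deriv(3)[folded T_def]]
  have G: "GDERIV (PS_integral \<alpha> \<phi>) x :>
      (C * R powr (1 - \<alpha>)) *\<^sub>R (\<integral>\<zeta>. (s * norm (x - \<zeta>) powr (s - 2) * \<phi> \<zeta>) *\<^sub>R (x - \<zeta>) \<partial>sphere_measure)
      + T x *\<^sub>R ((C * ((1 - \<alpha>) * R powr (- \<alpha>))) *\<^sub>R ((- 2) *\<^sub>R x))"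
    unfolding PS R_def .
  have pt: "\<phi> \<zeta> *\<^sub>R PS_kernel_grad \<alpha> x \<zeta>
      = (C * R powr (1 - \<alpha>)) *\<^sub>R ((s * norm (x - \<zeta>) powr (s - 2) * \<phi> \<zeta>) *\<^sub>R (x - \<zeta>))
      + (norm (x - \<zeta>) powr s * \<phi> \<zeta>) *\<^sub>R ((C * ((1 - \<alpha>) * R powr (- \<alpha>))) *\<^sub>R ((- 2) *\<^sub>R x))"
    if "\<zeta> \<in> space sphere_measure" for \<zeta>
  proof -
    have \<zeta>: "norm \<zeta> = 1"
      using that by simp
    define d where "d = norm (x - \<zeta>)"
    have d: "0 < d"
      using \<zeta> x by (auto simp: d_def)
    have e1: "d powr s = d powr (s - 2) * d\<^sup>2"
      using d powr_add[of d "s - 2" 2] by simp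
    have e2: "R powr (1 - \<alpha>) = R powr (- \<alpha>) * R"
      using R powr_add[of R "- \<alpha>" 1] by simp
    define Z where "Z = C * R powr (- \<alpha>) * d powr (s - 2) * \<phi> \<zeta>"
    have "PS_kernel_grad \<alpha> x \<zeta> = (s * C * R powr (- \<alpha>) * d powr s) *\<^sub>R
       (x + (R / d\<^sup>2) *\<^sub>R (x - \<zeta>) + ((2 - \<alpha> - n) / - s) *\<^sub>R x)"
      unfolding PS_kernel_grad_def chord_sphere[OF \<zeta>] chord_ratio_sphere[OF \<zeta>]
      by (simp add: s_def n_def C_def R_def d_def norm_minus_commute algebra_simps)
    then have "\<phi> \<zeta> *\<^sub>R PS_kernel_grad \<alpha> x \<zeta> = (Z * (s * d\<^sup>2)) *\<^sub>R
       (x + (R / d\<^sup>2) *\<^sub>R (x - \<zeta>) + ((2 - \<alpha> - n) / - s) *\<^sub>R x)"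
      unfolding e1 Z_def by (simp add: mult_ac)
    also have "\<dots> = (Z * (s * R)) *\<^sub>R (x - \<zeta>) + (Z * (s * d\<^sup>2 - (2 - \<alpha> - n) * d\<^sup>2)) *\<^sub>R x"
    proof -
      have "Z * (s * d\<^sup>2) * (R / d\<^sup>2) = Z * (s * R)"
        using d by simp
      moreover have "Z * (s * d\<^sup>2) * ((2 - \<alpha> - n) / - s) = - (Z * ((2 - \<alpha> - n) * d\<^sup>2))"
        using s by simp
      ultimately show ?thesis
        unfolding scaleR_add_right scaleR_scaleR
        by (simp only: right_diff_distrib scaleR_diff_left scaleR_minus_left) (simp only: add_ac diff_conv_add_uminus)
    qed
    \<comment> \<open>The origin of \<open>c\<close>: the product rule leaves \<open>x\<close> with
      the coefficient \<open>- 2 * (1 - \<alpha>)\<close>, the chord endpoint accounts for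
      \<open>s = - (n - \<alpha>)\<close> of it, and the rest is \<open>s\<close> times
      \<open>(2 - \<alpha> - n) / (n - \<alpha>)\<close>.\<close>
    also have "s * d\<^sup>2 - (2 - \<alpha> - n) * d\<^sup>2 = - 2 * (1 - \<alpha>) * d\<^sup>2"
      by (simp add: s_def algebra_simps)
    finally have fin: "\<phi> \<zeta> *\<^sub>R PS_kernel_grad \<alpha> x \<zeta>
        = (Z * (s * R)) *\<^sub>R (x - \<zeta>) + (Z * (- 2 * (1 - \<alpha>) * d\<^sup>2)) *\<^sub>R x" .
    show ?thesis
      unfolding fin d_def[symmetric] e1 e2 Z_def scaleR_scaleR
      by (intro arg_cong2[of _ _ _ _ "(+)"] arg_cong2[of _ _ _ _ scaleR] refl) (simp_all add: algebra_simps)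
  qed
  have i1: "integrable sphere_measure (\<lambda>\<zeta>. (C * R powr (1 - \<alpha>)) *\<^sub>R ((s * norm (x - \<zeta>) powr (s - 2) * \<phi> \<zeta>) *\<^sub>R (x - \<zeta>)))"
    by (intro integrable_scaleR_right deriv(2))
  have i2: "integrable sphere_measure (\<lambda>\<zeta>. (norm (x - \<zeta>) powr s * \<phi> \<zeta>) *\<^sub>R ((C * ((1 - \<alpha>) * R powr (- \<alpha>))) *\<^sub>R ((- 2) *\<^sub>R x)))"
    by (intro integrable_scaleR_left deriv(1))
  show "integrable sphere_measure (\<lambda>\<zeta>. \<phi> \<zeta> *\<^sub>R PS_kernel_grad \<alpha> x \<zeta>)"
    by (rule iffD2[OF Bochner_Integration.integrable_cong[OF refl pt] Bochner_Integration.integrable_add[OF i1 i2]])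
  have "(\<integral>\<zeta>. \<phi> \<zeta> *\<^sub>R PS_kernel_grad \<alpha> x \<zeta> \<partial>sphere_measure)
     = (\<integral>\<zeta>. (C * R powr (1 - \<alpha>)) *\<^sub>R ((s * norm (x - \<zeta>) powr (s - 2) * \<phi> \<zeta>) *\<^sub>R (x - \<zeta>)) \<partial>sphere_measure)
     + (\<integral>\<zeta>. (norm (x - \<zeta>) powr s * \<phi> \<zeta>) *\<^sub>R ((C * ((1 - \<alpha>) * R powr (- \<alpha>))) *\<^sub>R ((- 2) *\<^sub>R x)) \<partial>sphere_measure)"
    by (rule trans[OF Bochner_Integration.integral_cong[OF refl pt] Bochner_Integration.integral_add[OF i1 i2]])
  also have "\<dots> = (C * R powr (1 - \<alpha>)) *\<^sub>R (\<integral>\<zeta>. (s * norm (x - \<zeta>) powr (s - 2) * \<phi> \<zeta>) *\<^sub>R (x - \<zeta>) \<partial>sphere_measure)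
      + T x *\<^sub>R ((C * ((1 - \<alpha>) * R powr (- \<alpha>))) *\<^sub>R ((- 2) *\<^sub>R x))"
    unfolding T_def integral_scaleR_right integral_scaleR_left[OF deriv(1)] ..
  finally show "GDERIV (PS_integral \<alpha> \<phi>) x :> (\<integral>\<zeta>. \<phi> \<zeta> *\<^sub>R PS_kernel_grad \<alpha> x \<zeta> \<partial>sphere_measure)"
    using G by simp
qed

lemma GDERIV_unique:
  assumes "GDERIV f x :> D" "GDERIV f x :> E"
  shows "D = E"
proof -
  have "(\<lambda>h. h \<bullet> D) = (\<lambda>h. h \<bullet> E)"
    using assms unfolding gderiv_def by (rule has_derivative_unique)
  then show ?thesis
    by (metis inner_commute vector_eq_rdot)
qed

text \<open>\<open>grad\<close> is a choice, so facts about its value are obtained by exhibiting a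
  derivative and using its uniqueness.\<close>

lemma grad_eq:
  assumes "GDERIV f x :> D"
  shows "grad f x = D"
  unfolding grad_def using assms by (metis GDERIV_unique someI)

lemma PS_const_pos:
  assumes "\<alpha> < 1" "3 \<le> n"
  shows "0 < PS_const n \<alpha>"
  using assms unfolding PS_const_def by (intro divide_pos_pos mult_pos_pos Gamma_real_pos) auto

section \<open>Power integrals of the kernel gradient\<close>

lemma continuous_on_PS_kernel_grad:
  assumes x: "norm x < 1"
  shows "continuous_on (sphere 0 1) (PS_kernel_grad \<alpha> x)"
proof -
  have "continuous_on (sphere 0 1) (chord x)"
  proof (intro continuous_at_imp_continuous_on ballI)
    fix \<zeta> :: 'a assume "\<zeta> \<in> sphere 0 1"
    then have "\<zeta> \<noteq> 0" by auto
    then show "isCont (chord x) \<zeta>"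
      by (metis has_derivative_chord[OF x] has_derivative_continuous)
  qed
  moreover have "x - \<zeta> \<noteq> 0" if "norm \<zeta> = 1" for \<zeta>
    using that x by auto
  ultimately show ?thesis
    unfolding PS_kernel_grad_def[abs_def] by (auto intro!: continuous_intros)
qed

lemma integrable_PS_kernel_grad_powr:
  assumes x: "norm x < 1" and q: "0 < q"
  shows "integrable sphere_measure (\<lambda>\<zeta>. \<bar>PS_kernel_grad \<alpha> x \<zeta> \<bullet> l\<bar> powr q)"
  using continuous_on_PS_kernel_grad[OF x, of \<alpha>] q
  by (intro integrable_sphere_continuous continuous_on_powr' continuous_intros) auto

text \<open>After the substitution \<open>\<zeta> = chord x \<eta>\<close>, the powers of
  \<open>R = 1 - (norm x)\<^sup>2\<close> have exponents \<open>n - 1\<close> from the Jacobian,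
  \<open>- \<alpha> * q\<close> and \<open>- (n - \<alpha>) * q\<close> from the kernel, with sum
  \<open>- (n * (q - 1) + 1)\<close>. The distance to \<open>x\<close> gets
  \<open>- 2 * (n - 1)\<close> from the Jacobian and, as it is inverted,
  \<open>+ (n - \<alpha>) * q\<close> from the kernel.\<close>

lemma integral_PS_kernel_grad_powr:
  fixes x l :: "'a::euclidean_space"
  assumes x: "norm x < 1" and q: "1 \<le> q" and \<alpha>: "\<alpha> < 1" and dim: "3 \<le> DIM('a)"
  defines "n \<equiv> real DIM('a)"
  shows "(\<integral>\<zeta>. \<bar>PS_kernel_grad \<alpha> x \<zeta> \<bullet> l\<bar> powr q \<partial>sphere_measure)
    = ((n - \<alpha>) * PS_const DIM('a) \<alpha> / (1 - (norm x)\<^sup>2) powr ((n * (q - 1) + 1) / q)) powr q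
      * (\<integral>\<eta>. norm (\<eta> - x) powr ((n - \<alpha>) * q - 2 * n + 2)
          * \<bar>(\<eta> + ((2 - \<alpha> - n) / (n - \<alpha>)) *\<^sub>R x) \<bullet> l\<bar> powr q \<partial>sphere_measure)"
proof -
  define c where "c = (2 - \<alpha> - n) / (n - \<alpha>)"
  define k where "k = (n - \<alpha>) * PS_const DIM('a) \<alpha>"
  define R where "R = 1 - (norm x)\<^sup>2"
  have R: "0 < R"
    unfolding R_def using x by (rule one_minus_norm_sq_pos)
  have k: "0 < k"
    using PS_const_pos[OF \<alpha> dim] \<alpha> dim by (simp add: k_def n_def)
  define h where "h = (\<lambda>\<zeta>. \<bar>PS_kernel_grad \<alpha> x \<zeta> \<bullet> l\<bar> powr q)"
  have [measurable]: "h \<in> borel_measurable borel"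
    unfolding h_def PS_kernel_grad_def by measurable
  have int: "integrable sphere_measure h"
    unfolding h_def using q by (intro integrable_PS_kernel_grad_powr x) simp
  have "(\<integral>\<zeta>. h \<zeta> \<partial>sphere_measure)
      = (\<integral>\<eta>. \<bar>chord_ratio x \<eta>\<bar> ^ (DIM('a) - 1) * h (chord x \<eta>) \<partial>sphere_measure)"
    by (rule integral_sphere_chord[OF x _ int, symmetric]) measurable
  also have "\<dots> = (\<integral>\<eta>. (k / R powr ((n * (q - 1) + 1) / q)) powr q *
      (norm (\<eta> - x) powr ((n - \<alpha>) * q - 2 * n + 2) * \<bar>(\<eta> + c *\<^sub>R x) \<bullet> l\<bar> powr q) \<partial>sphere_measure)"
  proof (rule Bochner_Integration.integral_cong[OF refl])
    fix \<eta> :: 'a assume "\<eta> \<in> space sphere_measure"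
    then have \<eta>: "norm \<eta> = 1"
      by simp
    define d where "d = norm (\<eta> - x)"
    have d: "0 < d"
      using \<eta> x by (auto simp: d_def)
    have ratio: "\<bar>chord_ratio x \<eta>\<bar> = R / d\<^sup>2"
      using R d unfolding chord_ratio_sphere[OF \<eta>] by (simp add: R_def d_def)
    have "x - chord x \<eta> = - chord_ratio x \<eta> *\<^sub>R (\<eta> - x)"
      by (simp add: chord_sphere[OF \<eta>] algebra_simps)
    then have "norm (x - chord x \<eta>) = R / d\<^sup>2 * d"
      using ratio by (simp add: d_def)
    \<comment> \<open>The distances from \<open>x\<close> to the two ends of the chord multiply to
      \<open>R\<close>.\<close>
    then have dist: "norm (x - chord x \<eta>) = R / d"
      using d by (simp add: power2_eq_square)
    have "PS_kernel_grad \<alpha> x (chord x \<eta>) = (- (k * R powr (- \<alpha>) * (R / d) powr (- (n - \<alpha>)))) *\<^sub>R (\<eta> + c *\<^sub>R x)"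
      unfolding PS_kernel_grad_def chord_chord[OF x] dist by (simp add: k_def R_def c_def n_def)
    then have h: "h (chord x \<eta>) = (k * R powr (- \<alpha>) * (R / d) powr (- (n - \<alpha>))) powr q * \<bar>(\<eta> + c *\<^sub>R x) \<bullet> l\<bar> powr q"
      using k by (simp add: h_def abs_mult powr_mult)
    have pow: "(R / d\<^sup>2) ^ (DIM('a) - 1) = R powr (n - 1) * d powr (- 2 * (n - 1))"
    proof -
      have "(R / d\<^sup>2) ^ (DIM('a) - 1) = (R / d\<^sup>2) powr (n - 1)"
      proof -
        have "n - 1 = real (DIM('a) - 1)"
          using dim by (simp add: n_def of_nat_diff)
        then show ?thesis
          using R d powr_realpow[of "R / d\<^sup>2" "DIM('a) - 1"] by simp
      qed
      also have "\<dots> = R powr (n - 1) / (d\<^sup>2) powr (n - 1)"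
        using R d by (simp add: powr_divide)
      also have "(d\<^sup>2) powr (n - 1) = d powr (2 * (n - 1))"
        using d by (simp add: powr_powr flip: powr_numeral)
      also have "R powr (n - 1) / d powr (2 * (n - 1)) = R powr (n - 1) * d powr (- 2 * (n - 1))"
        using powr_minus[of d "2 * (n - 1)"] by (simp add: divide_inverse)
      finally show ?thesis .
    qed
    have "\<bar>chord_ratio x \<eta>\<bar> ^ (DIM('a) - 1) * h (chord x \<eta>)
        = (R powr (n - 1) * d powr (- 2 * (n - 1))) *
          (k powr q * R powr (- \<alpha> * q) * (R powr (- (n - \<alpha>) * q) * d powr ((n - \<alpha>) * q))) * \<bar>(\<eta> + c *\<^sub>R x) \<bullet> l\<bar> powr q"
    proof -
      have "(R / d) powr (- b) = R powr (- b) * d powr b" for b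
        using R d by (simp add: powr_divide powr_minus field_simps)
      then show ?thesis
        using k R d unfolding h ratio pow by (simp add: powr_mult powr_powr del: minus_diff_eq)
    qed
    also have "\<dots> = k powr q * (R powr (n - 1) * R powr (- \<alpha> * q) * R powr (- (n - \<alpha>) * q)) *
        (d powr (- 2 * (n - 1)) * d powr ((n - \<alpha>) * q)) * \<bar>(\<eta> + c *\<^sub>R x) \<bullet> l\<bar> powr q"
      by (simp add: mult_ac)
    also have "\<dots> = k powr q * R powr (- (n * (q - 1) + 1)) * d powr ((n - \<alpha>) * q - 2 * n + 2) * \<bar>(\<eta> + c *\<^sub>R x) \<bullet> l\<bar> powr q"
      unfolding powr_add[symmetric] by (simp add: algebra_simps)
    also have "k powr q * R powr (- (n * (q - 1) + 1)) = (k / R powr ((n * (q - 1) + 1) / q)) powr q"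
    proof -
      have "(k / R powr (b / q)) powr q = k powr q * R powr (- b)" for b
        using k R q by (simp add: powr_divide powr_powr powr_minus_divide)
      then show ?thesis
        by (rule sym)
    qed
    finally show "\<bar>chord_ratio x \<eta>\<bar> ^ (DIM('a) - 1) * h (chord x \<eta>) = (k / R powr ((n * (q - 1) + 1) / q)) powr q *
        (norm (\<eta> - x) powr ((n - \<alpha>) * q - 2 * n + 2) * \<bar>(\<eta> + c *\<^sub>R x) \<bullet> l\<bar> powr q)"
      by (simp add: d_def mult_ac)
  qed
  finally show ?thesis
    by (simp add: h_def k_def R_def c_def)
qed

section \<open>Comparison with \<open>I_fun\<close> and \<open>J_fun\<close>\<close>

text \<open>Convexity of the power function: the graph lies above its tangent at
  \<open>u = \<bar>a\<bar> + B\<close>, which is Young's inequality for \<open>\<bar>a\<bar>\<close>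
  and \<open>u powr (q - 1)\<close>. The bound \<open>u \<le> 1 + B\<close> then removes
  \<open>a\<close> from the error term, and this produces the prefactor of
  \<open>J_fun\<close>.\<close>

lemma abs_add_powr_le:
  fixes a b B q :: real
  assumes q: "1 \<le> q" and a: "\<bar>a\<bar> \<le> 1" and b: "\<bar>b\<bar> \<le> B"
  shows "\<bar>a + b\<bar> powr q \<le> \<bar>a\<bar> powr q + q * B * (1 + B) powr (q - 1)"
proof -
  define u where "u = \<bar>a\<bar> + B"
  have B: "0 \<le> B" and u: "0 \<le> u" "\<bar>a\<bar> \<le> u"
    using b by (auto simp: u_def)
  have "\<bar>a + b\<bar> powr q \<le> u powr q"
    using b q by (intro powr_mono2) (auto simp: u_def)
  also have "u powr q \<le> \<bar>a\<bar> powr q + q * B * u powr (q - 1)"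
  proof (cases "q = 1")
    case True
    \<comment> \<open>Here \<open>u powr (q - 1)\<close> is \<open>u powr 0\<close>, which is 1
      except that \<open>0 powr 0 = 0\<close>; hence the separate case \<open>u = 0\<close>.\<close>
    show ?thesis
      using True u B by (cases "u = 0") (auto simp: u_def)
  next
    case False
    then have q1: "1 < q" using q by simp
    have "\<bar>a\<bar> * u powr (q - 1) \<le> \<bar>a\<bar> powr q / q + (u powr (q - 1)) powr (q / (q - 1)) / (q / (q - 1))"
      using q1 by (intro Youngs_inequality) (auto simp: field_simps)
    also have "(u powr (q - 1)) powr (q / (q - 1)) = u powr q"
      using q1 by (simp add: powr_powr)
    finally have "q * (\<bar>a\<bar> * u powr (q - 1)) \<le> \<bar>a\<bar> powr q + (q - 1) * u powr q"
      using q1 by (simp add: field_simps)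
    moreover have "u powr q = u * u powr (q - 1)"
      using u powr_add[of u 1 "q - 1"] by simp
    then have "q * B * u powr (q - 1) = q * u powr q - q * (\<bar>a\<bar> * u powr (q - 1))"
      by (simp add: u_def algebra_simps)
    ultimately show ?thesis
      by (simp add: algebra_simps)
  qed
  also have "u powr (q - 1) \<le> (1 + B) powr (q - 1)"
    using a q u by (intro powr_mono2) (auto simp: u_def)
  then have "\<bar>a\<bar> powr q + q * B * u powr (q - 1) \<le> \<bar>a\<bar> powr q + q * B * (1 + B) powr (q - 1)"
    using B q by (simp add: mult_left_mono)
  finally show ?thesis .
qed

lemma integrable_sphere_dist_powr_inner:
  fixes x v l :: "'a::euclidean_space"
  assumes x: "norm x < 1" and q: "0 < q"
  shows "integrable sphere_measure (\<lambda>\<eta>. norm (\<eta> - x) powr s)"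
    and "integrable sphere_measure (\<lambda>\<eta>. norm (\<eta> - x) powr s * \<bar>(\<eta> + v) \<bullet> l\<bar> powr q)"
proof -
  have "\<eta> - x \<noteq> 0" if "norm \<eta> = 1" for \<eta>
    using that x by auto
  then have c: "continuous_on (sphere 0 1) (\<lambda>\<eta>. norm (\<eta> - x) powr s)"
    by (intro continuous_intros) auto
  then show "integrable sphere_measure (\<lambda>\<eta>. norm (\<eta> - x) powr s)"
    by (rule integrable_sphere_continuous)
  show "integrable sphere_measure (\<lambda>\<eta>. norm (\<eta> - x) powr s * \<bar>(\<eta> + v) \<bullet> l\<bar> powr q)"
    using q by (intro integrable_sphere_continuous continuous_on_mult[OF c] continuous_on_powr' continuous_intros) auto
qed

lemma abs_inner_sphere_le_1:
  assumes "norm \<eta> = 1" "norm l = 1"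
  shows "\<bar>\<eta> \<bullet> l\<bar> \<le> 1"
  using Cauchy_Schwarz_ineq2[of \<eta> l] assms by simp

text \<open>The supremum in \<open>grad_bound\<close> is taken in the reals, where
  \<open>cSUP_upper\<close> asks for boundedness. Replacing
  \<open>\<bar>\<eta> \<bullet> l\<bar>\<close> by 1 bounds all directions by the same power
  mean.\<close>

lemma bdd_above_I_fun:
  fixes x :: "'a::euclidean_space"
  assumes x: "norm x < 1" and q: "0 < q"
  shows "bdd_above (I_fun \<alpha> q x ` sphere 0 1)"
proof (rule bdd_aboveI2)
  fix l :: 'a assume l: "l \<in> sphere 0 1"
  let ?s = "(real DIM('a) - \<alpha>) * q - 2 * real DIM('a) + 2"
  show "I_fun \<alpha> q x l \<le> (\<integral>\<eta>. norm (\<eta> - x) powr ?s \<partial>sphere_measure)"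
    unfolding I_fun_def
  proof (rule integral_mono)
    show "integrable sphere_measure (\<lambda>\<eta>. norm (\<eta> - x) powr ?s * \<bar>\<eta> \<bullet> l\<bar> powr q)"
      using integrable_sphere_dist_powr_inner(2)[OF x q, of ?s 0 l] by simp
    fix \<eta> :: 'a assume "\<eta> \<in> space sphere_measure"
    then have "\<bar>\<eta> \<bullet> l\<bar> powr q \<le> 1 powr q"
      using l q by (intro powr_mono2 abs_inner_sphere_le_1) auto
    then show "norm (\<eta> - x) powr ?s * \<bar>\<eta> \<bullet> l\<bar> powr q \<le> norm (\<eta> - x) powr ?s"
      by (simp add: mult_left_le)
  qed (rule integrable_sphere_dist_powr_inner(1)[OF x q])
qed

text \<open>With \<open>B = \<bar>c\<bar> * norm x\<close> the pointwise error is a constant, so its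
  integral is that constant times the power mean of exponent \<open>s\<close>. The first two
  parameters of the series in \<open>J_fun\<close> are \<open>- s / 2\<close> and
  \<open>1 - s / 2 - n / 2\<close>.\<close>

lemma integral_le_I_fun_plus_J_fun:
  fixes x l :: "'a::euclidean_space"
  assumes x: "norm x < 1" and q: "1 \<le> q" and \<alpha>: "\<alpha> < 1" and dim: "3 \<le> DIM('a)" and l: "norm l = 1"
  defines "n \<equiv> real DIM('a)"
  shows "(\<integral>\<eta>. norm (\<eta> - x) powr ((n - \<alpha>) * q - 2 * n + 2)
      * \<bar>(\<eta> + ((2 - \<alpha> - n) / (n - \<alpha>)) *\<^sub>R x) \<bullet> l\<bar> powr q \<partial>sphere_measure) \<le> I_fun \<alpha> q x l + J_fun \<alpha> q x"
proof -
  define c where "c = (2 - \<alpha> - n) / (n - \<alpha>)"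
  define s where "s = (n - \<alpha>) * q - 2 * n + 2"
  define B where "B = \<bar>c\<bar> * norm x"
  define b where "b = q * B * (1 + B) powr (q - 1)"
  have n: "0 < n - \<alpha>"
    using \<alpha> dim by (simp add: n_def)
  have q0: "0 < q"
    using q by simp
  note int = integrable_sphere_dist_powr_inner[OF x q0, of s]
  have int0: "integrable sphere_measure (\<lambda>\<eta>. norm (\<eta> - x) powr s * \<bar>\<eta> \<bullet> l\<bar> powr q)"
    using int(2)[of 0 l] by simp
  have "(\<integral>\<eta>. norm (\<eta> - x) powr s * \<bar>(\<eta> + c *\<^sub>R x) \<bullet> l\<bar> powr q \<partial>sphere_measure)
      \<le> (\<integral>\<eta>. norm (\<eta> - x) powr s * \<bar>\<eta> \<bullet> l\<bar> powr q + norm (\<eta> - x) powr s * b \<partial>sphere_measure)"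
  proof (rule integral_mono)
    fix \<eta> :: 'a assume "\<eta> \<in> space sphere_measure"
    then have \<eta>: "norm \<eta> = 1"
      by simp
    have "\<bar>(c *\<^sub>R x) \<bullet> l\<bar> \<le> B"
      using Cauchy_Schwarz_ineq2[of "c *\<^sub>R x" l] l by (simp add: B_def)
    then have "\<bar>\<eta> \<bullet> l + (c *\<^sub>R x) \<bullet> l\<bar> powr q \<le> \<bar>\<eta> \<bullet> l\<bar> powr q + b"
      unfolding b_def by (intro abs_add_powr_le q abs_inner_sphere_le_1 \<eta> l)
    then show "norm (\<eta> - x) powr s * \<bar>(\<eta> + c *\<^sub>R x) \<bullet> l\<bar> powr q
        \<le> norm (\<eta> - x) powr s * \<bar>\<eta> \<bullet> l\<bar> powr q + norm (\<eta> - x) powr s * b"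
      unfolding inner_add_left distrib_left[symmetric] by (rule mult_left_mono) simp
  qed (use int(2)[of "c *\<^sub>R x" l] int0 int(1) in auto)
  also have "\<dots> = I_fun \<alpha> q x l + (\<integral>\<eta>. norm (\<eta> - x) powr s \<partial>sphere_measure) * b"
    using int0 int(1) by (simp add: I_fun_def s_def n_def)
  also have "(\<integral>\<eta>. norm (\<eta> - x) powr s \<partial>sphere_measure) * b = J_fun \<alpha> q x"
  proof -
    have "(\<integral>\<eta>. norm (\<eta> - x) powr s \<partial>sphere_measure) = hyp2F1 (- s / 2) (1 - s / 2 - n / 2) (n / 2) ((norm x)\<^sup>2)"
      unfolding n_def using dim by (intro integral_sphere_dist_powr x) simp
    moreover have "- s / 2 = n - 1 - q * (n - \<alpha>) / 2" "1 - s / 2 - n / 2 = (n - q * (n - \<alpha>)) / 2"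
      by (simp_all add: s_def field_simps)
    moreover have "\<bar>c\<bar> = \<bar>2 - \<alpha> - n\<bar> / (n - \<alpha>)"
      using n by (simp add: c_def)
    ultimately show ?thesis
      unfolding J_fun_def Let_def n_def[symmetric] b_def B_def by (simp add: mult_ac)
  qed
  finally show ?thesis
    by (simp add: c_def s_def)
qed

section \<open>The gradient estimate and its sharpness\<close>

definition grad_coeff :: "real \<Rightarrow> real \<Rightarrow> 'a::euclidean_space \<Rightarrow> real" where
  "grad_coeff \<alpha> q x = (real DIM('a) - \<alpha>) * PS_const DIM('a) \<alpha>
     / (1 - (norm x)\<^sup>2) powr ((real DIM('a) * (q - 1) + 1) / q)"

lemma grad_bound_eq:
  "grad_bound \<alpha> q x = grad_coeff \<alpha> q x * ((SUP l\<in>sphere 0 1. I_fun \<alpha> q x l) + J_fun \<alpha> q x) powr (1 / q)"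
  by (simp add: grad_bound_def grad_coeff_def Let_def)

lemma grad_coeff_pos:
  fixes x :: "'a::euclidean_space"
  assumes "norm x < 1" "\<alpha> < 1" "3 \<le> DIM('a)"
  shows "0 < grad_coeff \<alpha> q x"
  unfolding grad_coeff_def using assms PS_const_pos[of \<alpha> "DIM('a)"] one_minus_norm_sq_pos[of x]
  by (intro divide_pos_pos mult_pos_pos) auto

lemma inner_grad_PS_integral:
  fixes x l :: "'a::euclidean_space"
  assumes x: "norm x < 1" and \<alpha>: "\<alpha> < real DIM('a)" and \<phi>: "integrable sphere_measure \<phi>"
  shows "grad (PS_integral \<alpha> \<phi>) x \<bullet> l = (\<integral>\<zeta>. \<phi> \<zeta> * (PS_kernel_grad \<alpha> x \<zeta> \<bullet> l) \<partial>sphere_measure)"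
  unfolding grad_eq[OF GDERIV_PS_integral(2)[OF x \<alpha> \<phi>]]
  using integral_inner_left[OF GDERIV_PS_integral(1)[OF x \<alpha> \<phi>], of l] by simp

text \<open>Testing along the direction \<open>l\<close> of the gradient itself turns its norm into
  a linear functional of \<open>\<phi>\<close>, to which Hoelder's inequality applies.\<close>

lemma norm_grad_PS_integral_le:
  fixes x :: "'a::euclidean_space"
  assumes dim: "3 \<le> DIM('a)" and \<alpha>: "\<alpha> < 1" and pq: "conjugate_exponents p q"
    and \<phi>: "in_Lp sphere_measure p \<phi>" and x: "norm x < 1"
  shows "norm (grad (PS_integral \<alpha> \<phi>) x) \<le> grad_bound \<alpha> q x * Lp_norm sphere_measure p \<phi>"
proof -
  interpret prob_space "sphere_measure :: 'a measure"
    by (rule prob_space_sphere_measure)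
  have q: "1 \<le> q"
    using pq by (simp add: conjugate_exponents_def)
  have \<alpha>n: "\<alpha> < real DIM('a)"
    using \<alpha> dim by simp
  define G where "G = grad (PS_integral \<alpha> \<phi>) x"
  define k where "k = grad_coeff \<alpha> q x"
  have k: "0 < k"
    unfolding k_def by (rule grad_coeff_pos[OF x \<alpha> dim])
  show ?thesis
  proof (cases "G = 0")
    case True
    then show ?thesis
      using k Lp_norm_nonneg[OF \<phi>] unfolding G_def grad_bound_eq k_def by simp
  next
    case False
    define l where "l = sgn G"
    have l: "norm l = 1"
      using False by (simp add: l_def norm_sgn)
    define S where "S = (\<integral>\<eta>. norm (\<eta> - x) powr ((real DIM('a) - \<alpha>) * q - 2 * real DIM('a) + 2)
          * \<bar>(\<eta> + ((2 - \<alpha> - real DIM('a)) / (real DIM('a) - \<alpha>)) *\<^sub>R x) \<bullet> l\<bar> powr q \<partial>(sphere_measure :: 'a measure))"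
    have "0 \<le> S"
      by (simp add: S_def)
    have "S \<le> I_fun \<alpha> q x l + J_fun \<alpha> q x"
      unfolding S_def by (rule integral_le_I_fun_plus_J_fun[OF x q \<alpha> dim l])
    also have "\<dots> \<le> (SUP l\<in>sphere 0 1. I_fun \<alpha> q x l) + J_fun \<alpha> q x"
      using q l by (intro add_right_mono cSUP_upper bdd_above_I_fun x) auto
    finally have S: "S \<le> (SUP l\<in>sphere 0 1. I_fun \<alpha> q x l) + J_fun \<alpha> q x" .
    have "norm G = G \<bullet> l"
      using False by (simp add: l_def sgn_div_norm dot_square_norm power2_eq_square)
    also have "\<dots> = (\<integral>\<zeta>. \<phi> \<zeta> * (PS_kernel_grad \<alpha> x \<zeta> \<bullet> l) \<partial>sphere_measure)"
      unfolding G_def by (rule inner_grad_PS_integral[OF x \<alpha>n in_Lp_imp_integrable[OF pq \<phi>]])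
    also have "\<dots> \<le> (\<integral>\<zeta>. \<bar>PS_kernel_grad \<alpha> x \<zeta> \<bullet> l\<bar> powr q \<partial>sphere_measure) powr (1 / q) * Lp_norm sphere_measure p \<phi>"
    proof (rule order_trans[OF abs_ge_self Hoelder_inequality[OF pq \<phi>]])
      show "(\<lambda>\<zeta>. PS_kernel_grad \<alpha> x \<zeta> \<bullet> l) \<in> borel_measurable sphere_measure"
        by (intro borel_measurable_sphere_continuous continuous_intros continuous_on_PS_kernel_grad x)
      show "integrable sphere_measure (\<lambda>\<zeta>. \<bar>PS_kernel_grad \<alpha> x \<zeta> \<bullet> l\<bar> powr q)"
        using q by (intro integrable_PS_kernel_grad_powr x) simp
    qed
    also have "(\<integral>\<zeta>. \<bar>PS_kernel_grad \<alpha> x \<zeta> \<bullet> l\<bar> powr q \<partial>sphere_measure) = k powr q * S"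
      unfolding S_def k_def grad_coeff_def by (rule integral_PS_kernel_grad_powr[OF x q \<alpha> dim])
    also have "(k powr q * S) powr (1 / q) = k * S powr (1 / q)"
      using k q \<open>0 \<le> S\<close> by (simp add: powr_mult powr_powr)
    also have "k * S powr (1 / q) * Lp_norm sphere_measure p \<phi> \<le> grad_bound \<alpha> q x * Lp_norm sphere_measure p \<phi>"
      unfolding grad_bound_eq k_def[symmetric] using S k q \<open>0 \<le> S\<close>
      by (intro mult_right_mono mult_left_mono powr_mono2 Lp_norm_nonneg[OF \<phi>]) auto
    finally show ?thesis
      by (simp add: G_def)
  qed
qed

text \<open>In both cases \<open>c *\<^sub>R x = 0\<close> and \<open>J_fun\<close> is 0, so the
  power integral of the kernel gradient along \<open>l\<close> is exactly a multiple of
  \<open>I_fun\<close>. By \<open>Hoelder_extremal\<close> every admissible constant dominates its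
  root for each \<open>l\<close>.\<close>

lemma grad_bound_eq_opt_const:
  fixes x :: "'a::euclidean_space"
  assumes dim: "3 \<le> DIM('a)" and \<alpha>: "\<alpha> < 1" and pq: "conjugate_exponents p q" and x: "norm x < 1"
    and sharp: "x = 0 \<or> \<alpha> = 2 - real DIM('a)"
  shows "grad_bound \<alpha> q x = opt_const \<alpha> p x"
proof -
  interpret prob_space "sphere_measure :: 'a measure"
    by (rule prob_space_sphere_measure)
  have q: "1 \<le> q"
    using pq by (simp add: conjugate_exponents_def)
  have \<alpha>n: "\<alpha> < real DIM('a)"
    using \<alpha> dim by simp
  define k where "k = grad_coeff \<alpha> q x"
  have k: "0 < k"
    unfolding k_def by (rule grad_coeff_pos[OF x \<alpha> dim])
  have J: "J_fun \<alpha> q x = 0"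
    using sharp by (auto simp: J_fun_def Let_def)
  have cx: "((2 - \<alpha> - real DIM('a)) / (real DIM('a) - \<alpha>)) *\<^sub>R x = 0"
    using sharp by auto
  have I0: "0 \<le> I_fun \<alpha> q x l" for l
    by (simp add: I_fun_def)
  have "grad_bound \<alpha> q x \<le> K"
    if K: "\<forall>\<phi>. in_Lp sphere_measure p \<phi> \<longrightarrow> norm (grad (PS_integral \<alpha> \<phi>) x) \<le> K * Lp_norm sphere_measure p \<phi>" for K
  proof -
    have le: "k * I_fun \<alpha> q x l powr (1 / q) \<le> K" if l: "l \<in> sphere 0 1" for l
    proof -
      have "(\<integral>\<zeta>. \<bar>PS_kernel_grad \<alpha> x \<zeta> \<bullet> l\<bar> powr q \<partial>sphere_measure) powr (1 / q) \<le> K"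
      proof (rule Hoelder_extremal[OF pq])
        show "(\<lambda>\<zeta>. PS_kernel_grad \<alpha> x \<zeta> \<bullet> l) \<in> borel_measurable sphere_measure"
          by (intro borel_measurable_sphere_continuous continuous_intros continuous_on_PS_kernel_grad x)
        show "integrable sphere_measure (\<lambda>\<zeta>. \<bar>PS_kernel_grad \<alpha> x \<zeta> \<bullet> l\<bar> powr q)"
          using q by (intro integrable_PS_kernel_grad_powr x) simp
        fix f :: "'a \<Rightarrow> real" assume f: "in_Lp sphere_measure p f"
        have "\<bar>\<integral>\<zeta>. f \<zeta> * (PS_kernel_grad \<alpha> x \<zeta> \<bullet> l) \<partial>sphere_measure\<bar> = \<bar>grad (PS_integral \<alpha> f) x \<bullet> l\<bar>"
          by (simp only: inner_grad_PS_integral[OF x \<alpha>n in_Lp_imp_integrable[OF pq f]])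
        also have "\<dots> \<le> norm (grad (PS_integral \<alpha> f) x)"
          using Cauchy_Schwarz_ineq2[of "grad (PS_integral \<alpha> f) x" l] l by simp
        also have "\<dots> \<le> K * Lp_norm sphere_measure p f"
          using K f by blast
        finally show "\<bar>\<integral>\<zeta>. f \<zeta> * (PS_kernel_grad \<alpha> x \<zeta> \<bullet> l) \<partial>sphere_measure\<bar> \<le> K * Lp_norm sphere_measure p f" .
      qed
      moreover have "(\<integral>\<zeta>. \<bar>PS_kernel_grad \<alpha> x \<zeta> \<bullet> l\<bar> powr q \<partial>sphere_measure) = k powr q * I_fun \<alpha> q x l"
        unfolding integral_PS_kernel_grad_powr[OF x q \<alpha> dim] cx k_def grad_coeff_def I_fun_def by simp
      ultimately show ?thesis
        using k q I0[of l] by (simp add: powr_mult powr_powr)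
    qed
    obtain e :: 'a where e: "e \<in> sphere 0 1"
      using vector_choose_size[of 1] by (metis mem_sphere_0 zero_le_one)
    have "0 \<le> k * I_fun \<alpha> q x e powr (1 / q)"
      using k by simp
    then have K0: "0 \<le> K"
      using le[OF e] by linarith
    \<comment> \<open>The root is undone before the supremum is taken and restored afterwards, so
      that \<open>powr\<close> and the supremum never have to be interchanged.\<close>
    have "I_fun \<alpha> q x l \<le> (K / k) powr q" if l: "l \<in> sphere 0 1" for l
    proof -
      have "(I_fun \<alpha> q x l powr (1 / q)) powr q \<le> (K / k) powr q"
        using le[OF l] k q by (intro powr_mono2) (auto simp: field_simps)
      then show ?thesis
        using q I0[of l] by (simp add: powr_powr)
    qed
    then have sup: "(SUP l\<in>sphere 0 1. I_fun \<alpha> q x l) \<le> (K / k) powr q"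
      using e by (intro cSUP_least) auto
    have "0 \<le> (SUP l\<in>sphere 0 1. I_fun \<alpha> q x l)"
      using q by (intro order_trans[OF I0 cSUP_upper[OF e]] bdd_above_I_fun x) auto
    with sup have "(SUP l\<in>sphere 0 1. I_fun \<alpha> q x l) powr (1 / q) \<le> ((K / k) powr q) powr (1 / q)"
      using q by (intro powr_mono2) auto
    also have "\<dots> = K / k"
      using q K0 k by (simp add: powr_powr)
    finally show ?thesis
      unfolding grad_bound_eq J k_def[symmetric] using k by (simp add: field_simps)
  qed
  moreover have "grad_bound \<alpha> q x \<in> {K. \<forall>\<phi>. in_Lp sphere_measure p \<phi> \<longrightarrow>
      norm (grad (PS_integral \<alpha> \<phi>) x) \<le> K * Lp_norm sphere_measure p \<phi>}"
    using norm_grad_PS_integral_le[OF dim \<alpha> pq _ x] by blast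
  \<comment> \<open>The bound is itself admissible, so the infimum defining \<open>opt_const\<close>
    is a minimum.\<close>
  ultimately show ?thesis
    unfolding opt_const_def by (intro cInf_eq_minimum[symmetric]) auto
qed

text \<open>The differentiability conjunct certifies that \<open>grad\<close>, defined by choice, is
  the true gradient of the integral at \<open>x\<close>, which gives the estimate its
  meaning.\<close>

theorem theorem1p1:
  fixes \<alpha> q :: real and p :: ereal and \<phi> :: "'a::euclidean_space \<Rightarrow> real" and x :: 'a
  assumes "DIM('a) \<ge> 3"
    and "\<alpha> < 1"
    and "1 < p"
    and "q \<ge> 1"
    and "(p = \<infinity> \<and> q = 1) \<or> (p \<noteq> \<infinity> \<and> 1 / real_of_ereal p + 1 / q = 1)"
    and "in_Lp sphere_measure p \<phi>"
    and "x \<in> ball 0 1"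
  shows "GDERIV (PS_integral \<alpha> \<phi>) x :> grad (PS_integral \<alpha> \<phi>) x
      \<and> norm (grad (PS_integral \<alpha> \<phi>) x) \<le> grad_bound \<alpha> q x * Lp_norm sphere_measure p \<phi>
      \<and> ((x = 0 \<or> \<alpha> = 2 - real DIM('a)) \<longrightarrow> grad_bound \<alpha> q x = opt_const \<alpha> p x)"
proof -
  have pq: "conjugate_exponents p q"
    using assms by (simp add: conjugate_exponents_def)
  have x: "norm x < 1"
    using assms by simp
  have "integrable sphere_measure \<phi>"
    by (rule prob_space.in_Lp_imp_integrable[OF prob_space_sphere_measure pq assms(6)])
  then have "GDERIV (PS_integral \<alpha> \<phi>) x :> (\<integral>\<zeta>. \<phi> \<zeta> *\<^sub>R PS_kernel_grad \<alpha> x \<zeta> \<partial>sphere_measure)"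
    using assms(1,2) by (intro GDERIV_PS_integral(2) x) auto
  then show ?thesis
    using grad_eq norm_grad_PS_integral_le[OF assms(1,2) pq assms(6) x]
      grad_bound_eq_opt_const[OF assms(1,2) pq x] by metis
qed

end
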